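(* Let $\lambda>0$, $\gamma>0$. For $\omega>0$, the nonzero functions $\phi_\omega\in D(H_2)$ satisfying $$H_2\phi_\omega-\lambda|\phi_\omega|^2\phi_\omega+\omega\phi_\omega=0$$ (i.e. the profiles of the stationary states $\psi(t,x)=e^{i\omega t}\phi_\omega(x)$ of $i\partial_t\psi=H_2\psi-\lambda|\psi|^2\psi$) are, up to multiplication by a constant phase factor $e^{i\theta}$, $\theta\in\mathbb R$, exactly the following. (1) The unperturbed symmetric solitary wave, present for every $\omega>0$: $$\psi_\omega^{0,0}(x)=\sqrt{\tfrac{2\omega}{\lambda}}\,\operatorname{sech}(\sqrt\omega\,x).$$ (2) The asymmetric non-changing sign solutions, present for every $\omega>0$ (two of them, one for each choice of the sign $\pm$): $$\psi_{\omega,+}^{x_{1\pm},x_{2\pm}}(x)=\begin{cases}\sqrt{\frac{2\omega}{\lambda}}\,\operatorname{sech}(\sqrt\omega(x-x_{1\pm})),&x<0,\\[2pt] \sqrt{\frac{2\omega}{\lambda}}\,\operatorname{sech}(\sqrt\omega(x-x_{2\pm})),&x>0,\end{cases}$$ $$x_{1+}=\tfrac1{2\sqrt\omega}\log\tfrac{1+t_1}{1-t_1},\quad x_{2+}=\tfrac1{2\sqrt\omega}\log\tfrac{1+t_2}{1-t_2},\quad x_{1-}=-\tfrac1{2\sqrt\omega}\log\tfrac{1+t_2}{1-t_2},\quad x_{2-}=-\tfrac1{2\sqrt\omega}\log\tfrac{1+t_1}{1-t_1},$$ where $(t_1,t_2)$, with $0\le t_1,t_2\le1$, solves the system $t_1^2-t_1^4=t_2^2-t_2^4$,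 $\;t_1^{-1}-t_2^{-1}=\gamma\sqrt\omega$. (3) The changing sign solutions, which are: (a) the antisymmetric solution, present for $\omega>\frac4{\gamma^2}$: $$\psi_{\omega,-}^{\bar x,-\bar x}(x)=\begin{cases}-\sqrt{\frac{2\omega}{\lambda}}\,\operatorname{sech}(\sqrt\omega(x-\bar x)),&x<0,\\[2pt] \sqrt{\frac{2\omega}{\lambda}}\,\operatorname{sech}(\sqrt\omega(x+\bar x)),&x>0,\end{cases}\qquad \bar x=\frac1{2\sqrt\omega}\log\frac{\gamma\sqrt\omega+2}{\gamma\sqrt\omega-2};$$ (b) the asymmetric solutions, present for $\omega>\frac8{\gamma^2}$ (two of them, one for each choice of the sign $\pm$): $$\psi_{\omega,-}^{\bar x_{1\pm},\bar x_{2\pm}}(x)=\begin{cases}\sqrt{\frac{2\omega}{\lambda}}\,\operatorname{sech}(\sqrt\omega(x-\bar x_{1\pm})),&x<0,\\[2pt] -\sqrt{\frac{2\omega}{\lambda}}\,\operatorname{sech}(\sqrt\omega(x-\bar x_{2\pm})),&x>0,\end{cases}$$ $$\bar x_{1+}=\tfrac1{2\sqrt\omega}\log\tfrac{1+t_1}{1-t_1},\quad \bar x_{2+}=-\tfrac1{2\sqrt\omega}\log\tfrac{1+t_2}{1-t_2},\quad \bar x_{1-}=\tfrac1{2\sqrt\omega}\log\tfrac{1+t_2}{1-t_2},\quad \bar x_{2-}=-\tfrac1{2\sqrt\omega}\log\tfrac{1+t_1}{1-t_1},$$ where $(t_1,t_2)$, with $0\le t_1,t_2\le1$ and $t_1>t_2$,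 solves the system $t_1^2-t_1^4=t_2^2-t_2^4$, $\;t_1^{-1}+t_2^{-1}=\gamma\sqrt\omega$.
   Context: For $\gamma>0$, $H_2$ is the operator with domain $$D(H_2)=\{\psi\in H^2(\mathbb R\setminus\{0\}):\ \psi'(0+)=\psi'(0-),\ \psi(0+)-\psi(0-)=-\gamma\psi'(0+)\}$$ acting as $(H_2\psi)(x)=-\psi''(x)$ for $x\ne0$ (attractive delta prime interaction of strength $\gamma$ at the origin). Equivalently, the stationary equation reads $-\phi''-\lambda|\phi|^2\phi+\omega\phi=0$ for $x\neq0$ together with $\phi'(0+)=\phi'(0-)$ and $\phi(0+)-\phi(0-)=-\gamma\phi'(0+)$. Stationary states are square integrable and, by definition, have $\omega>0$. *)

theory Defs
  imports "HOL-Analysis.Analysis"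
begin

section \<open>Sobolev spaces of complex-valued functions on an open subset of the line\<close>

definition test_function :: "real set \<Rightarrow> (real \<Rightarrow> real) \<Rightarrow> bool" where
  "test_function \<Omega> \<eta> \<longleftrightarrow>
     (\<forall>n x. (deriv ^^ n) \<eta> differentiable (at x)) \<and>
     compact (closure {x. \<eta> x \<noteq> 0}) \<and> closure {x. \<eta> x \<noteq> 0} \<subseteq> \<Omega>"

definition locally_integrable :: "real set \<Rightarrow> (real \<Rightarrow> complex) \<Rightarrow> bool" where
  "locally_integrable \<Omega> u \<longleftrightarrow>
     (\<forall>K. compact K \<and> K \<subseteq> \<Omega> \<longrightarrow> set_integrable lebesgue K u)"

definition is_weak_deriv :: "real set \<Rightarrow> (real \<Rightarrow> complex) \<Rightarrow> (real \<Rightarrow> complex) \<Rightarrow> bool" where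
  "is_weak_deriv \<Omega> u v \<longleftrightarrow>
     locally_integrable \<Omega> u \<and> locally_integrable \<Omega> v \<and>
     (\<forall>\<eta>. test_function \<Omega> \<eta> \<longrightarrow>
        (LINT x:\<Omega>|lebesgue. deriv \<eta> x *\<^sub>R u x) = - (LINT x:\<Omega>|lebesgue. \<eta> x *\<^sub>R v x))"

text \<open>A weak derivative is unique only up to null sets; every use below is insensitive to the
  representative that is chosen.\<close>

definition weak_deriv :: "real set \<Rightarrow> (real \<Rightarrow> complex) \<Rightarrow> real \<Rightarrow> complex" where
  "weak_deriv \<Omega> u = (SOME v. is_weak_deriv \<Omega> u v)"

definition in_L2 :: "real set \<Rightarrow> (real \<Rightarrow> complex) \<Rightarrow> bool" where
  "in_L2 \<Omega> u \<longleftrightarrow>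
     set_borel_measurable lebesgue \<Omega> u \<and> set_integrable lebesgue \<Omega> (\<lambda>x. (cmod (u x))\<^sup>2)"

definition in_H2 :: "real set \<Rightarrow> (real \<Rightarrow> complex) \<Rightarrow> bool" where
  "in_H2 \<Omega> u \<longleftrightarrow>
     in_L2 \<Omega> u \<and>
     (\<exists>v w. is_weak_deriv \<Omega> u v \<and> in_L2 \<Omega> v \<and> is_weak_deriv \<Omega> v w \<and> in_L2 \<Omega> w)"

definition continuous_rep :: "real set \<Rightarrow> (real \<Rightarrow> complex) \<Rightarrow> (real \<Rightarrow> complex) \<Rightarrow> bool" where
  "continuous_rep \<Omega> u g \<longleftrightarrow> continuous_on \<Omega> g \<and> (AE x in lebesgue. x \<in> \<Omega> \<longrightarrow> u x = g x)"


section \<open>The Schroedinger operator with attractive delta prime interaction at the origin\<close>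

abbreviation punctured_line :: "real set" where
  "punctured_line \<equiv> - {0}"

text \<open>The boundary values \<open>\<psi>(0\<plusminus>)\<close> and \<open>\<psi>'(0\<plusminus>)\<close> are the one-sided
  limits of the continuous representatives \<open>g\<close> of \<open>\<psi>\<close> and \<open>h\<close> of \<open>\<psi>'\<close>.\<close>

definition dom_delta_prime :: "real \<Rightarrow> (real \<Rightarrow> complex) \<Rightarrow> bool" where
  "dom_delta_prime \<gamma> \<psi> \<longleftrightarrow>
     in_H2 punctured_line \<psi> \<and>
     (\<exists>g h l r dl dr.
        continuous_rep punctured_line \<psi> g \<and>
        continuous_rep punctured_line (weak_deriv punctured_line \<psi>) h \<and>
        (g \<longlongrightarrow> l) (at_left 0) \<and> (g \<longlongrightarrow> r) (at_right 0) \<and>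
        (h \<longlongrightarrow> dl) (at_left 0) \<and> (h \<longlongrightarrow> dr) (at_right 0) \<and>
        dr = dl \<and> r - l = - of_real \<gamma> * dr)"

definition delta_prime_op :: "(real \<Rightarrow> complex) \<Rightarrow> real \<Rightarrow> complex" where
  "delta_prime_op \<psi> = (\<lambda>x. - weak_deriv punctured_line (weak_deriv punctured_line \<psi>) x)"

text \<open>Elements of the domain are functions modulo null sets, so ``nonzero'' means ``not zero
  almost everywhere'', and the equation is one in \<open>L\<^sup>2\<close>.\<close>

definition stationary_profile :: "real \<Rightarrow> real \<Rightarrow> real \<Rightarrow> (real \<Rightarrow> complex) \<Rightarrow> bool" where
  "stationary_profile lam \<gamma> \<omega> \<phi> \<longleftrightarrow>
     dom_delta_prime \<gamma> \<phi> \<and>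
     \<not> (AE x in lebesgue. \<phi> x = 0) \<and>
     (AE x in lebesgue.
        delta_prime_op \<phi> x - of_real lam * of_real ((cmod (\<phi> x))\<^sup>2) * \<phi> x
          + of_real \<omega> * \<phi> x = 0)"

definition equal_up_to_phase :: "(real \<Rightarrow> complex) \<Rightarrow> (real \<Rightarrow> complex) \<Rightarrow> bool" where
  "equal_up_to_phase \<phi> \<psi> \<longleftrightarrow> (\<exists>\<theta>::real. AE x in lebesgue. \<phi> x = cis \<theta> * \<psi> x)"


section \<open>Solitary waves\<close>

definition sech :: "real \<Rightarrow> real" where
  "sech x = 1 / cosh x"

definition soliton :: "real \<Rightarrow> real \<Rightarrow> real \<Rightarrow> real \<Rightarrow> complex" where
  "soliton lam \<omega> y = (\<lambda>x. of_real (sqrt (2 * \<omega> / lam) * sech (sqrt \<omega> * (x - y))))"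

text \<open>The value assigned at the origin is immaterial, functions being considered modulo null
  sets.\<close>

definition same_sign_profile :: "real \<Rightarrow> real \<Rightarrow> real \<Rightarrow> real \<Rightarrow> real \<Rightarrow> complex" where
  "same_sign_profile lam \<omega> x1 x2 =
     (\<lambda>x. if x < 0 then soliton lam \<omega> x1 x else soliton lam \<omega> x2 x)"

definition minus_plus_profile :: "real \<Rightarrow> real \<Rightarrow> real \<Rightarrow> real \<Rightarrow> real \<Rightarrow> complex" where
  "minus_plus_profile lam \<omega> x1 x2 =
     (\<lambda>x. if x < 0 then - soliton lam \<omega> x1 x else soliton lam \<omega> x2 x)"

definition plus_minus_profile :: "real \<Rightarrow> real \<Rightarrow> real \<Rightarrow> real \<Rightarrow> real \<Rightarrow> complex" where
  "plus_minus_profile lam \<omega> x1 x2 =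
     (\<lambda>x. if x < 0 then soliton lam \<omega> x1 x else - soliton lam \<omega> x2 x)"

definition shift :: "real \<Rightarrow> real \<Rightarrow> real" where
  "shift \<omega> t = 1 / (2 * sqrt \<omega>) * ln ((1 + t) / (1 - t))"

definition antisym_shift :: "real \<Rightarrow> real \<Rightarrow> real" where
  "antisym_shift \<gamma> \<omega> =
     1 / (2 * sqrt \<omega>) * ln ((\<gamma> * sqrt \<omega> + 2) / (\<gamma> * sqrt \<omega> - 2))"

text \<open>In both systems \<open>t1, t2 \<noteq> 0\<close> is implicit in the occurrence of the inverses; it has to be
  spelled out because \<open>inverse 0 = 0\<close> would otherwise admit spurious solutions such as
  \<open>t1 = 1, t2 = 0\<close>.\<close>

definition same_sign_system :: "real \<Rightarrow> real \<Rightarrow> real \<Rightarrow> real \<Rightarrow> bool" where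
  "same_sign_system \<gamma> \<omega> t1 t2 \<longleftrightarrow>
     0 \<le> t1 \<and> t1 \<le> 1 \<and> 0 \<le> t2 \<and> t2 \<le> 1 \<and> t1 \<noteq> 0 \<and> t2 \<noteq> 0 \<and>
     t1^2 - t1^4 = t2^2 - t2^4 \<and> inverse t1 - inverse t2 = \<gamma> * sqrt \<omega>"

definition changing_sign_system :: "real \<Rightarrow> real \<Rightarrow> real \<Rightarrow> real \<Rightarrow> bool" where
  "changing_sign_system \<gamma> \<omega> t1 t2 \<longleftrightarrow>
     0 \<le> t1 \<and> t1 \<le> 1 \<and> 0 \<le> t2 \<and> t2 \<le> 1 \<and> t1 \<noteq> 0 \<and> t2 \<noteq> 0 \<and> t1 > t2 \<and>
     t1^2 - t1^4 = t2^2 - t2^4 \<and> inverse t1 + inverse t2 = \<gamma> * sqrt \<omega>"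

end

theory Submission
  imports Defs
begin

text \<open>
  On each half line the stationary equation is the autonomous Newton equation
  \<open>g'' = (\<omega> - \<lambda> |g|\<^sup>2) g\<close>, so the operator at the origin only decides how two half line solutions
  may be glued. The proof has four ingredients.

  \<^emph>\<open>Regularity.\<close> A profile in the domain satisfies the equation only weakly. Testing against a smooth
  approximation of the indicator of \<open>(a, b]\<close> shows that a weak derivative between continuous functions
  is a classical one (\<open>weak_deriv_imp_derivative\<close>): the derivative of the cutoff consists of two bumps that
  concentrate at \<open>a\<close> and \<open>b\<close>. The same cutoffs show that weak derivatives are unique up to null sets
  (\<open>weak_deriv_unique\<close>), which makes the choice hidden in \<open>weak_deriv\<close> harmless. Since the equation
  expresses the second weak derivative through the continuous representative, that representative
  solves the differential equation classically off the origin.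

  \<^emph>\<open>Half line solutions.\<close> The energy \<open>|h|\<^sup>2 - \<omega> |g|\<^sup>2 + (\<lambda>/2) |g|\<^sup>4\<close> and the angular momentum of
  \<open>(g, h) = (g, g')\<close> in the plane are conserved. Square integrability forces \<open>|g|\<^sup>2 + |h|\<^sup>2\<close> to
  become arbitrarily small somewhere, so both invariants vanish. Then \<open>g\<close> has constant phase, and at
  any point where \<open>g\<close> does not vanish some translated and rotated soliton has the same position and
  velocity; where \<open>g\<close> vanishes the zero solution does. As the energy bounds \<open>|g|\<close>, the force is
  Lipschitz along solutions and a Gronwall argument gives uniqueness
  (\<open>nls_solution_classification\<close>).

  \<^emph>\<open>Matching.\<close> A vanishing half would force vanishing data on the other side. So both halves are
  solitons, and with \<open>T = tanh (\<surd>\<omega> y)\<close> and \<open>S = sech (\<surd>\<omega> y)\<close> the boundary conditions become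
  \<open>c\<^sub>1 T\<^sub>1 S\<^sub>1 = c\<^sub>2 T\<^sub>2 S\<^sub>2\<close> and \<open>c\<^sub>2 S\<^sub>2 - c\<^sub>1 S\<^sub>1 = - \<gamma> \<surd>\<omega> c\<^sub>2 T\<^sub>2 S\<^sub>2\<close>. These force
  \<open>c\<^sub>1 = \<plusminus> c\<^sub>2\<close>. Squaring the first and dividing the second by \<open>T S\<close> yields the
  algebraic systems for \<open>T\<^sub>1\<close>, \<open>T\<^sub>2\<close>, the symmetric soliton being the degenerate case \<open>T\<^sub>1 = T\<^sub>2 = 0\<close>
  (\<open>delta_prime_matching_iff\<close>). Conversely every matched pair of solitons decays exponentially
  and integration by parts puts it in the domain.

  \<^emph>\<open>The algebraic systems.\<close> Since \<open>t\<^sub>1\<^sup>2 \<noteq> t\<^sub>2\<^sup>2\<close>, the quartic equation says \<open>t\<^sub>1\<^sup>2 + t\<^sub>2\<^sup>2 = 1\<close>. The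
  product \<open>p = t\<^sub>1 t\<^sub>2\<close> then satisfies a quadratic equation with exactly one positive root,
  and \<open>t\<^sub>1\<close>, \<open>t\<^sub>2\<close> are recovered from their product and their difference or sum.
\<close>

section \<open>Smooth cutoff functions\<close>

primrec smooth_upto :: "nat \<Rightarrow> (real \<Rightarrow> real) \<Rightarrow> bool" where
  "smooth_upto 0 f \<longleftrightarrow> (\<forall>x. f differentiable at x)"
| "smooth_upto (Suc n) f \<longleftrightarrow> (\<forall>x. f differentiable at x) \<and> smooth_upto n (deriv f)"

text \<open>
  The recursive form of smoothness makes closure properties provable by induction on the order; this
  equivalence translates it to iterated derivatives.
\<close>

lemma smooth_upto_iff: "smooth_upto n f \<longleftrightarrow> (\<forall>k\<le>n. \<forall>x. (deriv ^^ k) f differentiable at x)"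
proof (induction n arbitrary: f)
  case (Suc n)
  have "(\<forall>k\<le>Suc n. P k) \<longleftrightarrow> P 0 \<and> (\<forall>k\<le>n. P (Suc k))" for P
    by (metis Suc_le_mono bot_nat_0.extremum nat.exhaust)
  then show ?case
    by (simp add: Suc.IH funpow_Suc_right del: funpow.simps)
qed simp

lemma smooth_upto_differentiable: "smooth_upto n f \<Longrightarrow> f differentiable at x"
  by (cases n) auto

lemma smooth_upto_Suc_D: "smooth_upto (Suc n) f \<Longrightarrow> smooth_upto n f"
  by (simp add: smooth_upto_iff)

lemma smooth_upto_deriv: "smooth_upto (Suc n) f \<Longrightarrow> smooth_upto n (deriv f)"
  by simp

lemma has_deriv_of_smooth_upto: "smooth_upto n f \<Longrightarrow> (f has_real_derivative deriv f x) (at x)"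
  using smooth_upto_differentiable DERIV_deriv_iff_real_differentiable by blast

lemma smooth_upto_SucI:
  assumes "\<And>x. (f has_real_derivative f' x) (at x)" "smooth_upto n f'"
  shows "smooth_upto (Suc n) f"
proof -
  have "deriv f = f'"
    using assms(1) by (auto intro: DERIV_imp_deriv)
  then show ?thesis
    using assms by (auto simp: real_differentiable_def)
qed

lemma smooth_upto_add:
  "smooth_upto n f \<Longrightarrow> smooth_upto n g \<Longrightarrow> smooth_upto n (\<lambda>x. f x + g x)"
proof (induction n arbitrary: f g)
  case 0
  then show ?case by simp
next
  case (Suc n)
  have "smooth_upto n (\<lambda>x. deriv f x + deriv g x)"
    using Suc.prems by (intro Suc.IH smooth_upto_deriv)
  then show ?case
    by (rule smooth_upto_SucI[rotated])
      (intro DERIV_add has_deriv_of_smooth_upto[OF Suc.prems(1)]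
        has_deriv_of_smooth_upto[OF Suc.prems(2)])
qed

lemma smooth_upto_mult:
  "smooth_upto n f \<Longrightarrow> smooth_upto n g \<Longrightarrow> smooth_upto n (\<lambda>x. f x * g x)"
proof (induction n arbitrary: f g)
  case 0
  then show ?case by simp
next
  case (Suc n)
  have "smooth_upto n (\<lambda>x. deriv f x * g x + deriv g x * f x)"
    using Suc.prems smooth_upto_Suc_D[OF Suc.prems(1)] smooth_upto_Suc_D[OF Suc.prems(2)]
    by (intro smooth_upto_add Suc.IH smooth_upto_deriv)
  then show ?case
    by (rule smooth_upto_SucI[rotated])
      (intro DERIV_mult has_deriv_of_smooth_upto[OF Suc.prems(1)]
        has_deriv_of_smooth_upto[OF Suc.prems(2)])
qed

lemma smooth_upto_const: "smooth_upto n (\<lambda>x. c)"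
  by (induction n arbitrary: c) (simp, rule smooth_upto_SucI[OF DERIV_const])

text \<open>
  The derivative of \<open>1/f\<close> contains \<open>1/f\<close> itself only to a lower order of smoothness, which is what
  the induction hypothesis provides.
\<close>

lemma smooth_upto_inverse:
  assumes "smooth_upto n f" "\<And>x. f x \<noteq> 0"
  shows "smooth_upto n (\<lambda>x. inverse (f x))"
  using assms(1)
proof (induction n)
  case 0
  then show ?case using assms(2) by (auto intro: differentiable_inverse)
next
  case (Suc n)
  have "smooth_upto n (\<lambda>x. (-1) * ((inverse (f x) * deriv f x) * inverse (f x)))"
    using Suc.prems smooth_upto_Suc_D[OF Suc.prems]
    by (intro smooth_upto_mult smooth_upto_const smooth_upto_deriv Suc.IH)
  then show ?case
    by (rule smooth_upto_SucI[rotated])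
      (use Suc.prems assms(2) in
        \<open>auto intro!: DERIV_inverse' has_deriv_of_smooth_upto[where n="Suc n"] simp del: smooth_upto.simps\<close>)
qed

lemma smooth_upto_affine:
  "smooth_upto n f \<Longrightarrow> smooth_upto n (\<lambda>x. f (c * x + d))"
proof (induction n arbitrary: f)
  case 0
  have "((\<lambda>x. f (c * x + d)) has_real_derivative deriv f (c * x + d) * c) (at x)" for x
    by (rule DERIV_chain2[OF has_deriv_of_smooth_upto[OF 0]]) (auto intro!: derivative_eq_intros)
  then show ?case by (auto simp: real_differentiable_def)
next
  case (Suc n)
  have "((\<lambda>x. f (c * x + d)) has_real_derivative deriv f (c * x + d) * c) (at x)" for x
    by (rule DERIV_chain2[OF has_deriv_of_smooth_upto[OF Suc.prems]]) (auto intro!: derivative_eq_intros)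
  moreover have "smooth_upto n (\<lambda>x. deriv f (c * x + d) * c)"
    by (intro smooth_upto_mult smooth_upto_const Suc.IH smooth_upto_deriv Suc.prems)
  ultimately show ?case by (rule smooth_upto_SucI)
qed

text \<open>
  The standard smooth function that is flat at the origin, together with its products with powers of
  \<open>1 / x\<close>; the powers are needed because they appear in its derivatives.
\<close>

definition flat :: "nat \<Rightarrow> real \<Rightarrow> real" where
  "flat k x = (if x \<le> 0 then 0 else (1 / x) ^ k * exp (- (1 / x)))"

lemma flat_nonneg: "flat k x \<ge> 0"
  by (simp add: flat_def)

lemma flat_pos: "x > 0 \<Longrightarrow> flat k x > 0"
  by (simp add: flat_def)

lemma flat_tendsto_0: "(flat k \<longlongrightarrow> 0) (at_right 0)"
proof -
  have "((\<lambda>x::real. (inverse x) ^ k / exp (inverse x)) \<longlongrightarrow> 0) (at_right 0)"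
    by (rule filterlim_compose[OF tendsto_power_div_exp_0 filterlim_inverse_at_top_right])
  then show ?thesis
    by (rule Lim_transform_eventually)
      (auto simp: eventually_at_right_field flat_def exp_minus divide_inverse intro!: exI[of _ 1])
qed

text \<open>
  Differentiation stays within the linear span of these functions, so smoothness follows by
  induction for all of them simultaneously. At the origin the difference quotient of one of them is
  the next one, which tends to zero.
\<close>

lemma flat_has_derivative:
  "(flat k has_real_derivative flat (k + 2) x - real k * flat (k + 1) x) (at x)"
proof -
  consider "x < 0" | "x = 0" | "x > 0" by linarith
  then show ?thesis
  proof cases
    case 1
    have "((\<lambda>x. 0) has_real_derivative 0) (at x)" by simp
    then have "(flat k has_real_derivative 0) (at x)"
      by (rule has_field_derivative_transform_within_open[where S = "{..<0}"])
        (use 1 in \<open>auto simp: flat_def\<close>)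
    then show ?thesis using 1 by (simp add: flat_def)
  next
    case 2
    have left: "((\<lambda>h. flat k h / h) \<longlongrightarrow> 0) (at_left 0)"
      by (rule Lim_transform_eventually[where f = "\<lambda>_. 0"])
        (auto simp: eventually_at_left_field flat_def intro!: exI[of _ "-1"])
    have right: "((\<lambda>h. flat k h / h) \<longlongrightarrow> 0) (at_right 0)"
      by (rule Lim_transform_eventually[OF flat_tendsto_0[of "k+1"]])
        (auto simp: eventually_at_right_field flat_def intro!: exI[of _ 1])
    have "((\<lambda>h. flat k h / h) \<longlongrightarrow> 0) (at 0)"
      using left right by (simp add: filterlim_split_at)
    then have "(flat k has_real_derivative 0) (at 0)"
      by (simp add: DERIV_def flat_def)
    then show ?thesis using 2 by (simp add: flat_def)
  next
    case 3
    have inv: "((\<lambda>x. 1 / x) has_real_derivative - ((1 / x)\<^sup>2)) (at x)"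
      using 3 by (auto intro!: derivative_eq_intros simp: power2_eq_square)
    have "((\<lambda>x. (1 / x) ^ k * exp (- (1 / x))) has_real_derivative
        real k * (- ((1 / x)\<^sup>2) * (1 / x) ^ (k - Suc 0)) * exp (- (1 / x))
          + exp (- (1 / x)) * - (- ((1 / x)\<^sup>2)) * (1 / x) ^ k) (at x)"
      by (intro DERIV_mult DERIV_power[OF inv] DERIV_chain2[OF DERIV_exp] DERIV_minus inv)
    moreover have "real k * (- (u\<^sup>2) * u ^ (k - Suc 0)) * e + e * - (- (u\<^sup>2)) * u ^ k
        = u ^ (k + 2) * e - real k * (u ^ (k + 1) * e)" for u e :: real
      by (cases k) (simp_all add: algebra_simps power2_eq_square)
    ultimately have "((\<lambda>x. (1 / x) ^ k * exp (- (1 / x))) has_real_derivative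
        (1 / x) ^ (k + 2) * exp (- (1 / x)) - real k * ((1 / x) ^ (k + 1) * exp (- (1 / x)))) (at x)"
      by metis
    then have "(flat k has_real_derivative
        (1 / x) ^ (k + 2) * exp (- (1 / x)) - real k * ((1 / x) ^ (k + 1) * exp (- (1 / x)))) (at x)"
      by (rule has_field_derivative_transform_within_open[where S = "{0<..}"])
        (use 3 in \<open>auto simp: flat_def\<close>)
    then show ?thesis using 3 by (simp add: flat_def)
  qed
qed

lemma smooth_upto_flat: "smooth_upto n (flat k)"
proof (induction n arbitrary: k)
  case 0
  then show ?case using flat_has_derivative by (auto simp: real_differentiable_def)
next
  case (Suc n)
  have "smooth_upto n (\<lambda>x. flat (k + 2) x + (- real k) * flat (k + 1) x)"
    by (intro smooth_upto_add smooth_upto_mult smooth_upto_const Suc.IH)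
  then have "smooth_upto n (\<lambda>x. flat (k + 2) x - real k * flat (k + 1) x)"
    by simp
  with flat_has_derivative show ?case
    by (rule smooth_upto_SucI)
qed

text \<open>
  A smooth transition from 0 on the left of the origin to 1 on the right of 1.
\<close>

definition step :: "real \<Rightarrow> real" where
  "step x = flat 0 x / (flat 0 x + flat 0 (1 - x))"

text \<open>
  At least one of \<open>x\<close> and \<open>1 - x\<close> is positive.
\<close>

lemma step_denominator_pos: "flat 0 x + flat 0 (1 - x) > 0"
proof (cases "x > 0")
  case True
  then show ?thesis using flat_pos[of x 0] flat_nonneg[of 0 "1 - x"] by linarith
next
  case False
  then show ?thesis using flat_pos[of "1 - x" 0] flat_nonneg[of 0 x] by linarith
qed

lemma step_eq_0: "x \<le> 0 \<Longrightarrow> step x = 0"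
  by (simp add: step_def flat_def)

lemma step_eq_1: "x \<ge> 1 \<Longrightarrow> step x = 1"
  by (simp add: step_def flat_def)

lemma step_nonneg: "step x \<ge> 0"
  using step_denominator_pos[of x] by (simp add: step_def flat_nonneg)

lemma step_le_1: "step x \<le> 1"
  using step_denominator_pos[of x] flat_nonneg[of 0 "1 - x"] by (simp add: step_def)

lemma smooth_upto_step: "smooth_upto n step"
proof -
  have a: "smooth_upto n (\<lambda>x. flat 0 (1 - x))"
    using smooth_upto_affine[OF smooth_upto_flat[of n 0], of "-1" 1] by simp
  have "smooth_upto n (\<lambda>x. flat 0 x * inverse (flat 0 x + flat 0 (1 - x)))"
    using step_denominator_pos
    by (intro smooth_upto_mult smooth_upto_inverse smooth_upto_add smooth_upto_flat a)
      (simp add: order_less_imp_not_eq2)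
  moreover have "(\<lambda>x. flat 0 x * inverse (flat 0 x + flat 0 (1 - x))) = step"
    by (auto simp: step_def divide_inverse)
  ultimately show ?thesis by simp
qed

lemma step_has_derivative: "(step has_real_derivative deriv step x) (at x)"
  by (rule has_deriv_of_smooth_upto[OF smooth_upto_step[of 0]])

lemma step_mono: "mono step"
proof -
  have F: "mono (flat 0)"
  proof (rule monoI)
    fix x y :: real assume "x \<le> y"
    show "flat 0 x \<le> flat 0 y"
    proof (rule DERIV_nonneg_imp_nondecreasing[OF \<open>x \<le> y\<close>])
      fix z
      have "(flat 0 has_real_derivative flat 2 z) (at z)"
        using flat_has_derivative[of 0 z] by (simp add: numeral_2_eq_2)
      then show "\<exists>d. (flat 0 has_real_derivative d) (at z) \<and> d \<ge> 0"
        using flat_nonneg by blast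
    qed
  qed
  show ?thesis
  proof (rule monoI)
    fix x y :: real assume xy: "x \<le> y"
    have "flat 0 x \<le> flat 0 y" "flat 0 (1 - y) \<le> flat 0 (1 - x)"
      using monoD[OF F] xy by auto
    then have "flat 0 x * flat 0 (1 - y) \<le> flat 0 y * flat 0 (1 - x)"
      by (intro mult_mono flat_nonneg)
    then show "step x \<le> step y"
      using step_denominator_pos[of x] step_denominator_pos[of y]
      by (simp add: step_def field_simps)
  qed
qed

lemma deriv_step_nonneg: "deriv step x \<ge> 0"
  using mono_on_imp_deriv_nonneg[of UNIV step "deriv step x" x] step_mono step_has_derivative
  by simp

text \<open>
  A smooth approximation, as \<open>\<epsilon>\<close> tends to zero, of the indicator of the half-open interval
  from \<open>a\<close> to \<open>b\<close>.
\<close>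

definition cutoff :: "real \<Rightarrow> real \<Rightarrow> real \<Rightarrow> real \<Rightarrow> real" where
  "cutoff a b \<epsilon> x = step ((x - a) / \<epsilon>) - step ((x - b) / \<epsilon>)"

lemma step_shift_has_derivative:
  "((\<lambda>x. step ((x - a) / \<epsilon>)) has_real_derivative deriv step ((x - a) / \<epsilon>) / \<epsilon>) (at x)"
proof -
  have "((\<lambda>x. (x - a) / \<epsilon>) has_real_derivative 1 / \<epsilon>) (at x)"
    by (rule DERIV_cdivide) (auto intro!: derivative_eq_intros)
  from DERIV_chain2[OF step_has_derivative this] show ?thesis by simp
qed

lemma deriv_cutoff:
  "deriv (cutoff a b \<epsilon>) x = deriv step ((x - a) / \<epsilon>) / \<epsilon> - deriv step ((x - b) / \<epsilon>) / \<epsilon>"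
proof -
  have "(cutoff a b \<epsilon> has_real_derivative
      deriv step ((x - a) / \<epsilon>) / \<epsilon> - deriv step ((x - b) / \<epsilon>) / \<epsilon>) (at x)"
    unfolding cutoff_def[abs_def]
    by (intro derivative_intros step_shift_has_derivative)
  then show ?thesis by (rule DERIV_imp_deriv)
qed

lemma cutoff_abs_le_1: "\<bar>cutoff a b \<epsilon> x\<bar> \<le> 1"
  using step_nonneg[of "(x - a) / \<epsilon>"] step_nonneg[of "(x - b) / \<epsilon>"]
    step_le_1[of "(x - a) / \<epsilon>"] step_le_1[of "(x - b) / \<epsilon>"]
  unfolding cutoff_def by linarith

lemma cutoff_eq_0:
  assumes "a \<le> b" "\<epsilon> > 0" "x \<notin> {a..b + \<epsilon>}"
  shows "cutoff a b \<epsilon> x = 0"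
proof (cases "x < a")
  case True
  then show ?thesis using assms by (simp add: cutoff_def step_eq_0 divide_le_0_iff)
next
  case False
  then have "(x - a) / \<epsilon> \<ge> 1" "(x - b) / \<epsilon> \<ge> 1" using assms by (auto simp: field_simps)
  then show ?thesis by (simp add: cutoff_def step_eq_1)
qed

lemma test_function_cutoff:
  assumes "a \<le> b" "\<epsilon> > 0" "{a..b + \<epsilon>} \<subseteq> \<Omega>"
  shows "test_function \<Omega> (cutoff a b \<epsilon>)"
proof -
  have "smooth_upto n (cutoff a b \<epsilon>)" for n
  proof -
    have *: "smooth_upto n (\<lambda>x. step ((x - c) / \<epsilon>))" for c
      using smooth_upto_affine[OF smooth_upto_step[of n], of "1 / \<epsilon>" "- c / \<epsilon>"]
      by (simp add: diff_divide_distrib)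
    have "smooth_upto n (\<lambda>x. step ((x - a) / \<epsilon>) + (-1) * step ((x - b) / \<epsilon>))"
      by (intro smooth_upto_add smooth_upto_mult smooth_upto_const *)
    then show ?thesis by (simp add: cutoff_def[abs_def])
  qed
  then have smooth: "(deriv ^^ n) (cutoff a b \<epsilon>) differentiable at x" for n x
    by (meson order_refl smooth_upto_iff)
  have supp: "closure {x. cutoff a b \<epsilon> x \<noteq> 0} \<subseteq> {a..b + \<epsilon>}"
    by (rule closure_minimal) (use cutoff_eq_0[OF assms(1,2)] in blast, simp)
  then have "compact (closure {x. cutoff a b \<epsilon> x \<noteq> 0})"
    by (metis bounded_closed_interval bounded_subset closed_closure compact_eq_bounded_closed)
  with smooth supp assms(3) show ?thesis by (auto simp: test_function_def)
qed

text \<open>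
  Each shifted step rises strictly to the right of its base point, hence the half-open interval in
  the limit.
\<close>

lemma cutoff_tendsto_indicator:
  assumes "a \<le> b" "\<epsilon> \<longlonglongrightarrow> 0" "\<And>n. \<epsilon> n > 0"
  shows "(\<lambda>n. cutoff a b (\<epsilon> n) x) \<longlonglongrightarrow> indicator {a<..b} x"
proof -
  have step_lim: "(\<lambda>n. step ((x - c) / \<epsilon> n)) \<longlonglongrightarrow> indicator {c<..} x" for c
  proof (cases "c < x")
    case True
    then have "\<forall>\<^sub>F n in sequentially. \<epsilon> n < x - c"
      using assms(2) by (intro order_tendstoD(2)) auto
    then have "\<forall>\<^sub>F n in sequentially. step ((x - c) / \<epsilon> n) = 1"
      by eventually_elim (use assms(3) in \<open>simp add: step_eq_1 less_imp_le\<close>)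
    then show ?thesis using True by (simp add: tendsto_eventually)
  next
    case False
    then have "step ((x - c) / \<epsilon> n) = 0" for n
      using assms(3)[of n] by (simp add: step_eq_0 divide_le_0_iff)
    then show ?thesis using False by simp
  qed
  have "indicator {a<..b} x = indicator {a<..} x - (indicator {b<..} x :: real)"
    using assms(1) by (auto simp: indicator_def)
  then show ?thesis
    unfolding cutoff_def by (simp add: tendsto_diff step_lim)
qed

lemma continuous_on_deriv_step: "continuous_on UNIV (deriv step)"
  using smooth_upto_deriv[OF smooth_upto_step, of 0]
  by (auto intro!: differentiable_imp_continuous_on simp: differentiable_on_def
      intro: differentiable_at_imp_differentiable_on)

lemma deriv_step_eq_0:
  assumes "x \<notin> {0..1}"
  shows "deriv step x = 0"
proof -
  consider "x < 0" | "x > 1" using assms by auto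
  then have "(step has_real_derivative 0) (at x)"
  proof cases
    case 1
    have "((\<lambda>x. 0) has_real_derivative 0) (at x)" by simp
    then show ?thesis
      by (rule has_field_derivative_transform_within_open[where S = "{..<0}"])
        (use 1 in \<open>auto simp: step_eq_0\<close>)
  next
    case 2
    have "((\<lambda>x. 1) has_real_derivative 0) (at x)" by simp
    then show ?thesis
      by (rule has_field_derivative_transform_within_open[where S = "{1<..}"])
        (use 2 in \<open>auto simp: step_eq_1\<close>)
  qed
  then show ?thesis by (rule DERIV_imp_deriv)
qed

section \<open>The fundamental lemma of the calculus of variations\<close>

text \<open>
  The supports stay in the compact interval \<open>{a..d}\<close>, on which \<open>f\<close> is integrable, so
  dominated convergence applies.
\<close>

lemma cutoff_integral_tendsto:
  fixes f :: "real \<Rightarrow> complex"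
  assumes int: "set_integrable lebesgue {a..d} f"
    and ab: "a \<le> b" and sub: "{a..d} \<subseteq> \<Omega>"
    and \<epsilon>: "\<epsilon> \<longlonglongrightarrow> 0" "\<And>n. \<epsilon> n > 0" "\<And>n. b + \<epsilon> n \<le> d"
  shows "(\<lambda>n. LINT x:\<Omega>|lebesgue. cutoff a b (\<epsilon> n) x *\<^sub>R f x) \<longlonglongrightarrow> (LINT x:{a<..b}|lebesgue. f x)"
proof -
  let ?F = "\<lambda>x. indicator {a..d} x *\<^sub>R f x"
  have F: "integrable lebesgue ?F"
    using int by (simp add: set_integrable_def)
  have eq: "(LINT x:\<Omega>|lebesgue. cutoff a b (\<epsilon> n) x *\<^sub>R f x) = (LINT x|lebesgue. cutoff a b (\<epsilon> n) x *\<^sub>R ?F x)"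
    for n
    unfolding set_lebesgue_integral_def
  proof (rule Bochner_Integration.integral_cong[OF refl])
    fix x
    have "x \<notin> {a..d} \<Longrightarrow> cutoff a b (\<epsilon> n) x = 0"
      using cutoff_eq_0[OF ab \<epsilon>(2)[of n], of x] \<epsilon>(3)[of n] by auto
    with sub show "indicator \<Omega> x *\<^sub>R cutoff a b (\<epsilon> n) x *\<^sub>R f x = cutoff a b (\<epsilon> n) x *\<^sub>R ?F x"
      by (auto simp: indicator_def)
  qed
  have "continuous_on UNIV (cutoff a b e)" for e
    unfolding cutoff_def[abs_def]
    by (intro continuous_at_imp_continuous_on ballI continuous_diff
        DERIV_isCont[OF step_shift_has_derivative])
  then have meas: "cutoff a b e \<in> borel_measurable lebesgue" for e
    by (intro measurable_completion) (simp add: borel_measurable_continuous_onI)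
  have "(\<lambda>n. LINT x|lebesgue. cutoff a b (\<epsilon> n) x *\<^sub>R ?F x) \<longlonglongrightarrow> (LINT x|lebesgue. indicator {a<..b} x *\<^sub>R f x)"
  proof (rule integral_dominated_convergence)
    have "(\<lambda>x. indicator {a<..b} x *\<^sub>R ?F x) \<in> borel_measurable lebesgue"
      by (rule borel_measurable_scaleR[OF _ borel_measurable_integrable[OF F]])
          (intro borel_measurable_indicator, simp)
    moreover have "{a<..b} \<subseteq> {a..d}" using \<epsilon>(2,3)[of 0] by auto
    ultimately show "(\<lambda>x. indicator {a<..b} x *\<^sub>R f x) \<in> borel_measurable lebesgue"
      by (rule_tac back_subst[where P = "\<lambda>g. g \<in> borel_measurable lebesgue"]) (auto simp: indicator_def fun_eq_iff)
    show "(\<lambda>x. cutoff a b (\<epsilon> n) x *\<^sub>R ?F x) \<in> borel_measurable lebesgue" for n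
      by (rule borel_measurable_scaleR[OF meas borel_measurable_integrable[OF F]])
    show "integrable lebesgue (\<lambda>x. norm (?F x))"
      using F by (rule integrable_norm)
    show "AE x in lebesgue. norm (cutoff a b (\<epsilon> n) x *\<^sub>R ?F x) \<le> norm (?F x)" for n
      using cutoff_abs_le_1[of a b "\<epsilon> n"]
      by (intro AE_I2) (auto simp: indicator_def mult_left_le_one_le)
    have "(\<lambda>n. cutoff a b (\<epsilon> n) x *\<^sub>R ?F x) \<longlonglongrightarrow> indicator {a<..b} x *\<^sub>R ?F x" for x
      by (intro tendsto_scaleR tendsto_const cutoff_tendsto_indicator[OF ab \<epsilon>(1,2)])
    moreover have "indicator {a<..b} x *\<^sub>R ?F x = indicator {a<..b} x *\<^sub>R f x" for x
      using \<epsilon>(2,3)[of 0] by (auto simp: indicator_def)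
    ultimately show "AE x in lebesgue. (\<lambda>n. cutoff a b (\<epsilon> n) x *\<^sub>R ?F x) \<longlonglongrightarrow> indicator {a<..b} x *\<^sub>R f x"
      by (intro AE_I2) metis
  qed
  then show ?thesis
    by (simp add: eq) (simp add: set_lebesgue_integral_def)
qed

lemma vanishing_sequence:
  fixes \<delta> :: real
  assumes "\<delta> > 0"
  obtains \<epsilon> where "\<epsilon> \<longlonglongrightarrow> 0" "\<And>n. \<epsilon> n > 0" "\<And>n. \<epsilon> n \<le> \<delta>"
proof
  have "(\<lambda>n. \<delta> * inverse (real (Suc n))) \<longlonglongrightarrow> \<delta> * 0"
    by (intro tendsto_mult tendsto_const LIMSEQ_inverse_real_of_nat)
  then show "(\<lambda>n. \<delta> * inverse (real (Suc n))) \<longlonglongrightarrow> 0" by simp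
  show "\<delta> * inverse (real (Suc n)) > 0" for n using assms by simp
  show "\<delta> * inverse (real (Suc n)) \<le> \<delta>" for n using assms by (simp add: field_simps)
qed

lemma sigma_finite_lebesgue: "sigma_finite_measure (lebesgue :: real measure)"
proof -
  obtain A :: "real set set" where A: "countable A" "A \<subseteq> sets lborel" "\<Union>A = space lborel"
    "\<forall>a\<in>A. emeasure lborel a \<noteq> \<infinity>"
    using lborel.sigma_finite_countable by blast
  show ?thesis
    by standard (use A in \<open>intro exI[of _ A], auto\<close>)
qed

text \<open>
  Half-open intervals form an intersection-stable generator of the Borel sets, so the integral of
  \<open>f\<close> vanishes over every Borel subset, and over every Lebesgue set since these differ from
  Borel sets by null sets.
\<close>

lemma AE_0_if_integrals_Ioc_0:
  fixes f :: "real \<Rightarrow> complex"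
  assumes int: "set_integrable lebesgue {c<..e} f"
    and zero: "\<And>a b. c \<le> a \<Longrightarrow> a \<le> b \<Longrightarrow> b \<le> e \<Longrightarrow> (LINT x:{a<..b}|lebesgue. f x) = 0"
  shows "AE x in lebesgue. x \<in> {c<..e} \<longrightarrow> f x = 0"
proof (cases "c \<le> e")
  case False
  then show ?thesis by auto
next
  case ce: True
  let ?F = "\<lambda>x. indicator {c<..e} x *\<^sub>R f x"
  have F: "integrable lebesgue ?F"
    using int by (simp add: set_integrable_def)
  have Fs: "set_integrable lebesgue A ?F" if "A \<in> sets lebesgue" for A
    using integrable_mult_indicator[OF that F] by (simp add: set_integrable_def)
  let ?G = "range (\<lambda>(a, b). {a <.. b::real})"
  have stable: "Int_stable ?G"
  proof (rule Int_stableI)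
    fix A B :: "real set" assume "A \<in> ?G" "B \<in> ?G"
    then obtain a b a' b' where "A = {a<..b}" "B = {a'<..b'}" by auto
    then have "A \<inter> B = {max a a'<..min b b'}" by auto
    then show "A \<inter> B \<in> ?G" by (auto intro!: image_eqI[of _ _ "(max a a', min b b')"])
  qed
  have pow: "?G \<subseteq> Pow UNIV" by simp
  have borel: "(LINT x:A|lebesgue. ?F x) = 0" if "A \<in> sigma_sets UNIV ?G" for A
    using that
  proof (induction A rule: sigma_sets_induct_disjoint[OF stable pow, consumes 1,
      case_names basic empty compl union])
    case (basic A)
    then obtain a b where A: "A = {a<..b}" by auto
    define a' b' where "a' = max a c" and "b' = min b e"
    have "(LINT x:A|lebesgue. ?F x) = (LINT x:{a'<..b'}|lebesgue. f x)"
      unfolding set_lebesgue_integral_def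
      by (rule Bochner_Integration.integral_cong) (auto simp: A a'_def b'_def indicator_def)
    also have "\<dots> = 0"
    proof (cases "a' \<le> b'")
      case True
      then show ?thesis by (intro zero) (auto simp: a'_def b'_def)
    next
      case False
      then show ?thesis by (simp add: set_lebesgue_integral_def)
    qed
    finally show ?case .
  next
    case empty
    show ?case by (simp add: set_lebesgue_integral_def)
  next
    case (compl A)
    then have A: "A \<in> sets lebesgue"
      by (auto simp: borel_sigma_sets_Ioc intro!: sets_completionI_sets)
    have "(LINT x:UNIV|lebesgue. ?F x) = (LINT x:{c<..e}|lebesgue. f x)"
      by (simp add: set_lebesgue_integral_def)
    also have "\<dots> = 0" using ce by (intro zero) auto
    finally have "(LINT x:A \<union> (UNIV - A)|lebesgue. ?F x) = 0" by simp
    moreover have "(LINT x:A \<union> (UNIV - A)|lebesgue. ?F x)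
        = (LINT x:A|lebesgue. ?F x) + (LINT x:UNIV - A|lebesgue. ?F x)"
      using A by (intro set_integral_Un Fs) auto
    ultimately show ?case using compl by simp
  next
    case (union A)
    have "A i \<in> sigma_sets UNIV ?G" for i
      using union(2) by blast
    then have A: "A i \<in> sets lebesgue" for i
      by (auto simp: borel_sigma_sets_Ioc intro!: sets_completionI_sets)
    have "(LINT x:(\<Union>i. A i)|lebesgue. ?F x) = (\<Sum>i. LINT x:A i|lebesgue. ?F x)"
      using A union(1)
      by (intro lebesgue_integral_countable_add Fs) (auto simp: disjoint_family_on_def)
    then show ?case using union by simp
  qed
  have "AE x in lebesgue. ?F x = 0"
  proof (rule sigma_finite_measure.density_zero[OF sigma_finite_lebesgue F])
    fix A :: "real set" assume "A \<in> sets lebesgue"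
    then obtain S N N' where A: "A = S \<union> N" and SN: "S \<in> sets lborel" "N' \<in> null_sets lborel" "N \<subseteq> N'"
      by (auto elim: sets_completionE)
    have "AE x in lebesgue. x \<notin> N'"
      using SN by (intro AE_not_in null_sets_completionI)
    then have "AE x in lebesgue. x \<in> A \<longleftrightarrow> x \<in> S"
      by eventually_elim (use A SN in auto)
    then have "(LINT x:A|lebesgue. ?F x) = (LINT x:S|lebesgue. ?F x)"
      by (intro set_integral_cong_set borel_measurable_integrable[OF Fs[unfolded set_integrable_def],
            folded set_borel_measurable_def])
        (use \<open>A \<in> sets lebesgue\<close> SN in auto)
    then show "(LINT x:A|lebesgue. ?F x) = 0"
      using borel[of S] SN by (simp add: borel_sigma_sets_Ioc)
  qed
  then show ?thesis
    by eventually_elim (auto simp: indicator_def)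
qed

text \<open>
  Fundamental lemma of the calculus of variations. Integrals over compactly contained intervals
  vanish by approximation with cutoffs; countably many rational intervals exhaust \<open>\<Omega>\<close>.
\<close>

lemma fundamental_lemma:
  fixes f :: "real \<Rightarrow> complex"
  assumes "open \<Omega>" and loc: "locally_integrable \<Omega> f"
    and test: "\<And>\<eta>. test_function \<Omega> \<eta> \<Longrightarrow> (LINT x:\<Omega>|lebesgue. \<eta> x *\<^sub>R f x) = 0"
  shows "AE x in lebesgue. x \<in> \<Omega> \<longrightarrow> f x = 0"
proof -
  have local: "AE x in lebesgue. x \<in> {c<..e} \<longrightarrow> f x = 0" if "e < d" "{c..d} \<subseteq> \<Omega>" for c d e
  proof (rule AE_0_if_integrals_Ioc_0)
    have cd: "set_integrable lebesgue {c..d} f"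
      using loc that by (auto simp: locally_integrable_def)
    then show "set_integrable lebesgue {c<..e} f"
      by (rule set_integrable_subset) (use that in auto)
    fix a b assume ab: "c \<le> a" "a \<le> b" "b \<le> e"
    have "d - b > 0" using ab that by simp
    then obtain \<epsilon> where \<epsilon>: "\<epsilon> \<longlonglongrightarrow> 0" "\<And>n. \<epsilon> n > 0" "\<And>n. \<epsilon> n \<le> d - b"
      using vanishing_sequence by blast
    have le: "b + \<epsilon> n \<le> d" for n using \<epsilon>(3)[of n] by simp
    have ad: "{a..d} \<subseteq> {c..d}" using ab by auto
    have "(\<lambda>n. LINT x:\<Omega>|lebesgue. cutoff a b (\<epsilon> n) x *\<^sub>R f x) \<longlonglongrightarrow> (LINT x:{a<..b}|lebesgue. f x)"
      by (rule cutoff_integral_tendsto[OF set_integrable_subset[OF cd _ ad]])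
        (use ab that \<epsilon> le ad in auto)
    moreover have "(LINT x:\<Omega>|lebesgue. cutoff a b (\<epsilon> n) x *\<^sub>R f x) = 0" for n
    proof (intro test test_function_cutoff)
      show "{a..b + \<epsilon> n} \<subseteq> \<Omega>" using le[of n] that ad by fastforce
    qed (use ab \<epsilon> in auto)
    ultimately show "(LINT x:{a<..b}|lebesgue. f x) = 0"
      by (simp add: LIMSEQ_const_iff)
  qed
  have "AE x in lebesgue. \<forall>c\<in>\<rat>. \<forall>e\<in>\<rat>. (\<exists>d>e. {c..d} \<subseteq> \<Omega>) \<longrightarrow> x \<in> {c<..e} \<longrightarrow> f x = 0"
    by (intro AE_ball_countable[THEN iffD2] countable_rat ballI) (use local in \<open>auto\<close>)
  then show ?thesis
  proof eventually_elim
    case (elim x)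
    show ?case
    proof
      assume "x \<in> \<Omega>"
      then obtain r where r: "r > 0" "{x - r..x + r} \<subseteq> \<Omega>"
        using \<open>open \<Omega>\<close> by (metis open_contains_cball cball_eq_atLeastAtMost)
      obtain c where c: "c \<in> \<rat>" "x - r < c" "c < x"
        using Rats_dense_in_real[of "x - r" x] r by auto
      obtain e where e: "e \<in> \<rat>" "x < e" "e < x + r"
        using Rats_dense_in_real[of x "x + r"] r by auto
      have "{c..x + r} \<subseteq> \<Omega>" using r c by fastforce
      then show "f x = 0"
        using elim c e by (metis greaterThanAtMost_iff less_imp_le)
    qed
  qed
qed

section \<open>Weak and classical derivatives\<close>

text \<open>
  Completeness of Lebesgue measure: the two preimages differ by a subset of a null set.
\<close>

lemma borel_measurable_lebesgue_cong_AE: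
  fixes f g :: "'a::euclidean_space \<Rightarrow> 'b::topological_space"
  assumes f: "f \<in> borel_measurable lebesgue" and eq: "AE x in lebesgue. f x = g x"
  shows "g \<in> borel_measurable lebesgue"
proof (rule measurableI)
  fix A :: "'b set" assume A: "A \<in> sets borel"
  obtain N where N: "{x \<in> space lebesgue. f x \<noteq> g x} \<subseteq> N" "N \<in> null_sets lebesgue"
    using eq by (auto elim: AE_E simp: null_sets_def)
  have "f -` A \<in> sets lebesgue"
    using measurable_sets[OF f A] by simp
  moreover have "g -` A \<inter> N \<in> sets lebesgue"
    using null_sets_completion_subset[OF Int_lower2 N(2)] by blast
  moreover have "g -` A \<inter> space lebesgue = (f -` A - N) \<union> (g -` A \<inter> N)"
  proof (rule set_eqI)
    fix x
    have "x \<notin> N \<Longrightarrow> f x = g x" using N(1) by auto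
    then show "x \<in> g -` A \<inter> space lebesgue \<longleftrightarrow> x \<in> (f -` A - N) \<union> (g -` A \<inter> N)"
      by (cases "x \<in> N") auto
  qed
  ultimately show "g -` A \<inter> space lebesgue \<in> sets lebesgue"
    using null_setsD2[OF N(2)] by (metis sets.Diff sets.Un)
qed simp

text \<open>
  By completeness either both functions are measurable or neither is, and in the latter case both
  integrals have the default value zero.
\<close>

lemma lebesgue_integral_cong_AE:
  fixes f g :: "real \<Rightarrow> complex"
  assumes eq: "AE x in lebesgue. f x = g x"
  shows "integrable lebesgue f \<longleftrightarrow> integrable lebesgue g" "integral\<^sup>L lebesgue f = integral\<^sup>L lebesgue g"
proof -
  have "AE x in lebesgue. g x = f x" using eq by eventually_elim simp
  with eq have meas: "f \<in> borel_measurable lebesgue \<longleftrightarrow> g \<in> borel_measurable lebesgue"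
    using borel_measurable_lebesgue_cong_AE by metis
  show int: "integrable lebesgue f \<longleftrightarrow> integrable lebesgue g"
    using integrable_cong_AE[OF _ _ eq] meas by (auto dest: borel_measurable_integrable)
  show "integral\<^sup>L lebesgue f = integral\<^sup>L lebesgue g"
  proof (cases "f \<in> borel_measurable lebesgue")
    case True
    then show ?thesis using meas eq by (intro integral_cong_AE) auto
  next
    case False
    then have "\<not> integrable lebesgue f" "\<not> integrable lebesgue g"
      using meas by (auto dest: borel_measurable_integrable)
    then show ?thesis by (simp add: not_integrable_integral_eq)
  qed
qed

lemma locally_integrable_cong_AE:
  assumes "locally_integrable \<Omega> u" "AE x in lebesgue. x \<in> \<Omega> \<longrightarrow> u x = u' x"
  shows "locally_integrable \<Omega> u'"
  unfolding locally_integrable_def set_integrable_def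
proof (intro allI impI)
  fix K assume K: "compact K \<and> K \<subseteq> \<Omega>"
  have "AE x in lebesgue. indicator K x *\<^sub>R u x = indicator K x *\<^sub>R u' x"
    using assms(2) by eventually_elim (use K in \<open>auto simp: indicator_def\<close>)
  from lebesgue_integral_cong_AE(1)[OF this]
  show "integrable lebesgue (\<lambda>x. indicat_real K x *\<^sub>R u' x)"
    using assms(1) K by (simp add: locally_integrable_def set_integrable_def)
qed

lemma is_weak_deriv_cong_AE:
  assumes "is_weak_deriv \<Omega> u v"
    and u: "AE x in lebesgue. x \<in> \<Omega> \<longrightarrow> u x = u' x"
    and v: "AE x in lebesgue. x \<in> \<Omega> \<longrightarrow> v x = v' x"
  shows "is_weak_deriv \<Omega> u' v'"
proof -
  have "(LINT x:\<Omega>|lebesgue. \<eta> x *\<^sub>R w x) = (LINT x:\<Omega>|lebesgue. \<eta> x *\<^sub>R w' x)"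
    if w: "AE x in lebesgue. x \<in> \<Omega> \<longrightarrow> w x = w' x" for \<eta> and w w' :: "real \<Rightarrow> complex"
    unfolding set_lebesgue_integral_def
    by (rule lebesgue_integral_cong_AE(2), use w in eventually_elim) (auto simp: indicator_def)
  from this[OF u] this[OF v] show ?thesis
    using assms locally_integrable_cong_AE unfolding is_weak_deriv_def by metis
qed

lemma in_L2_cong_AE:
  assumes "in_L2 \<Omega> u" "AE x in lebesgue. x \<in> \<Omega> \<longrightarrow> u x = u' x"
  shows "in_L2 \<Omega> u'"
proof -
  have 1: "AE x in lebesgue. indicator \<Omega> x *\<^sub>R u x = indicator \<Omega> x *\<^sub>R u' x"
    and 2: "AE x in lebesgue. indicator \<Omega> x *\<^sub>R (cmod (u x))\<^sup>2 = indicator \<Omega> x *\<^sub>R (cmod (u' x))\<^sup>2"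
    using assms(2) by (eventually_elim, auto simp: indicator_def)+
  have "integrable lebesgue (\<lambda>x. indicator \<Omega> x *\<^sub>R (cmod (u x))\<^sup>2)"
    using assms(1) by (simp add: in_L2_def set_integrable_def)
  then have "integrable lebesgue (\<lambda>x. indicator \<Omega> x *\<^sub>R (cmod (u' x))\<^sup>2)"
    by (rule integrable_cong_AE_imp[OF _ borel_measurable_lebesgue_cong_AE[OF borel_measurable_integrable 2] 2])
      fact
  with borel_measurable_lebesgue_cong_AE[OF _ 1] assms(1) show ?thesis
    by (simp add: in_L2_def set_integrable_def set_borel_measurable_def)
qed

lemma test_function_continuous: "test_function \<Omega> \<eta> \<Longrightarrow> continuous_on UNIV \<eta>"
  unfolding test_function_def
  by (metis continuous_at_imp_continuous_on differentiable_imp_continuous_within funpow_0)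

lemma test_function_has_derivative:
  "test_function \<Omega> \<eta> \<Longrightarrow> (\<eta> has_real_derivative deriv \<eta> x) (at x)"
  unfolding test_function_def by (metis DERIV_deriv_iff_real_differentiable funpow_0)

lemma test_function_eq_0: "x \<notin> closure {x. \<eta> x \<noteq> 0} \<Longrightarrow> \<eta> x = 0"
  using closure_subset[of "{x. \<eta> x \<noteq> 0}"] by blast

lemma deriv_eq_0_outside_support:
  fixes \<eta> :: "real \<Rightarrow> real"
  assumes "x \<notin> closure {x. \<eta> x \<noteq> 0}"
  shows "(\<eta> has_real_derivative 0) (at x)"
proof -
  have "((\<lambda>x. 0) has_real_derivative 0) (at x)" by simp
  moreover have "open (- closure {x. \<eta> x \<noteq> 0})"
    by (rule open_Compl[OF closed_closure])
  moreover have "x \<in> - closure {x. \<eta> x \<noteq> 0}"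
    using assms by simp
  moreover have "0 = \<eta> y" if "y \<in> - closure {x. \<eta> x \<noteq> 0}" for y
    using test_function_eq_0[OF ComplD[OF that]] by (rule sym)
  ultimately show ?thesis
    by (rule has_field_derivative_transform_within_open)
qed

lemma test_function_deriv:
  assumes "test_function \<Omega> \<eta>"
  shows "test_function \<Omega> (deriv \<eta>)"
proof -
  have "closure {x. deriv \<eta> x \<noteq> 0} \<subseteq> closure {x. \<eta> x \<noteq> 0}"
    by (rule closure_minimal) (use DERIV_imp_deriv[OF deriv_eq_0_outside_support[of _ \<eta>]] in blast, simp)
  moreover have "(deriv ^^ n) (deriv \<eta>) differentiable at x" for n x
    using assms unfolding test_function_def by (metis comp_apply funpow_Suc_right)
  ultimately show ?thesis
    using assms unfolding test_function_def
    by (meson bounded_subset closed_closure compact_eq_bounded_closed order_trans)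
qed

text \<open>
  A test function is bounded and its support is a compact subset of \<open>\<Omega>\<close>.
\<close>

lemma set_integrable_test_function:
  assumes loc: "locally_integrable \<Omega> v" and test: "test_function \<Omega> \<eta>"
  shows "set_integrable lebesgue \<Omega> (\<lambda>x. \<eta> x *\<^sub>R v x)"
proof -
  define K where "K = closure {x. \<eta> x \<noteq> 0}"
  have K: "compact K" "K \<subseteq> \<Omega>" using test by (auto simp: test_function_def K_def)
  have "bounded (\<eta> ` K)"
    using K test_function_continuous[OF test]
    by (meson compact_continuous_image compact_imp_bounded continuous_on_subset top_greatest)
  then obtain B where B: "\<And>x. x \<in> K \<Longrightarrow> \<bar>\<eta> x\<bar> \<le> B"
    by (auto simp: bounded_iff)
  have v: "integrable lebesgue (\<lambda>x. indicator K x *\<^sub>R v x)"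
    using loc K by (simp add: locally_integrable_def set_integrable_def)
  have "\<eta> \<in> borel_measurable lebesgue"
    using test_function_continuous[OF test]
    by (intro measurable_completion) (simp add: borel_measurable_continuous_onI)
  then have "(\<lambda>x. \<eta> x *\<^sub>R (indicator K x *\<^sub>R v x)) \<in> borel_measurable lebesgue"
    by (rule borel_measurable_scaleR[OF _ borel_measurable_integrable[OF v]])
  then have "integrable lebesgue (\<lambda>x. \<eta> x *\<^sub>R (indicator K x *\<^sub>R v x))"
    using B by (intro Bochner_Integration.integrable_bound[OF integrable_scaleR_right[OF v, of B]] AE_I2)
      (auto simp: indicator_def intro!: mult_right_mono abs_ge_self order_trans[OF _ abs_ge_self])
  moreover have "indicator \<Omega> x *\<^sub>R (\<eta> x *\<^sub>R v x) = \<eta> x *\<^sub>R (indicator K x *\<^sub>R v x)" for x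
    using test_function_eq_0[of x \<eta>] K(2) by (auto simp: indicator_def K_def)
  ultimately show ?thesis by (simp only: set_integrable_def)
qed

lemma weak_deriv_unique:
  assumes "open \<Omega>" and v: "is_weak_deriv \<Omega> u v" and w: "is_weak_deriv \<Omega> u w"
  shows "AE x in lebesgue. x \<in> \<Omega> \<longrightarrow> v x = w x"
proof -
  have "AE x in lebesgue. x \<in> \<Omega> \<longrightarrow> v x - w x = 0"
  proof (rule fundamental_lemma[OF \<open>open \<Omega>\<close>])
    show "locally_integrable \<Omega> (\<lambda>x. v x - w x)"
      using v w by (auto simp: is_weak_deriv_def locally_integrable_def)
    fix \<eta> assume \<eta>: "test_function \<Omega> \<eta>"
    have "(LINT x:\<Omega>|lebesgue. \<eta> x *\<^sub>R (v x - w x))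
        = (LINT x:\<Omega>|lebesgue. \<eta> x *\<^sub>R v x) - (LINT x:\<Omega>|lebesgue. \<eta> x *\<^sub>R w x)"
      unfolding scaleR_diff_right
      using v w \<eta> by (intro set_integral_diff set_integrable_test_function) (auto simp: is_weak_deriv_def)
    moreover have "- (LINT x:\<Omega>|lebesgue. \<eta> x *\<^sub>R v x) = - (LINT x:\<Omega>|lebesgue. \<eta> x *\<^sub>R w x)"
      using v w \<eta> unfolding is_weak_deriv_def by metis
    ultimately show "(LINT x:\<Omega>|lebesgue. \<eta> x *\<^sub>R (v x - w x)) = 0"
      by simp
  qed
  then show ?thesis by simp
qed

lemma locally_integrable_continuous:
  fixes u :: "real \<Rightarrow> complex"
  assumes "continuous_on \<Omega> u"
  shows "locally_integrable \<Omega> u"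
  unfolding locally_integrable_def set_integrable_def
proof (intro allI impI)
  fix K assume "compact K \<and> K \<subseteq> \<Omega>"
  then have "set_integrable lborel K u"
    using assms by (auto intro!: borel_integrable_compact simp: set_integrable_def intro: continuous_on_subset)
  then show "integrable lebesgue (\<lambda>x. indicat_real K x *\<^sub>R u x)"
    by (simp add: set_integrable_def integrable_completion)
qed

text \<open>
  Integration by parts: \<open>\<eta> u\<close>, which vanishes near the complement of \<open>\<Omega>\<close>, is differentiable on the
  whole line and vanishes at both ends of a large interval.
\<close>

lemma is_weak_deriv_of_derivative:
  fixes u v :: "real \<Rightarrow> complex"
  assumes deriv: "\<And>x. x \<in> \<Omega> \<Longrightarrow> (u has_vector_derivative v x) (at x)"
    and cont: "continuous_on \<Omega> v"
  shows "is_weak_deriv \<Omega> u v"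
  unfolding is_weak_deriv_def
proof (intro conjI allI impI)
  have "continuous_on \<Omega> u"
    using deriv by (meson continuous_at_imp_continuous_on has_vector_derivative_continuous)
  then show u: "locally_integrable \<Omega> u" by (rule locally_integrable_continuous)
  show v: "locally_integrable \<Omega> v" using cont by (rule locally_integrable_continuous)
  fix \<eta> assume \<eta>: "test_function \<Omega> \<eta>"
  define K where "K = closure {x. \<eta> x \<noteq> 0}"
  have K: "compact K" "K \<subseteq> \<Omega>" using \<eta> by (auto simp: test_function_def K_def)
  let ?F = "\<lambda>x. \<eta> x *\<^sub>R u x" and ?f = "\<lambda>x. deriv \<eta> x *\<^sub>R u x + \<eta> x *\<^sub>R v x"
  have zero: "\<eta> x = 0" "deriv \<eta> x = 0" if "x \<notin> K" for x
    using that unfolding K_def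
    by (rule test_function_eq_0, rule DERIV_imp_deriv[OF deriv_eq_0_outside_support])
  have F: "(?F has_vector_derivative ?f x) (at x)" for x
  proof (cases "x \<in> K")
    case True
    then have "((\<lambda>x. \<eta> x *\<^sub>R u x) has_vector_derivative (\<eta> x *\<^sub>R v x + deriv \<eta> x *\<^sub>R u x)) (at x)"
      using K by (intro has_vector_derivative_scaleR deriv
          test_function_has_derivative[OF \<eta>]) auto
    then show ?thesis by (simp add: add.commute)
  next
    case False
    have "((\<lambda>x. 0) has_vector_derivative ?f x) (at x)"
      using zero[OF False] by simp
    then show ?thesis
      by (rule has_vector_derivative_transform_within_open[where S = "- K"])
        (use False zero(1) compact_imp_closed[OF K(1)] in auto)
  qed
  obtain R where R: "R > 0" "K \<subseteq> {-R<..<R}"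
    using bounded_subset_ballD[OF compact_imp_bounded[OF K(1)], of 0]
    by (auto simp: ball_eq_greaterThanLessThan)
  have "(?f has_integral (?F R - ?F (- R))) {- R..R}"
    using R by (intro fundamental_theorem_of_calculus) (auto intro: has_vector_derivative_at_within F)
  moreover have "R \<notin> K" "- R \<notin> K" using R by auto
  ultimately have int0: "integral {- R..R} ?f = 0"
    by (simp add: zero integral_unique)
  have i1: "set_integrable lebesgue \<Omega> (\<lambda>x. deriv \<eta> x *\<^sub>R u x)"
    and i2: "set_integrable lebesgue \<Omega> (\<lambda>x. \<eta> x *\<^sub>R v x)"
    using set_integrable_test_function u v \<eta> test_function_deriv[OF \<eta>] by blast+
  have ind: "indicator \<Omega> x *\<^sub>R ?f x = indicator {- R..R} x *\<^sub>R ?f x" for x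
  proof (cases "x \<in> K")
    case True
    then have "x \<in> \<Omega>" "x \<in> {- R..R}" using K(2) R(2) by auto
    then show ?thesis by simp
  next
    case False
    then show ?thesis by (simp add: zero)
  qed
  have "(LINT x:\<Omega>|lebesgue. deriv \<eta> x *\<^sub>R u x) + (LINT x:\<Omega>|lebesgue. \<eta> x *\<^sub>R v x)
      = (LINT x:\<Omega>|lebesgue. ?f x)"
    by (rule set_integral_add(2)[OF i1 i2, symmetric])
  also have "\<dots> = (LINT x:{- R..R}|lebesgue. ?f x)"
    unfolding set_lebesgue_integral_def ind ..
  also have "\<dots> = integral {- R..R} ?f"
    using set_integral_add(1)[OF i1 i2] unfolding set_integrable_def ind
    by (intro set_lebesgue_integral_eq_integral) (simp add: set_integrable_def)
  finally show "(LINT x:\<Omega>|lebesgue. deriv \<eta> x *\<^sub>R u x) = - (LINT x:\<Omega>|lebesgue. \<eta> x *\<^sub>R v x)"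
    using int0 by (simp add: add_eq_0_iff2)
qed

text \<open>
  The rescaled derivatives of the step are nonnegative kernels of total mass one, supported in
  \<open>{c..c + \<epsilon>}\<close>; they form an approximate identity from the right.
\<close>

lemma step_kernel_tendsto:
  fixes g :: "real \<Rightarrow> complex"
  assumes g: "continuous_on {a..d} g" and c: "a \<le> c" "c < d"
    and \<epsilon>: "\<epsilon> \<longlonglongrightarrow> 0" "\<And>n. \<epsilon> n > 0" "\<And>n. c + \<epsilon> n \<le> d"
  shows "(\<lambda>n. integral {a..d} (\<lambda>x. (deriv step ((x - c) / \<epsilon> n) / \<epsilon> n) *\<^sub>R g x)) \<longlonglongrightarrow> g c"
proof (rule LIMSEQ_I)
  fix r :: real assume "r > 0"
  define k where "k n x = deriv step ((x - c) / \<epsilon> n) / \<epsilon> n" for n x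
  have k_cont: "continuous_on S (k n)" for n S
    unfolding k_def[abs_def] using \<epsilon>(2)[of n]
    by (intro continuous_intros continuous_on_compose2[OF continuous_on_deriv_step]) auto
  have k_nonneg: "k n x \<ge> 0" for n x
    using deriv_step_nonneg \<epsilon>(2)[of n] by (simp add: k_def)
  have "(k n has_integral (step ((d - c) / \<epsilon> n) - step ((a - c) / \<epsilon> n))) {a..d}" for n
    unfolding k_def[abs_def] using c
    by (intro fundamental_theorem_of_calculus)
      (auto simp flip: has_real_derivative_iff_has_vector_derivative
        intro!: has_field_derivative_at_within step_shift_has_derivative)
  moreover have "step ((d - c) / \<epsilon> n) = 1" "step ((a - c) / \<epsilon> n) = 0" for n
    using c \<epsilon>(2,3)[of n] by (auto simp: field_simps intro!: step_eq_1 step_eq_0)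
  ultimately have k_int: "(k n has_integral 1) {a..d}" for n by simp
  obtain \<delta> where \<delta>: "\<delta> > 0" "\<And>x. x \<in> {a..d} \<Longrightarrow> dist x c < \<delta> \<Longrightarrow> dist (g x) (g c) < r / 2"
    using g c \<open>r > 0\<close> unfolding continuous_on_iff
    by (metis atLeastAtMost_iff half_gt_zero_iff less_imp_le)
  have "\<forall>\<^sub>F n in sequentially. \<epsilon> n < \<delta>"
    using \<epsilon>(1) \<delta>(1) by (rule order_tendstoD(2))
  then obtain N where N: "\<And>n. n \<ge> N \<Longrightarrow> \<epsilon> n < \<delta>" by (auto simp: eventually_sequentially)
  show "\<exists>N. \<forall>n\<ge>N. norm (integral {a..d} (\<lambda>x. (deriv step ((x - c) / \<epsilon> n) / \<epsilon> n) *\<^sub>R g x) - g c) < r"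
  proof (intro exI allI impI)
    fix n assume "n \<ge> N"
    have i1: "(\<lambda>x. k n x *\<^sub>R g x) integrable_on {a..d}"
      by (intro integrable_continuous_real continuous_intros k_cont g)
    have "((\<lambda>x. k n x *\<^sub>R g c) has_integral 1 *\<^sub>R g c) {a..d}"
      using k_int by (rule has_integral_scaleR_left)
    then have i2: "(\<lambda>x. k n x *\<^sub>R g c) integrable_on {a..d}" "integral {a..d} (\<lambda>x. k n x *\<^sub>R g c) = g c"
      by (auto simp: integral_unique integrable_on_def)
    have "integral {a..d} (\<lambda>x. k n x *\<^sub>R g x) - g c = integral {a..d} (\<lambda>x. k n x *\<^sub>R g x - k n x *\<^sub>R g c)"
      using integral_diff[OF i1 i2(1)] i2(2) by simp
    also have "norm \<dots> \<le> integral {a..d} (\<lambda>x. k n x * (r / 2))"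
    proof (rule integral_norm_bound_integral)
      show "(\<lambda>x. k n x *\<^sub>R g x - k n x *\<^sub>R g c) integrable_on {a..d}"
        by (intro integrable_diff i1 i2)
      show "(\<lambda>x. k n x * (r / 2)) integrable_on {a..d}"
        by (intro integrable_continuous_real continuous_intros k_cont)
      fix x assume x: "x \<in> {a..d}"
      have "norm (k n x *\<^sub>R (g x - g c)) \<le> k n x * (r / 2)"
      proof (cases "c \<le> x \<and> x \<le> c + \<epsilon> n")
        case True
        then have "dist x c < \<delta>" using N[OF \<open>n \<ge> N\<close>] by (simp add: dist_real_def)
        then show ?thesis
          using mult_left_mono[OF less_imp_le[OF \<delta>(2)[OF x]] k_nonneg[of n x]] k_nonneg[of n x]
          by (simp add: dist_norm)
      next
        case False
        then have "(x - c) / \<epsilon> n \<notin> {0..1}" using \<epsilon>(2)[of n] by (auto simp: field_simps)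
        then show ?thesis by (simp add: k_def deriv_step_eq_0)
      qed
      then show "norm (k n x *\<^sub>R g x - k n x *\<^sub>R g c) \<le> k n x * (r / 2)"
        by (simp add: scaleR_diff_right)
    qed
    also have "\<dots> = r / 2"
      using k_int[of n] by (simp add: integral_unique)
    also have "\<dots> < r" using \<open>r > 0\<close> by simp
    finally show "norm (integral {a..d} (\<lambda>x. (deriv step ((x - c) / \<epsilon> n) / \<epsilon> n) *\<^sub>R g x) - g c) < r"
      by (simp add: k_def)
  qed
qed

text \<open>
  Test with the cutoff of \<open>(a, b]\<close>: one side tends to the integral of \<open>h\<close>, the other, by the
  approximate identity at both end points, to the increment of \<open>g\<close>.
\<close>

lemma weak_deriv_integral:
  assumes weak: "is_weak_deriv \<Omega> g h"
    and g: "continuous_on {a..d} g" and h: "continuous_on {a..d} h"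
    and ab: "a \<le> b" "b < d" and sub: "{a..d} \<subseteq> \<Omega>"
  shows "g b - g a = integral {a..b} h"
proof -
  have "d - b > 0" using ab by simp
  then obtain \<epsilon> where \<epsilon>: "\<epsilon> \<longlonglongrightarrow> 0" "\<And>n. \<epsilon> n > 0" "\<And>n. \<epsilon> n \<le> d - b"
    using vanishing_sequence by blast
  have le: "b + \<epsilon> n \<le> d" "a + \<epsilon> n \<le> d" for n using \<epsilon>(3)[of n] ab by auto
  have h_int: "set_integrable lebesgue {a..d} h"
    using weak sub by (auto simp: is_weak_deriv_def locally_integrable_def)
  have test: "test_function \<Omega> (cutoff a b (\<epsilon> n))" for n
    by (rule test_function_cutoff) (use le[of n] ab \<epsilon>(2) sub in auto)
  let ?k = "\<lambda>c n x. deriv step ((x - c) / \<epsilon> n) / \<epsilon> n"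
  have k_cont: "continuous_on S (?k c n)" for c n S
    using \<epsilon>(2)[of n] by (intro continuous_intros continuous_on_compose2[OF continuous_on_deriv_step]) auto
  have eq: "(LINT x:\<Omega>|lebesgue. deriv (cutoff a b (\<epsilon> n)) x *\<^sub>R g x)
      = integral {a..d} (\<lambda>x. ?k a n x *\<^sub>R g x) - integral {a..d} (\<lambda>x. ?k b n x *\<^sub>R g x)" for n
  proof -
    have "deriv (cutoff a b (\<epsilon> n)) x = 0" if "x \<notin> {a..d}" for x
    proof -
      have "(x - a) / \<epsilon> n \<notin> {0..1}" "(x - b) / \<epsilon> n \<notin> {0..1}"
        using that \<epsilon>(2)[of n] le[of n] ab by (auto simp: field_simps)
      then show ?thesis by (simp add: deriv_cutoff deriv_step_eq_0)
    qed
    then have ind: "indicator \<Omega> x *\<^sub>R deriv (cutoff a b (\<epsilon> n)) x *\<^sub>R g x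
        = indicator {a..d} x *\<^sub>R deriv (cutoff a b (\<epsilon> n)) x *\<^sub>R g x" for x
      using sub by (auto simp: indicator_def)
    have "set_integrable lebesgue \<Omega> (\<lambda>x. deriv (cutoff a b (\<epsilon> n)) x *\<^sub>R g x)"
      using weak test_function_deriv[OF test] by (intro set_integrable_test_function) (auto simp: is_weak_deriv_def)
    then have "set_integrable lebesgue {a..d} (\<lambda>x. deriv (cutoff a b (\<epsilon> n)) x *\<^sub>R g x)"
      unfolding set_integrable_def ind .
    then have "(LINT x:\<Omega>|lebesgue. deriv (cutoff a b (\<epsilon> n)) x *\<^sub>R g x)
        = integral {a..d} (\<lambda>x. deriv (cutoff a b (\<epsilon> n)) x *\<^sub>R g x)"
      using set_lebesgue_integral_eq_integral(2) unfolding set_lebesgue_integral_def ind by blast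
    also have "\<dots> = integral {a..d} (\<lambda>x. ?k a n x *\<^sub>R g x - ?k b n x *\<^sub>R g x)"
      by (simp add: deriv_cutoff scaleR_diff_left)
    also have "\<dots> = integral {a..d} (\<lambda>x. ?k a n x *\<^sub>R g x) - integral {a..d} (\<lambda>x. ?k b n x *\<^sub>R g x)"
      by (intro integral_diff integrable_continuous_real continuous_on_scaleR k_cont g)
    finally show ?thesis .
  qed
  have "(\<lambda>n. LINT x:\<Omega>|lebesgue. deriv (cutoff a b (\<epsilon> n)) x *\<^sub>R g x) \<longlonglongrightarrow> g a - g b"
    unfolding eq using ab by (intro tendsto_diff step_kernel_tendsto g \<epsilon> le) auto
  moreover have "(\<lambda>n. LINT x:\<Omega>|lebesgue. deriv (cutoff a b (\<epsilon> n)) x *\<^sub>R g x)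
      \<longlonglongrightarrow> - (LINT x:{a<..b}|lebesgue. h x)"
  proof -
    have "(LINT x:\<Omega>|lebesgue. deriv (cutoff a b (\<epsilon> n)) x *\<^sub>R g x)
        = - (LINT x:\<Omega>|lebesgue. cutoff a b (\<epsilon> n) x *\<^sub>R h x)" for n
      using weak test unfolding is_weak_deriv_def by blast
    moreover have "(\<lambda>n. - (LINT x:\<Omega>|lebesgue. cutoff a b (\<epsilon> n) x *\<^sub>R h x)) \<longlonglongrightarrow> - (LINT x:{a<..b}|lebesgue. h x)"
      by (intro tendsto_minus cutoff_integral_tendsto[OF h_int ab(1) sub \<epsilon>(1,2) le(1)])
    ultimately show ?thesis by simp
  qed
  ultimately have "g a - g b = - (LINT x:{a<..b}|lebesgue. h x)"
    by (rule LIMSEQ_unique)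
  moreover have "(LINT x:{a<..b}|lebesgue. h x) = integral {a..b} h"
  proof -
    have "(LINT x:{a<..b}|lebesgue. h x) = integral {a<..b} h"
      by (intro set_lebesgue_integral_eq_integral(2) set_integrable_subset[OF h_int]) (use ab in auto)
    also have "\<dots> = integral {a..b} h"
      by (rule integral_spike_set) (auto intro: negligible_subset[of "{a}"])
    finally show ?thesis .
  qed
  ultimately show ?thesis by (simp add: algebra_simps)
qed

lemma weak_deriv_imp_derivative:
  assumes "open \<Omega>" and weak: "is_weak_deriv \<Omega> g h"
    and g: "continuous_on \<Omega> g" and h: "continuous_on \<Omega> h" and x: "x \<in> \<Omega>"
  shows "(g has_vector_derivative h x) (at x)"
proof -
  obtain r where r: "r > 0" "{x - r..x + r} \<subseteq> \<Omega>"
    using \<open>open \<Omega>\<close> x by (metis open_contains_cball cball_eq_atLeastAtMost)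
  have "continuous_on {x - r..x + r} h" using h r continuous_on_subset by blast
  then have "((\<lambda>u. integral {x - r..u} h) has_vector_derivative h x) (at x within {x - r..x + r})"
    by (rule integral_has_vector_derivative) (use r in auto)
  then have "((\<lambda>u. integral {x - r..u} h) has_vector_derivative h x) (at x)"
    using at_within_Icc_at[of "x - r" x "x + r"] r(1) by simp
  then have "((\<lambda>u. g (x - r) + integral {x - r..u} h) has_vector_derivative h x) (at x)"
    by (auto intro!: derivative_eq_intros)
  then show ?thesis
  proof (rule has_vector_derivative_transform_within_open[where S = "{x - r<..<x + r}"])
    fix y assume "y \<in> {x - r<..<x + r}"
    then show "g (x - r) + integral {x - r..y} h = g y"
      using weak_deriv_integral[OF weak continuous_on_subset[OF g r(2)] continuous_on_subset[OF h r(2)], of y] r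
      by (simp add: algebra_simps)
  qed (use r in auto)
qed

section \<open>Decaying solutions of the stationary equation on an interval\<close>

definition nls_force :: "real \<Rightarrow> real \<Rightarrow> complex \<Rightarrow> complex" where
  "nls_force lam \<omega> z = (\<omega> - lam * (cmod z)\<^sup>2) *\<^sub>R z"

text \<open>
  The second order equation as a first order system for position \<open>g\<close> and velocity \<open>h\<close>; keeping the
  velocity explicit lets the continuous representatives of \<open>\<psi>\<close> and \<open>\<psi>'\<close> be inserted directly.
\<close>

definition nls_solution ::
  "real \<Rightarrow> real \<Rightarrow> real set \<Rightarrow> (real \<Rightarrow> complex) \<Rightarrow> (real \<Rightarrow> complex) \<Rightarrow> bool" where
  "nls_solution lam \<omega> I g h \<longleftrightarrow>
     (\<forall>x\<in>I. (g has_vector_derivative h x) (at x) \<and>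
            (h has_vector_derivative nls_force lam \<omega> (g x)) (at x))"

definition soliton_deriv :: "real \<Rightarrow> real \<Rightarrow> real \<Rightarrow> real \<Rightarrow> complex" where
  "soliton_deriv lam \<omega> y x = of_real (- sqrt \<omega> * tanh (sqrt \<omega> * (x - y))) * soliton lam \<omega> y x"

lemma sech_pos: "sech x > 0"
  by (simp add: sech_def cosh_real_pos)

lemma sech_square: "(sech x)\<^sup>2 = 1 - (tanh x)\<^sup>2"
  by (simp add: sech_def tanh_def power_divide sinh_square_eq diff_divide_distrib)

lemma sech_has_derivative:
  "(sech has_real_derivative - tanh x * sech x) (at x)"
  unfolding sech_def[abs_def] tanh_def
  using cosh_real_pos[of x]
  by (auto intro!: derivative_eq_intros simp: power2_eq_square)

lemma cmod_soliton:
  assumes "lam > 0" "\<omega> > 0"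
  shows "cmod (soliton lam \<omega> y x) = sqrt (2 * \<omega> / lam) * sech (sqrt \<omega> * (x - y))"
proof -
  have "sqrt (2 * \<omega> / lam) * sech (sqrt \<omega> * (x - y)) \<ge> 0"
    using assms by (intro mult_nonneg_nonneg less_imp_le[OF sech_pos]) auto
  then show ?thesis
    by (simp only: soliton_def norm_of_real abs_of_nonneg)
qed

lemma soliton_ne_0: "lam > 0 \<Longrightarrow> \<omega> > 0 \<Longrightarrow> soliton lam \<omega> y x \<noteq> 0"
  using sech_pos[of "sqrt \<omega> * (x - y)"] by (simp add: soliton_def)

text \<open>
  With \<open>\<sigma> = A sech\<close> one has \<open>\<lambda> \<sigma>\<^sup>2 = 2 \<omega> sech\<^sup>2 = 2 \<omega> (1 - tanh\<^sup>2)\<close>, which turns the second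
  derivative \<open>\<omega> (2 tanh\<^sup>2 - 1) \<sigma>\<close> into the force.
\<close>

lemma nls_solution_soliton:
  assumes "lam > 0" "\<omega> > 0" "cmod c = 1"
  shows "nls_solution lam \<omega> I (\<lambda>x. c * soliton lam \<omega> y x) (\<lambda>x. c * soliton_deriv lam \<omega> y x)"
proof -
  define A s where "A = sqrt (2 * \<omega> / lam)" and "s = sqrt \<omega>"
  have s2: "s * s = \<omega>" using assms by (simp add: s_def)
  have A2: "A\<^sup>2 = 2 * \<omega> / lam" using assms by (simp add: A_def del: real_sqrt_divide)
  let ?\<sigma> = "\<lambda>x. A * sech (s * (x - y))"
  let ?\<tau> = "\<lambda>x. - s * tanh (s * (x - y)) * ?\<sigma> x"
  have in_arg: "((\<lambda>x. s * (x - y)) has_real_derivative s) (at x)" for x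
    by (auto intro!: derivative_eq_intros)
  have d1: "(?\<sigma> has_real_derivative ?\<tau> x) (at x)" for x
    using DERIV_cmult[OF DERIV_chain2[OF sech_has_derivative in_arg], of A]
    by (simp add: mult_ac)
  have tanh': "(tanh has_real_derivative (1 - (tanh u)\<^sup>2)) (at u)" for u :: real
    by (auto intro!: derivative_eq_intros simp: cosh_real_pos less_imp_neq[symmetric])
  have d2: "(?\<tau> has_real_derivative (\<omega> - lam * (?\<sigma> x)\<^sup>2) * ?\<sigma> x) (at x)" for x
  proof -
    let ?t = "tanh (s * (x - y))"
    have "(?\<tau> has_real_derivative
       (- s * ((1 - ?t\<^sup>2) * s)) * ?\<sigma> x + ?\<tau> x * (- s * ?t)) (at x)"
      by (intro DERIV_mult DERIV_cmult d1 DERIV_chain2[OF tanh' in_arg])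
    moreover have "(- s * ((1 - ?t\<^sup>2) * s)) * ?\<sigma> x + ?\<tau> x * (- s * ?t)
       = (\<omega> - lam * (?\<sigma> x)\<^sup>2) * ?\<sigma> x"
    proof -
      have "lam * (?\<sigma> x)\<^sup>2 = 2 * \<omega> * (1 - ?t\<^sup>2)"
        using assms by (simp add: power_mult_distrib A2 sech_square)
      then have "(\<omega> - lam * (?\<sigma> x)\<^sup>2) * ?\<sigma> x = (\<omega> - 2 * \<omega> * (1 - ?t\<^sup>2)) * ?\<sigma> x"
        by (simp only:)
      also have "\<dots> = s * s * (2 * ?t\<^sup>2 - 1) * ?\<sigma> x"
        by (simp add: s2 algebra_simps)
      also have "\<dots> = (- s * ((1 - ?t\<^sup>2) * s)) * ?\<sigma> x + ?\<tau> x * (- s * ?t)"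
        by (simp add: algebra_simps power2_eq_square)
      finally show ?thesis by simp
    qed
    ultimately show ?thesis by metis
  qed
  have g: "soliton lam \<omega> y = (\<lambda>x. of_real (?\<sigma> x))"
    by (simp add: soliton_def A_def s_def fun_eq_iff)
  have h: "soliton_deriv lam \<omega> y = (\<lambda>x. of_real (?\<tau> x))"
    by (simp add: soliton_deriv_def g s_def fun_eq_iff)
  have f: "nls_force lam \<omega> (c * of_real (?\<sigma> x)) = c * of_real ((\<omega> - lam * (?\<sigma> x)\<^sup>2) * ?\<sigma> x)" for x
    using assms(3) by (simp add: nls_force_def norm_mult power_mult_distrib scaleR_conv_of_real)
  show ?thesis
    unfolding nls_solution_def g h f
    by (intro ballI conjI has_vector_derivative_mult_right has_vector_derivative_of_real d1 d2)
qed

lemma has_real_derivative_inner: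
  fixes f g :: "real \<Rightarrow> 'a::real_inner"
  assumes "(f has_vector_derivative f') (at x)" "(g has_vector_derivative g') (at x)"
  shows "((\<lambda>x. f x \<bullet> g x) has_real_derivative f x \<bullet> g' + f' \<bullet> g x) (at x)"
  using bounded_bilinear.has_vector_derivative[OF bounded_bilinear_inner assms]
  by (simp add: has_real_derivative_iff_has_vector_derivative)

text \<open>
  \<open>D exp (- C x)\<close> is nonincreasing to the right of the zero, \<open>D exp (C x)\<close> nondecreasing to the left,
  so \<open>D\<close> is nowhere positive.
\<close>

lemma zero_of_gronwall_bound:
  fixes D D' :: "real \<Rightarrow> real"
  assumes I: "is_interval I" "x0 \<in> I"
    and D: "\<And>x. x \<in> I \<Longrightarrow> (D has_real_derivative D' x) (at x)"
    and bound: "\<And>x. x \<in> I \<Longrightarrow> \<bar>D' x\<bar> \<le> C * D x"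
    and nonneg: "\<And>x. x \<in> I \<Longrightarrow> D x \<ge> 0" and zero: "D x0 = 0" and x: "x \<in> I"
  shows "D x = 0"
proof -
  have deriv: "((\<lambda>x. D x * exp (K * x)) has_real_derivative (D' z + K * D z) * exp (K * z)) (at z)"
    if "z \<in> I" for z K
  proof -
    have "((\<lambda>x. exp (K * x)) has_real_derivative exp (K * z) * K) (at z)"
      by (auto intro!: derivative_eq_intros)
    from DERIV_mult[OF D[OF that] this] show ?thesis
      by (simp add: algebra_simps)
  qed
  have "D x * exp (K * x) \<le> 0" if "K = (if x0 \<le> x then - C else C)" for K
  proof (cases "x0 \<le> x")
    case True
    have "D x * exp (- C * x) \<le> D x0 * exp (- C * x0)"
    proof (rule DERIV_nonpos_imp_nonincreasing[OF True])
      fix z assume "x0 \<le> z" "z \<le> x"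
      then have z: "z \<in> I" using I x mem_is_interval_1_I by blast
      have "(D' z + - C * D z) * exp (- C * z) \<le> 0"
        using bound[OF z] by (intro mult_nonpos_nonneg) auto
      then show "\<exists>d. ((\<lambda>x. D x * exp (- C * x)) has_real_derivative d) (at z) \<and> d \<le> 0"
        using deriv[OF z] by blast
    qed
    then show ?thesis using True that zero by simp
  next
    case False
    then have le: "x \<le> x0" by simp
    have "D x * exp (C * x) \<le> D x0 * exp (C * x0)"
    proof (rule DERIV_nonneg_imp_nondecreasing[OF le])
      fix z assume "x \<le> z" "z \<le> x0"
      then have z: "z \<in> I" using I x mem_is_interval_1_I by blast
      have "0 \<le> (D' z + C * D z) * exp (C * z)"
        using bound[OF z] by (intro mult_nonneg_nonneg) auto
      then show "\<exists>d. ((\<lambda>x. D x * exp (C * x)) has_real_derivative d) (at z) \<and> d \<ge> 0"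
        using deriv[OF z] by blast
    qed
    then show ?thesis using False that zero by simp
  qed
  then have "D x \<le> 0" by (simp add: mult_le_0_iff)
  then show ?thesis using nonneg[OF x] by simp
qed

lemma nls_force_lipschitz:
  assumes "lam > 0" "\<omega> > 0" "cmod z \<le> M" "cmod w \<le> M"
  shows "cmod (nls_force lam \<omega> z - nls_force lam \<omega> w) \<le> (\<omega> + 3 * lam * M\<^sup>2) * cmod (z - w)"
proof -
  have M: "M \<ge> 0" using assms(3) norm_ge_zero order_trans by blast
  have "nls_force lam \<omega> z - nls_force lam \<omega> w
      = \<omega> *\<^sub>R (z - w) - (lam * (cmod z)\<^sup>2) *\<^sub>R (z - w) - (lam * ((cmod z)\<^sup>2 - (cmod w)\<^sup>2)) *\<^sub>R w"
    by (simp add: nls_force_def algebra_simps scaleR_diff_left scaleR_diff_right)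
  also have "cmod \<dots> \<le> cmod (\<omega> *\<^sub>R (z - w)) + cmod ((lam * (cmod z)\<^sup>2) *\<^sub>R (z - w))
      + cmod ((lam * ((cmod z)\<^sup>2 - (cmod w)\<^sup>2)) *\<^sub>R w)"
    by (rule order_trans[OF norm_triangle_ineq4 add_mono[OF norm_triangle_ineq4 order_refl]])
  also have "\<dots> = \<omega> * cmod (z - w) + lam * (cmod z)\<^sup>2 * cmod (z - w)
      + lam * \<bar>(cmod z)\<^sup>2 - (cmod w)\<^sup>2\<bar> * cmod w"
    using assms by (simp add: abs_mult)
  also have "\<dots> \<le> \<omega> * cmod (z - w) + lam * M\<^sup>2 * cmod (z - w) + lam * (2 * M * cmod (z - w)) * M"
  proof (intro add_mono order_refl mult_mono power_mono)
    have "\<bar>(cmod z)\<^sup>2 - (cmod w)\<^sup>2\<bar> = (cmod z + cmod w) * \<bar>cmod z - cmod w\<bar>"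
      by (simp add: square_diff_square_factored power2_eq_square abs_mult)
    also have "\<dots> \<le> (2 * M) * cmod (z - w)"
      using assms M by (intro mult_mono norm_triangle_ineq3) auto
    finally show "\<bar>(cmod z)\<^sup>2 - (cmod w)\<^sup>2\<bar> \<le> 2 * M * cmod (z - w)" .
  qed (use assms M in auto)
  also have "\<dots> = (\<omega> + 3 * lam * M\<^sup>2) * cmod (z - w)"
    by (simp add: algebra_simps power2_eq_square)
  finally show ?thesis .
qed

text \<open>
  Gronwall for the squared distance of the two solutions in phase space; the common bound \<open>M\<close> makes
  the force Lipschitz.
\<close>

lemma nls_solution_unique:
  assumes pos: "lam > 0" "\<omega> > 0" and I: "is_interval I" "x0 \<in> I"
    and sol1: "nls_solution lam \<omega> I g1 h1" and sol2: "nls_solution lam \<omega> I g2 h2"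
    and M: "\<And>x. x \<in> I \<Longrightarrow> cmod (g1 x) \<le> M" "\<And>x. x \<in> I \<Longrightarrow> cmod (g2 x) \<le> M"
    and init: "g1 x0 = g2 x0" "h1 x0 = h2 x0" and x: "x \<in> I"
  shows "g1 x = g2 x \<and> h1 x = h2 x"
proof -
  define u v f where "u = (\<lambda>x. g1 x - g2 x)" and "v = (\<lambda>x. h1 x - h2 x)"
    and "f = (\<lambda>x. nls_force lam \<omega> (g1 x) - nls_force lam \<omega> (g2 x))"
  define L where "L = \<omega> + 3 * lam * M\<^sup>2"
  have L: "L \<ge> 0" using pos by (simp add: L_def)
  have u: "(u has_vector_derivative v x) (at x)" and v: "(v has_vector_derivative f x) (at x)"
    if "x \<in> I" for x
    using sol1 sol2 that unfolding nls_solution_def u_def v_def f_def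
    by (auto intro!: derivative_intros)
  define D where "D = (\<lambda>x. u x \<bullet> u x + v x \<bullet> v x)"
  have D: "(D has_real_derivative 2 * (u x \<bullet> v x) + 2 * (v x \<bullet> f x)) (at x)" if "x \<in> I" for x
  proof -
    have "(D has_real_derivative (u x \<bullet> v x + v x \<bullet> u x) + (v x \<bullet> f x + f x \<bullet> v x)) (at x)"
      unfolding D_def by (intro DERIV_add has_real_derivative_inner u v that)
    then show ?thesis by (simp add: inner_commute)
  qed
  have bound: "\<bar>2 * (u x \<bullet> v x) + 2 * (v x \<bullet> f x)\<bar> \<le> (1 + L) * D x" if "x \<in> I" for x
  proof -
    have "norm (f x) \<le> L * norm (u x)"
      unfolding f_def u_def L_def by (rule nls_force_lipschitz[OF pos M(1)[OF that] M(2)[OF that]])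
    have "\<bar>2 * (u x \<bullet> v x) + 2 * (v x \<bullet> f x)\<bar> \<le> 2 * (norm (u x) * norm (v x)) + 2 * (norm (v x) * norm (f x))"
      using Cauchy_Schwarz_ineq2[of "u x" "v x"] Cauchy_Schwarz_ineq2[of "v x" "f x"] by linarith
    also have "\<dots> \<le> 2 * (norm (u x) * norm (v x)) + 2 * (norm (v x) * (L * norm (u x)))"
      using \<open>norm (f x) \<le> L * norm (u x)\<close> by (intro add_mono mult_left_mono) auto
    also have "\<dots> = (1 + L) * (2 * norm (u x) * norm (v x))"
      by (simp add: algebra_simps)
    also have "\<dots> \<le> (1 + L) * D x"
      using L sum_squares_bound[of "norm (u x)" "norm (v x)"]
      by (intro mult_left_mono) (auto simp: D_def dot_square_norm)
    finally show ?thesis .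
  qed
  have "D x = 0"
  proof (rule zero_of_gronwall_bound[OF I D bound])
    show "D x0 = 0" using init by (simp add: D_def u_def v_def)
    show "D z \<ge> 0" for z by (simp add: D_def)
  qed (use x in auto)
  then show ?thesis
    by (simp add: D_def u_def v_def add_nonneg_eq_0_iff)
qed

text \<open>
  The equation is Newton's equation in the plane with a central force, so energy and angular momentum
  are conserved. The angular momentum \<open>Im (cnj g * h)\<close> is written as an inner product.
\<close>

lemma nls_conservation:
  assumes I: "is_interval I" and sol: "nls_solution lam \<omega> I g h"
  shows "\<exists>E. \<forall>x\<in>I. (cmod (h x))\<^sup>2 - \<omega> * (cmod (g x))\<^sup>2 + lam / 2 * (cmod (g x))^4 = E"
    and "\<exists>J. \<forall>x\<in>I. (\<i> * g x) \<bullet> h x = J"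
proof -
  have g: "(g has_vector_derivative h x) (at x)"
    and h: "(h has_vector_derivative nls_force lam \<omega> (g x)) (at x)" if "x \<in> I" for x
    using sol that by (auto simp: nls_solution_def)
  have "((\<lambda>x. h x \<bullet> h x - \<omega> * (g x \<bullet> g x) + lam / 2 * ((g x \<bullet> g x) * (g x \<bullet> g x)))
      has_real_derivative 0) (at x within I)" if x: "x \<in> I" for x
  proof -
    let ?f = "nls_force lam \<omega> (g x)"
    have gg: "((\<lambda>x. g x \<bullet> g x) has_real_derivative g x \<bullet> h x + h x \<bullet> g x) (at x)"
      by (rule has_real_derivative_inner[OF g[OF x] g[OF x]])
    have "((\<lambda>x. h x \<bullet> h x - \<omega> * (g x \<bullet> g x) + lam / 2 * ((g x \<bullet> g x) * (g x \<bullet> g x)))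
      has_real_derivative (h x \<bullet> ?f + ?f \<bullet> h x) - \<omega> * (g x \<bullet> h x + h x \<bullet> g x)
        + lam / 2 * ((g x \<bullet> h x + h x \<bullet> g x) * (g x \<bullet> g x) + (g x \<bullet> h x + h x \<bullet> g x) * (g x \<bullet> g x))) (at x)"
      by (intro DERIV_add DERIV_diff DERIV_cmult DERIV_mult gg has_real_derivative_inner h x)
    moreover have "(h x \<bullet> ?f + ?f \<bullet> h x) - \<omega> * (g x \<bullet> h x + h x \<bullet> g x)
        + lam / 2 * ((g x \<bullet> h x + h x \<bullet> g x) * (g x \<bullet> g x) + (g x \<bullet> h x + h x \<bullet> g x) * (g x \<bullet> g x)) = 0"
      by (simp add: nls_force_def inner_commute[of "h x" "g x"] dot_square_norm algebra_simps)
    ultimately show ?thesis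
      by (simp add: has_field_derivative_at_within)
  qed
  then have "\<exists>E. \<forall>x\<in>I. h x \<bullet> h x - \<omega> * (g x \<bullet> g x) + lam / 2 * ((g x \<bullet> g x) * (g x \<bullet> g x)) = E"
    using I by (intro has_field_derivative_zero_constant) (auto simp: is_interval_convex_1)
  then show "\<exists>E. \<forall>x\<in>I. (cmod (h x))\<^sup>2 - \<omega> * (cmod (g x))\<^sup>2 + lam / 2 * (cmod (g x))^4 = E"
    by (simp add: dot_square_norm flip: power_add)
  have "((\<lambda>x. (\<i> * g x) \<bullet> h x) has_real_derivative 0) (at x within I)" if x: "x \<in> I" for x
  proof -
    have "((\<lambda>x. (\<i> * g x) \<bullet> h x) has_real_derivative
        (\<i> * g x) \<bullet> nls_force lam \<omega> (g x) + (\<i> * h x) \<bullet> h x) (at x)"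
      by (intro has_real_derivative_inner has_vector_derivative_mult_right g h x)
    moreover have "(\<i> * g x) \<bullet> nls_force lam \<omega> (g x) + (\<i> * h x) \<bullet> h x = 0"
      by (simp add: nls_force_def inner_complex_def algebra_simps)
    ultimately show ?thesis by (simp add: has_field_derivative_at_within)
  qed
  then show "\<exists>J. \<forall>x\<in>I. (\<i> * g x) \<bullet> h x = J"
    using I by (intro has_field_derivative_zero_constant) (auto simp: is_interval_convex_1)
qed

text \<open>
  Both invariants are constant, and they are small where \<open>|g|\<^sup>2 + |h|\<^sup>2\<close> is small.
\<close>

lemma nls_invariants_vanish:
  assumes pos: "lam > 0" "\<omega> > 0" and I: "is_interval I" and sol: "nls_solution lam \<omega> I g h"
    and small: "\<And>\<epsilon>. \<epsilon> > 0 \<Longrightarrow> \<exists>x\<in>I. (cmod (g x))\<^sup>2 + (cmod (h x))\<^sup>2 < \<epsilon>"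
    and x: "x \<in> I"
  shows "(cmod (h x))\<^sup>2 = \<omega> * (cmod (g x))\<^sup>2 - lam / 2 * (cmod (g x))^4" "(\<i> * g x) \<bullet> h x = 0"
proof -
  obtain E J where E: "\<And>x. x \<in> I \<Longrightarrow> (cmod (h x))\<^sup>2 - \<omega> * (cmod (g x))\<^sup>2 + lam / 2 * (cmod (g x))^4 = E"
    and J: "\<And>x. x \<in> I \<Longrightarrow> (\<i> * g x) \<bullet> h x = J"
    using nls_conservation[OF I sol] by metis
  have bound: "\<bar>E\<bar> \<le> (1 + \<omega> + lam) * \<epsilon> \<and> \<bar>J\<bar> \<le> \<epsilon>" if \<epsilon>: "\<epsilon> > 0" "\<epsilon> < 1" for \<epsilon>
  proof -
    obtain z where z: "z \<in> I" "(cmod (g z))\<^sup>2 + (cmod (h z))\<^sup>2 < \<epsilon>" using small[OF \<epsilon>(1)] by blast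
    define p q where "p = (cmod (g z))\<^sup>2" and "q = (cmod (h z))\<^sup>2"
    have pq: "0 \<le> p" "0 \<le> q" "p + q < \<epsilon>" using z by (auto simp: p_def q_def)
    have pp: "p * p \<le> \<epsilon>"
      using mult_mono[of p \<epsilon> p 1] pq \<epsilon> by simp
    have Ez: "E = q - \<omega> * p + lam / 2 * (p * p)"
      using E[OF z(1)] by (simp add: p_def q_def flip: power_add)
    have "\<omega> * p \<le> \<omega> * \<epsilon>" "lam / 2 * (p * p) \<le> lam / 2 * \<epsilon>" "0 \<le> \<omega> * p" "0 \<le> lam / 2 * (p * p)"
      "0 \<le> lam * \<epsilon>"
      using pos pq pp \<epsilon> by (auto intro!: mult_left_mono)
    then have "\<bar>E\<bar> \<le> (1 + \<omega> + lam) * \<epsilon>"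
      unfolding Ez using pq \<epsilon> by (simp add: algebra_simps abs_le_iff)
    moreover have "\<bar>J\<bar> \<le> cmod (g z) * cmod (h z)"
      using J[OF z(1)] Cauchy_Schwarz_ineq2[of "\<i> * g z" "h z"] by (simp add: norm_mult)
    moreover have "2 * (cmod (g z) * cmod (h z)) \<le> p + q"
      using sum_squares_bound[of "cmod (g z)" "cmod (h z)"] by (simp add: p_def q_def mult_ac)
    ultimately show ?thesis using pq by simp
  qed
  have "\<bar>E\<bar> / (1 + \<omega> + lam) \<le> 0"
  proof (rule field_le_epsilon)
    fix e :: real assume "e > 0"
    define m where "m = min e (1 / 2)"
    have m: "0 < m" "m < 1" "m \<le> e" using \<open>e > 0\<close> by (auto simp: m_def)
    have "\<bar>E\<bar> / (1 + \<omega> + lam) \<le> m"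
      using bound[OF m(1,2)] pos by (simp add: pos_divide_le_eq mult.commute)
    with m(3) show "\<bar>E\<bar> / (1 + \<omega> + lam) \<le> 0 + e" by simp
  qed
  then have "E = 0" using pos by (simp add: divide_le_0_iff)
  then show "(cmod (h x))\<^sup>2 = \<omega> * (cmod (g x))\<^sup>2 - lam / 2 * (cmod (g x))^4"
    using E[OF x] by simp
  have "\<bar>J\<bar> \<le> 0"
  proof (rule field_le_epsilon)
    fix e :: real assume "e > 0"
    then show "\<bar>J\<bar> \<le> 0 + e"
      using bound[of "min e (1 / 2)"] by simp
  qed
  then show "(\<i> * g x) \<bullet> h x = 0" using J[OF x] by simp
qed

lemma tanh_artanh:
  assumes "\<bar>t\<bar> < 1"
  shows "tanh (artanh t) = (t::real)"
proof -
  define r where "r = (1 + t) / (1 - t)"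
  have r: "r > 0" using assms by (simp add: r_def)
  have "exp (- 2 * artanh t) = inverse r"
    using r by (simp add: artanh_def r_def[symmetric] exp_minus)
  then have "tanh (artanh t) = (1 - inverse r) / (1 + inverse r)"
    by (simp add: tanh_real_altdef)
  also have "\<dots> = t"
  proof -
    have "1 - inverse r = 2 * t / (1 + t)" "1 + inverse r = 2 / (1 + t)"
      using assms by (auto simp: r_def field_simps abs_less_iff)
    then show ?thesis using assms by (simp add: abs_less_iff)
  qed
  finally show ?thesis .
qed

text \<open>
  Zero energy and zero momentum leave a one-parameter family of states up to phase, which one soliton
  orbit sweeps out: the velocity relative to the position fixes \<open>tanh\<close> of the shift, and the energy
  relation then gives the right amplitude.
\<close>

lemma soliton_through_point:
  assumes pos: "lam > 0" "\<omega> > 0" and "z \<noteq> 0"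
    and E: "(cmod w)\<^sup>2 = \<omega> * (cmod z)\<^sup>2 - lam / 2 * (cmod z)^4"
    and J: "(\<i> * z) \<bullet> w = 0"
  obtains c y where "cmod c = 1" "z = c * soliton lam \<omega> y x" "w = c * soliton_deriv lam \<omega> y x"
proof -
  define r c where "r = cmod z" and "c = z / of_real (cmod z)"
  have r: "r > 0" using assms by (simp add: r_def)
  have c: "cmod c = 1" "z = c * of_real r" using assms by (auto simp: c_def r_def norm_divide)
  \<comment> \<open>the vanishing momentum makes w a real multiple of z\<close>
  define q where "q = (z \<bullet> w) / r"
  have w: "w = c * of_real q"
  proof -
    have "cnj z * w = of_real (z \<bullet> w)"
      using J by (simp add: complex_eq_iff inner_complex_def algebra_simps)
    then have "z * cnj z * w = z * of_real (z \<bullet> w)" by (simp add: mult.assoc)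
    then have "of_real (r\<^sup>2) * w = z * of_real (z \<bullet> w)"
      by (simp only: complex_norm_square r_def)
    then show ?thesis using r c
      by (simp add: q_def field_simps power2_eq_square)
  qed
  have q2: "q\<^sup>2 = \<omega> * r\<^sup>2 - lam / 2 * r^4"
    using E c(1) by (simp add: w norm_mult r_def)
  define t where "t = - q / (sqrt \<omega> * r)"
  have t2: "t\<^sup>2 = 1 - lam / (2 * \<omega>) * r\<^sup>2"
  proof -
    have "t\<^sup>2 = q\<^sup>2 / (\<omega> * r\<^sup>2)"
      using pos by (simp add: t_def power_divide power_mult_distrib)
    also have "\<dots> = 1 - lam / (2 * \<omega>) * r\<^sup>2"
      unfolding q2 using pos r by (simp add: field_simps power2_eq_square power4_eq_xxxx)
    finally show ?thesis .
  qed
  have "lam / (2 * \<omega>) * r\<^sup>2 > 0" using pos r by simp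
  then have t: "\<bar>t\<bar> < 1" using t2 by (simp add: abs_square_less_1[symmetric])
  define y where "y = x - artanh t / sqrt \<omega>"
  have arg: "sqrt \<omega> * (x - y) = artanh t" using pos by (simp add: y_def)
  have "(sqrt (2 * \<omega> / lam) * sech (artanh t))\<^sup>2 = r\<^sup>2"
    using pos by (simp add: power_mult_distrib sech_square tanh_artanh[OF t] t2 del: real_sqrt_divide)
  then have amp: "sqrt (2 * \<omega> / lam) * sech (artanh t) = r"
    using r pos sech_pos[of "artanh t"] by (simp add: power2_eq_iff_nonneg)
  have sol: "soliton lam \<omega> y x = of_real r"
    by (simp add: soliton_def arg amp del: of_real_mult)
  have "soliton_deriv lam \<omega> y x = of_real (- sqrt \<omega> * t * r)"
    by (simp add: soliton_deriv_def sol arg tanh_artanh[OF t])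
  also have "- sqrt \<omega> * t * r = q" using pos r by (simp add: t_def)
  finally show thesis using that[of c y] c w sol by simp
qed

text \<open>
  Zero energy bounds \<open>|g|\<close> by the soliton amplitude, so solutions are compared globally with the
  soliton (or zero) that shares their data at one point.
\<close>

lemma nls_solution_classification:
  assumes pos: "lam > 0" "\<omega> > 0" and I: "is_interval I" "I \<noteq> {}"
    and sol: "nls_solution lam \<omega> I g h"
    and small: "\<And>\<epsilon>. \<epsilon> > 0 \<Longrightarrow> \<exists>x\<in>I. (cmod (g x))\<^sup>2 + (cmod (h x))\<^sup>2 < \<epsilon>"
  shows "(\<forall>x\<in>I. g x = 0 \<and> h x = 0) \<or>
    (\<exists>c y. cmod c = 1 \<and> (\<forall>x\<in>I. g x = c * soliton lam \<omega> y x \<and> h x = c * soliton_deriv lam \<omega> y x))"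
proof -
  have inv: "(cmod (h x))\<^sup>2 = \<omega> * (cmod (g x))\<^sup>2 - lam / 2 * (cmod (g x))^4" "(\<i> * g x) \<bullet> h x = 0"
    if "x \<in> I" for x
    using nls_invariants_vanish[OF pos I(1) sol _ that] small by blast+
  define M where "M = sqrt (2 * \<omega> / lam)"
  have M: "cmod (g x) \<le> M" if "x \<in> I" for x
  proof (cases "g x = 0")
    case True
    then show ?thesis using pos by (simp add: M_def)
  next
    case False
    have "lam / 2 * (cmod (g x))\<^sup>2 * (cmod (g x))\<^sup>2 \<le> \<omega> * (cmod (g x))\<^sup>2"
      using inv(1)[OF that] zero_le_power2[of "cmod (h x)"]
      by (simp add: power4_eq_xxxx power2_eq_square mult_ac)
    then have "lam / 2 * (cmod (g x))\<^sup>2 \<le> \<omega>"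
      using False by (simp add: mult_le_cancel_right)
    then show ?thesis
      unfolding M_def using pos by (intro real_le_rsqrt) (simp add: field_simps)
  qed
  obtain x0 where x0: "x0 \<in> I" using I by blast
  show ?thesis
  proof (cases "g x0 = 0")
    case True
    then have "h x0 = 0" using inv(1)[OF x0] by simp
    have "nls_solution lam \<omega> I (\<lambda>_. 0) (\<lambda>_. 0)"
      by (simp add: nls_solution_def nls_force_def)
    from nls_solution_unique[OF pos I(1) x0 sol this M] True \<open>h x0 = 0\<close> pos
    show ?thesis by (simp add: M_def)
  next
    case False
    obtain c y where cy: "cmod c = 1" "g x0 = c * soliton lam \<omega> y x0" "h x0 = c * soliton_deriv lam \<omega> y x0"
      using soliton_through_point[OF pos False inv(1)[OF x0] inv(2)[OF x0]] by blast
    have "cmod (c * soliton lam \<omega> y x) \<le> M" for x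
    proof -
      have "(sech u)\<^sup>2 \<le> 1\<^sup>2" for u by (simp add: sech_square)
      then have "sech u \<le> 1" for u by (rule power2_le_imp_le) simp
      then show ?thesis
        using pos cy(1) by (simp add: norm_mult cmod_soliton M_def mult_left_le del: real_sqrt_divide)
    qed
    from nls_solution_unique[OF pos I(1) x0 sol nls_solution_soliton[OF pos cy(1)] M this cy(2,3)]
    show ?thesis using cy(1) by blast
  qed
qed

section \<open>The matching conditions at the origin\<close>

lemma tanh_shift: "\<omega> > 0 \<Longrightarrow> \<bar>t\<bar> < 1 \<Longrightarrow> tanh (sqrt \<omega> * shift \<omega> t) = t"
  using tanh_artanh[of t] by (simp add: shift_def artanh_def)

lemma shift_tanh: "\<omega> > 0 \<Longrightarrow> shift \<omega> (tanh (sqrt \<omega> * y)) = y"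
  using artanh_tanh_real[of "sqrt \<omega> * y"] by (simp add: shift_def artanh_def field_simps)

lemma eq_shift_iff:
  assumes "\<omega> > 0" "\<bar>t\<bar> < 1"
  shows "y = shift \<omega> t \<longleftrightarrow> tanh (sqrt \<omega> * y) = t" "y = - shift \<omega> t \<longleftrightarrow> tanh (sqrt \<omega> * y) = - t"
proof -
  show 1: "y = shift \<omega> t \<longleftrightarrow> tanh (sqrt \<omega> * y) = t" for y
    using tanh_shift[OF assms] shift_tanh[OF assms(1), of y] by auto
  show "y = - shift \<omega> t \<longleftrightarrow> tanh (sqrt \<omega> * y) = - t"
    using 1[of "- y"] by auto
qed

lemma antisym_shift_eq_shift:
  assumes "\<gamma> * sqrt \<omega> > 2"
  shows "antisym_shift \<gamma> \<omega> = shift \<omega> (2 / (\<gamma> * sqrt \<omega>))"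
proof -
  have "(g + 2) / (g - 2) = (1 + 2 / g) / (1 - 2 / g)" if "g > 2" for g :: real
    using that by (simp add: field_simps)
  from this[OF assms] show ?thesis by (simp only: antisym_shift_def shift_def)
qed

text \<open>
  The difference of the two sides is \<open>(a\<^sup>2 - b\<^sup>2) (1 - (a\<^sup>2 + b\<^sup>2))\<close>.
\<close>

lemma quartic_level_eq_iff:
  fixes a b :: real
  shows "a^2 - a^4 = b^2 - b^4 \<longleftrightarrow> a\<^sup>2 = b\<^sup>2 \<or> a\<^sup>2 + b\<^sup>2 = 1"
proof -
  have "a^2 - a^4 = b^2 - b^4 \<longleftrightarrow> (a\<^sup>2 - b\<^sup>2) * (1 - (a\<^sup>2 + b\<^sup>2)) = 0"
    by (simp add: algebra_simps power4_eq_xxxx power2_eq_square)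
  then show ?thesis by auto
qed

text \<open>
  The case \<open>t1\<^sup>2 = t2\<^sup>2\<close> of the quartic equation would make \<open>\<gamma> \<surd>\<omega>\<close> vanish.
\<close>

lemma same_sign_system_iff:
  assumes "\<gamma> > 0" "\<omega> > 0"
  shows "same_sign_system \<gamma> \<omega> t1 t2 \<longleftrightarrow>
    0 < t1 \<and> 0 < t2 \<and> t1\<^sup>2 + t2\<^sup>2 = 1 \<and> t2 - t1 = \<gamma> * sqrt \<omega> * (t1 * t2)"
proof -
  define g where "g = \<gamma> * sqrt \<omega>"
  have g: "g > 0" using assms by (simp add: g_def)
  have inv: "inverse t1 - inverse t2 = g \<longleftrightarrow> t2 - t1 = g * (t1 * t2)" if "t1 > 0" "t2 > 0"
    using that by (auto simp: field_simps)
  have "t1\<^sup>2 \<noteq> t2\<^sup>2" if "t1 > 0" "t2 > 0" "t2 - t1 = g * (t1 * t2)"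
    using that g by (auto simp: power2_eq_iff)
  moreover have "t1 \<le> 1 \<and> t2 \<le> 1" if "t1\<^sup>2 + t2\<^sup>2 = 1"
    using that zero_le_power2[of t1] zero_le_power2[of t2]
    by (metis add_le_cancel_left add_le_cancel_right add.right_neutral add_0 power2_le_imp_le one_power2 zero_le_one)
  ultimately show ?thesis
    unfolding same_sign_system_def g_def[symmetric] quartic_level_eq_iff using inv by force
qed

text \<open>
  Here \<open>t1 > t2\<close> excludes the case \<open>t1\<^sup>2 = t2\<^sup>2\<close>.
\<close>

lemma changing_sign_system_iff:
  assumes "\<gamma> > 0" "\<omega> > 0"
  shows "changing_sign_system \<gamma> \<omega> t1 t2 \<longleftrightarrow>
    0 < t2 \<and> t2 < t1 \<and> t1\<^sup>2 + t2\<^sup>2 = 1 \<and> t1 + t2 = \<gamma> * sqrt \<omega> * (t1 * t2)"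
proof -
  define g where "g = \<gamma> * sqrt \<omega>"
  have inv: "inverse t1 + inverse t2 = g \<longleftrightarrow> t1 + t2 = g * (t1 * t2)" if "t1 > 0" "t2 > 0"
    using that by (auto simp: field_simps)
  have "t1\<^sup>2 \<noteq> t2\<^sup>2" if "t1 > t2" "t2 > 0"
    using that by (auto simp: power2_eq_iff)
  moreover have "t1 \<le> 1 \<and> t2 \<le> 1" if "t1\<^sup>2 + t2\<^sup>2 = 1"
    using that zero_le_power2[of t1] zero_le_power2[of t2]
    by (metis add_le_cancel_left add_le_cancel_right add.right_neutral add_0 power2_le_imp_le one_power2 zero_le_one)
  ultimately show ?thesis
    unfolding changing_sign_system_def g_def[symmetric] quartic_level_eq_iff using inv by force
qed

lemma system_bounds:
  fixes t1 t2 :: real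
  assumes "t1\<^sup>2 + t2\<^sup>2 = 1" "t1 > 0" "t2 > 0"
  shows "\<bar>t1\<bar> < 1" "\<bar>t2\<bar> < 1"
proof -
  have "t1\<^sup>2 > 0" "t2\<^sup>2 > 0" using assms by auto
  then have "t1\<^sup>2 < 1" "t2\<^sup>2 < 1" using assms by linarith+
  then show "\<bar>t1\<bar> < 1" "\<bar>t2\<bar> < 1" by (simp_all add: abs_square_less_1)
qed

text \<open>
  With \<open>g = \<gamma> \<surd>\<omega>\<close> and \<open>p = t1 t2\<close>, squaring \<open>t2 - t1 = g p\<close> gives \<open>g\<^sup>2 p\<^sup>2 = 1 - 2 p\<close>, whose only positive
  root is \<open>1 / (1 + sqrt (1 + g\<^sup>2))\<close>; the sum of \<open>t1\<close> and \<open>t2\<close> is \<open>sqrt (1 + 2 p)\<close>.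
\<close>

lemma ex1_same_sign_system:
  assumes pos: "\<gamma> > 0" "\<omega> > 0"
  shows "\<exists>!(t1, t2). same_sign_system \<gamma> \<omega> t1 t2"
proof -
  define g where "g = \<gamma> * sqrt \<omega>"
  have g: "g > 0" using pos by (simp add: g_def)
  define p where "p = 1 / (1 + sqrt (1 + g\<^sup>2))"
  have p: "p > 0" using g by (simp add: p_def add_pos_nonneg)
  have "(1 / p - 1)\<^sup>2 = 1 + g\<^sup>2"
    by (simp add: p_def)
  then have p2: "g\<^sup>2 * p\<^sup>2 = 1 - 2 * p"
    using p by (simp add: field_simps power2_eq_square)
  define s d where "s = sqrt (1 + 2 * p)" and "d = g * p"
  have s2: "s\<^sup>2 = 1 + 2 * p" and d2: "d\<^sup>2 = 1 - 2 * p"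
    using p p2 by (auto simp: s_def d_def power_mult_distrib)
  have d: "d > 0" using g p by (simp add: d_def)
  have sd: "s > d"
    by (rule power2_less_imp_less) (use s2 d2 p in \<open>auto simp: s_def\<close>)
  have prod: "(s - d) / 2 * ((s + d) / 2) = p"
  proof -
    have "(s - d) / 2 * ((s + d) / 2) = (s\<^sup>2 - d\<^sup>2) / 4" by (simp add: field_simps power2_eq_square)
    then show ?thesis by (simp add: s2 d2)
  qed
  have sum: "((s - d) / 2)\<^sup>2 + ((s + d) / 2)\<^sup>2 = 1"
  proof -
    have "((s - d) / 2)\<^sup>2 + ((s + d) / 2)\<^sup>2 = (s\<^sup>2 + d\<^sup>2) / 2" by (simp add: field_simps power2_eq_square)
    then show ?thesis by (simp add: s2 d2)
  qed
  have ex: "same_sign_system \<gamma> \<omega> ((s - d) / 2) ((s + d) / 2)"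
    unfolding same_sign_system_iff[OF pos] g_def[symmetric] prod
    using sd d sum by (auto simp: d_def field_simps)
  have unique: "t1 = (s - d) / 2 \<and> t2 = (s + d) / 2" if "same_sign_system \<gamma> \<omega> t1 t2" for t1 t2
  proof -
    from that have t: "0 < t1" "0 < t2" "t1\<^sup>2 + t2\<^sup>2 = 1" "t2 - t1 = g * (t1 * t2)"
      by (simp_all add: same_sign_system_iff[OF pos] g_def)
    define q where "q = t1 * t2"
    have q: "q > 0" using t by (simp add: q_def)
    have "(g * q)\<^sup>2 = 1 - 2 * q"
      using t(3) unfolding q_def t(4)[symmetric] by (simp add: power2_diff algebra_simps)
    then have "g\<^sup>2 * q\<^sup>2 = 1 - 2 * q" by (simp add: power_mult_distrib)
    with p2 have "(g\<^sup>2 * (p + q) + 2) * (p - q) = 0"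
      by (simp add: algebra_simps power2_eq_square)
    moreover have "g\<^sup>2 * (p + q) + 2 > 0" using p q by (intro add_nonneg_pos) auto
    ultimately have "p = q" by auto
    have "t2 - t1 = d" using t(4) \<open>p = q\<close> by (simp add: d_def q_def)
    moreover have "(t1 + t2)\<^sup>2 = s\<^sup>2"
      using t(3) \<open>p = q\<close> by (simp add: s2 q_def power2_sum)
    then have "t1 + t2 = s"
      by (rule power2_eq_imp_eq) (use t p in \<open>auto simp: s_def\<close>)
    ultimately show ?thesis by auto
  qed
  show ?thesis
    by (rule ex1I[of _ "((s - d) / 2, (s + d) / 2)"]) (use ex unique in auto)
qed

lemma threshold_iff:
  assumes "\<gamma> > 0" "\<omega> > 0" "k > 0"
  shows "\<omega> > k / \<gamma>^2 \<longleftrightarrow> (\<gamma> * sqrt \<omega>)\<^sup>2 > k"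
  using assms by (simp add: power_mult_distrib pos_divide_less_eq mult.commute)

text \<open>
  Distinct \<open>t1\<close>, \<open>t2\<close> on the unit circle have product \<open>q < 1/2\<close>, and \<open>g\<^sup>2 = 1/q\<^sup>2 + 2/q > 8\<close>. So the
  threshold is forced by solvability of the system.
\<close>

lemma changing_sign_system_threshold:
  assumes pos: "\<gamma> > 0" "\<omega> > 0" and sys: "changing_sign_system \<gamma> \<omega> t1 t2"
  shows "\<omega> > 8 / \<gamma>^2"
proof -
  define g where "g = \<gamma> * sqrt \<omega>"
  define q where "q = t1 * t2"
  from sys have t: "0 < t2" "t2 < t1" "t1\<^sup>2 + t2\<^sup>2 = 1" "t1 + t2 = g * q"
    by (simp_all add: changing_sign_system_iff[OF pos] g_def q_def)
  have q: "q > 0" using t by (simp add: q_def)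
  have "(t1 - t2)\<^sup>2 > 0" using t by simp
  then have "q < 1 / 2" using t(3) by (simp add: power2_diff q_def)
  have "g\<^sup>2 * q\<^sup>2 = 1 + 2 * q"
    using t(3) unfolding power_mult_distrib[symmetric] t(4)[symmetric] by (simp add: power2_sum q_def)
  also have "\<dots> > 8 * q\<^sup>2"
  proof -
    have "0 < (1 - 2 * q) * (1 + 4 * q)" using \<open>q < 1 / 2\<close> q by (intro mult_pos_pos) auto
    then show ?thesis by (simp add: algebra_simps power2_eq_square)
  qed
  finally have "g\<^sup>2 > 8" using q by simp
  then show ?thesis by (simp add: threshold_iff[OF pos] g_def)
qed

text \<open>
  Now the product satisfies \<open>g\<^sup>2 p\<^sup>2 = 1 + 2 p\<close>, whose positive root is \<open>1 / (sqrt (1 + g\<^sup>2) - 1)\<close>. The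
  difference \<open>sqrt (1 - 2 p)\<close> is real and positive exactly when \<open>g\<^sup>2 > 8\<close>.
\<close>

lemma ex1_changing_sign_system:
  assumes pos: "\<gamma> > 0" "\<omega> > 0" and large: "\<omega> > 8 / \<gamma>^2"
  shows "\<exists>!(t1, t2). changing_sign_system \<gamma> \<omega> t1 t2"
proof -
  define g where "g = \<gamma> * sqrt \<omega>"
  have g: "g > 0" using pos by (simp add: g_def)
  have "g\<^sup>2 > 8" using large by (simp add: threshold_iff[OF pos] g_def)
  then have root: "sqrt (1 + g\<^sup>2) > 3" by (intro real_less_rsqrt) simp
  define p where "p = 1 / (sqrt (1 + g\<^sup>2) - 1)"
  have p: "p > 0" "p < 1 / 2" using root by (auto simp: p_def divide_less_eq)
  have "(1 / p + 1)\<^sup>2 = 1 + g\<^sup>2"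
    by (simp add: p_def)
  then have p2: "g\<^sup>2 * p\<^sup>2 = 1 + 2 * p"
    using p by (simp add: field_simps power2_eq_square)
  define s d where "s = g * p" and "d = sqrt (1 - 2 * p)"
  have s2: "s\<^sup>2 = 1 + 2 * p" and d2: "d\<^sup>2 = 1 - 2 * p"
    using p p2 by (auto simp: s_def d_def power_mult_distrib)
  have d: "d > 0" using p by (simp add: d_def)
  have sd: "s > d"
    by (rule power2_less_imp_less) (use s2 d2 p g in \<open>auto simp: s_def\<close>)
  have prod: "(s + d) / 2 * ((s - d) / 2) = p"
  proof -
    have "(s + d) / 2 * ((s - d) / 2) = (s\<^sup>2 - d\<^sup>2) / 4" by (simp add: field_simps power2_eq_square)
    then show ?thesis by (simp add: s2 d2)
  qed
  have sum: "((s + d) / 2)\<^sup>2 + ((s - d) / 2)\<^sup>2 = 1"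
  proof -
    have "((s + d) / 2)\<^sup>2 + ((s - d) / 2)\<^sup>2 = (s\<^sup>2 + d\<^sup>2) / 2" by (simp add: field_simps power2_eq_square)
    then show ?thesis by (simp add: s2 d2)
  qed
  have ex: "changing_sign_system \<gamma> \<omega> ((s + d) / 2) ((s - d) / 2)"
    unfolding changing_sign_system_iff[OF pos] g_def[symmetric] prod
    using sd d sum by (auto simp: s_def field_simps)
  have unique: "t1 = (s + d) / 2 \<and> t2 = (s - d) / 2" if "changing_sign_system \<gamma> \<omega> t1 t2" for t1 t2
  proof -
    from that have t: "0 < t2" "t2 < t1" "t1\<^sup>2 + t2\<^sup>2 = 1" "t1 + t2 = g * (t1 * t2)"
      by (simp_all add: changing_sign_system_iff[OF pos] g_def)
    define q where "q = t1 * t2"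
    have q: "q > 0" using t by (simp add: q_def)
    have "(g * q)\<^sup>2 = 1 + 2 * q"
      using t(3) unfolding q_def t(4)[symmetric] by (simp add: power2_sum)
    then have q2: "g\<^sup>2 * q\<^sup>2 = 1 + 2 * q" by (simp add: power_mult_distrib)
    with p2 have "(g\<^sup>2 * (p + q) - 2) * (p - q) = 0"
      by (simp add: algebra_simps power2_eq_square)
    moreover have "g\<^sup>2 * (p + q) - 2 > 0"
    proof -
      have "g\<^sup>2 * q > 2"
      proof -
        have "g\<^sup>2 * q * q > 2 * q" using q2 by (simp add: power2_eq_square mult_ac)
        then show ?thesis using q by (simp add: mult_less_cancel_right)
      qed
      moreover have "g\<^sup>2 * p \<ge> 0" using p by simp
      ultimately show ?thesis by (simp add: distrib_left)
    qed
    ultimately have "p = q" by auto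
    have "t1 + t2 = s" using t(4) \<open>p = q\<close> by (simp add: s_def q_def)
    moreover have "(t1 - t2)\<^sup>2 = d\<^sup>2"
      using t(3) \<open>p = q\<close> by (simp add: d2 q_def power2_diff)
    then have "t1 - t2 = d"
      by (rule power2_eq_imp_eq) (use t d in auto)
    ultimately show ?thesis by auto
  qed
  show ?thesis
    by (rule ex1I[of _ "((s + d) / 2, (s - d) / 2)"]) (use ex unique in auto)
qed

text \<open>
  Once \<open>T1 S1 = T2 S2\<close> is a nonzero number, dividing the jump condition by it gives
  \<open>1/T2 - 1/T1 = - g\<close>; squaring it loses only a sign, which the sign of \<open>T1 T2\<close> restores.
\<close>

lemma matching_same_sign:
  fixes T1 T2 S1 S2 g :: real
  assumes S: "S1 > 0" "S2 > 0" "S1\<^sup>2 = 1 - T1\<^sup>2" "S2\<^sup>2 = 1 - T2\<^sup>2"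
  shows "T1 * S1 = T2 * S2 \<and> S2 - S1 = - (g * (T2 * S2)) \<longleftrightarrow>
    T1 = 0 \<and> T2 = 0 \<or> T1 * T2 > 0 \<and> T1^2 - T1^4 = T2^2 - T2^4 \<and> inverse T1 - inverse T2 = g"
    (is "?L \<longleftrightarrow> ?R")
proof -
  have sq: "(T1 * S1)\<^sup>2 = (T2 * S2)\<^sup>2 \<longleftrightarrow> T1^2 - T1^4 = T2^2 - T2^4"
    by (simp add: power_mult_distrib S algebra_simps flip: power_add)
  show ?thesis
  proof
    assume L: ?L
    show ?R
    proof (cases "T1 = 0")
      case True
      then show ?thesis using L S by auto
    next
      case False
      then have T2: "T2 \<noteq> 0" using L S by auto
      have "T1 * T2 * (S1 * S2) = (T2 * S2)\<^sup>2"
        using L by (simp add: power2_eq_square mult_ac)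
      also have "\<dots> > 0" using T2 S by simp
      finally have "T1 * T2 > 0"
        by (rule zero_less_mult_pos2[OF _ mult_pos_pos[OF S(1,2)]])
      moreover have "T1^2 - T1^4 = T2^2 - T2^4" using L sq by simp
      moreover have "inverse T1 - inverse T2 = g"
      proof -
        have "S1 = T2 * S2 * inverse T1" "S2 = T2 * S2 * inverse T2"
          using L False T2 by (auto simp: field_simps)
        then have "T2 * S2 * (inverse T2 - inverse T1) = S2 - S1" by (simp add: algebra_simps)
        then have "T2 * S2 * (inverse T2 - inverse T1) = T2 * S2 * (- g)" using L by (simp add: mult_ac)
        then have "inverse T2 - inverse T1 = - g"
          unfolding mult_cancel_left using T2 S by auto
        then show ?thesis by simp
      qed
      ultimately show ?thesis by blast
    qed
  next
    assume R: ?R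
    show ?L
    proof (cases "T1 = 0 \<and> T2 = 0")
      case True
      then have "S1 = S2" using S by (metis power2_eq_iff_nonneg less_imp_le)
      with True show ?thesis by simp
    next
      case False
      with R have T: "T1 * T2 > 0" "T1^2 - T1^4 = T2^2 - T2^4" "inverse T1 - inverse T2 = g" by auto
      then have T0: "T1 \<noteq> 0" "T2 \<noteq> 0" by auto
      have "T1 * S1 = T2 * S2 \<or> T1 * S1 = - (T2 * S2)"
        using sq T(2) by (simp add: power2_eq_iff)
      moreover have "(T1 * S1) * (T2 * S2) > 0"
        using mult_pos_pos[OF T(1) mult_pos_pos[OF S(1,2)]] by (simp add: mult_ac)
      moreover have False if "T1 * S1 = - (T2 * S2)" "(T1 * S1) * (T2 * S2) > 0"
        using that(2) unfolding that(1) mult_minus_left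
        using zero_le_square[of "T2 * S2"] by linarith
      ultimately have eq: "T1 * S1 = T2 * S2" by blast
      have "S2 = T2 * S2 * inverse T2" "S1 = T2 * S2 * inverse T1"
        using eq T0 by (auto simp: field_simps)
      then have "S2 - S1 = T2 * S2 * (inverse T2 - inverse T1)" by (simp add: algebra_simps)
      also have "\<dots> = - (g * (T2 * S2))" using T(3) by (simp add: algebra_simps)
      finally show ?thesis using eq by simp
    qed
  qed
qed

text \<open>
  The jump condition now has a positive left side, which fixes the signs of \<open>T1\<close> and \<open>T2\<close> and
  excludes the degenerate case.
\<close>

lemma matching_changing_sign:
  fixes T1 T2 S1 S2 g :: real
  assumes S: "S1 > 0" "S2 > 0" "S1\<^sup>2 = 1 - T1\<^sup>2" "S2\<^sup>2 = 1 - T2\<^sup>2" and g: "g > 0"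
  shows "T1 * S1 = - (T2 * S2) \<and> S2 + S1 = - (g * (T2 * S2)) \<longleftrightarrow>
    T1 > 0 \<and> T2 < 0 \<and> T1^2 - T1^4 = T2^2 - T2^4 \<and> inverse T1 - inverse T2 = g"
    (is "?L \<longleftrightarrow> ?R")
proof -
  have sq: "(T1 * S1)\<^sup>2 = (T2 * S2)\<^sup>2 \<longleftrightarrow> T1^2 - T1^4 = T2^2 - T2^4"
    by (simp add: power_mult_distrib S algebra_simps flip: power_add)
  show ?thesis
  proof
    assume L: ?L
    have "g * (T1 * S1) = S1 + S2" using L by simp
    then have "g * (T1 * S1) > 0" using S by simp
    then have "T1 * S1 > 0" by (rule zero_less_mult_pos[OF _ g])
    then have T: "T1 > 0" "T2 < 0"
      using S L zero_less_mult_pos2[OF _ S(1), of T1] by (auto simp: mult_less_0_iff)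
    have "(T1 * S1)\<^sup>2 = (T2 * S2)\<^sup>2" using L by simp
    then have "T1^2 - T1^4 = T2^2 - T2^4" using sq by blast
    moreover have "inverse T1 - inverse T2 = g"
    proof -
      have "S1 = T1 * S1 * inverse T1" "S2 = - (T1 * S1 * inverse T2)"
        using L T by (auto simp: field_simps)
      then have "T1 * S1 * (inverse T1 - inverse T2) = S1 + S2" by (simp add: algebra_simps)
      then have "T1 * S1 * (inverse T1 - inverse T2) = T1 * S1 * g"
        using \<open>g * (T1 * S1) = S1 + S2\<close> by (metis mult.commute)
      then show ?thesis using T S by auto
    qed
    ultimately show ?R using T by blast
  next
    assume R: ?R
    have "T1 * S1 = T2 * S2 \<or> T1 * S1 = - (T2 * S2)"
      using sq R by (simp add: power2_eq_iff)
    moreover have "T1 * S1 > 0" "T2 * S2 < 0" using R S by (auto simp: mult_less_0_iff)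
    ultimately have eq: "T1 * S1 = - (T2 * S2)" by auto
    have "T1 \<noteq> 0" "T2 \<noteq> 0" using R by auto
    then have "S2 = T2 * S2 * inverse T2" "S1 = - (T2 * S2 * inverse T1)"
      using eq by (auto simp: field_simps)
    then have "S2 + S1 = - (T2 * S2 * (inverse T1 - inverse T2))" by (simp add: algebra_simps)
    also have "\<dots> = - (g * (T2 * S2))" using R by (metis mult.commute)
    finally show ?L using eq by simp
  qed
qed

text \<open>
  The boundary conditions of the delta prime interaction for the soliton \<open>c1, y1\<close> on the left and
  \<open>c2, y2\<close> on the right.
\<close>

definition delta_prime_matching ::
  "real \<Rightarrow> real \<Rightarrow> real \<Rightarrow> complex \<Rightarrow> real \<Rightarrow> complex \<Rightarrow> real \<Rightarrow> bool" where
  "delta_prime_matching lam \<gamma> \<omega> c1 y1 c2 y2 \<longleftrightarrow>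
     c2 * soliton_deriv lam \<omega> y2 0 = c1 * soliton_deriv lam \<omega> y1 0 \<and>
     c2 * soliton lam \<omega> y2 0 - c1 * soliton lam \<omega> y1 0
       = - of_real \<gamma> * (c2 * soliton_deriv lam \<omega> y2 0)"

text \<open>
  If the slopes at the origin are nonzero, their equality forces \<open>c1 / c2\<close> to be real, hence \<open>\<plusminus>1\<close>; when both
  slopes vanish the jump condition gives \<open>c1 = c2\<close>. In the same sign case both \<open>T\<close> have the same
  sign and the two choices of sign are the two members of the pair. In the changing sign case the
  two orders of the pair \<open>(T1, - T2)\<close> are the two asymmetric profiles and equality is the
  antisymmetric one.
\<close>

lemma delta_prime_matching_iff:
  assumes pos: "lam > 0" "\<gamma> > 0" "\<omega> > 0" and c: "cmod c1 = 1" "cmod c2 = 1"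
  shows "delta_prime_matching lam \<gamma> \<omega> c1 y1 c2 y2 \<longleftrightarrow>
    c1 = c2 \<and> y1 = 0 \<and> y2 = 0 \<or>
    c1 = c2 \<and> (\<exists>t1 t2. same_sign_system \<gamma> \<omega> t1 t2 \<and>
      (y1 = shift \<omega> t1 \<and> y2 = shift \<omega> t2 \<or> y1 = - shift \<omega> t2 \<and> y2 = - shift \<omega> t1)) \<or>
    c1 = - c2 \<and> \<omega> > 4 / \<gamma>^2 \<and> y1 = antisym_shift \<gamma> \<omega> \<and> y2 = - antisym_shift \<gamma> \<omega> \<or>
    c1 = - c2 \<and> \<omega> > 8 / \<gamma>^2 \<and> (\<exists>t1 t2. changing_sign_system \<gamma> \<omega> t1 t2 \<and>
      (y1 = shift \<omega> t1 \<and> y2 = - shift \<omega> t2 \<or> y1 = shift \<omega> t2 \<and> y2 = - shift \<omega> t1))"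
proof -
  define g where "g = \<gamma> * sqrt \<omega>"
  have g: "g > 0" using pos by (simp add: g_def)
  define T1 T2 S1 S2 where "T1 = tanh (sqrt \<omega> * y1)" and "T2 = tanh (sqrt \<omega> * y2)"
    and "S1 = sech (sqrt \<omega> * y1)" and "S2 = sech (sqrt \<omega> * y2)"
  have S: "S1 > 0" "S2 > 0" "S1\<^sup>2 = 1 - T1\<^sup>2" "S2\<^sup>2 = 1 - T2\<^sup>2"
    by (simp_all add: S1_def S2_def T1_def T2_def sech_pos sech_square)
  have T: "\<bar>T1\<bar> < 1" "\<bar>T2\<bar> < 1"
    using tanh_real_bounds by (auto simp: T1_def T2_def abs_less_iff)
  have y0: "y1 = 0 \<longleftrightarrow> T1 = 0" "y2 = 0 \<longleftrightarrow> T2 = 0"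
    using pos by (auto simp: T1_def T2_def)
  define A where "A = complex_of_real (sqrt (2 * \<omega> / lam))"
  have A: "A \<noteq> 0" using pos by (simp add: A_def)
  have sol: "soliton lam \<omega> y1 0 = A * of_real S1" "soliton lam \<omega> y2 0 = A * of_real S2"
    by (simp_all add: soliton_def A_def S1_def S2_def sech_def)
  have der: "soliton_deriv lam \<omega> y1 0 = A * of_real (sqrt \<omega> * (T1 * S1))"
    "soliton_deriv lam \<omega> y2 0 = A * of_real (sqrt \<omega> * (T2 * S2))"
    by (simp_all add: soliton_deriv_def sol T1_def T2_def mult_ac)
  have "delta_prime_matching lam \<gamma> \<omega> c1 y1 c2 y2 \<longleftrightarrow>
    (A * of_real (sqrt \<omega>)) * (c2 * of_real (T2 * S2)) = (A * of_real (sqrt \<omega>)) * (c1 * of_real (T1 * S1)) \<and>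
    A * (c2 * of_real S2 - c1 * of_real S1) = A * (- (c2 * of_real (g * (T2 * S2))))"
    by (simp add: delta_prime_matching_def sol der g_def algebra_simps)
  also have "\<dots> \<longleftrightarrow> c2 * of_real (T2 * S2) = c1 * of_real (T1 * S1) \<and>
      c2 * of_real S2 - c1 * of_real S1 = - (c2 * of_real (g * (T2 * S2)))"
    unfolding mult_cancel_left using A pos by auto
  finally have match: "delta_prime_matching lam \<gamma> \<omega> c1 y1 c2 y2 \<longleftrightarrow>
      c2 * of_real (T2 * S2) = c1 * of_real (T1 * S1) \<and>
      c2 * of_real S2 - c1 * of_real S1 = - (c2 * of_real (g * (T2 * S2)))" .
  have c0: "c1 \<noteq> 0" "c2 \<noteq> 0" using c by auto
  have same: "delta_prime_matching lam \<gamma> \<omega> c1 y1 c2 y2 \<longleftrightarrow>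
      T1 * S1 = T2 * S2 \<and> S2 - S1 = - (g * (T2 * S2))" if "c1 = c2"
  proof -
    have "delta_prime_matching lam \<gamma> \<omega> c1 y1 c2 y2 \<longleftrightarrow>
      c2 * of_real (T2 * S2) = c2 * of_real (T1 * S1) \<and>
      c2 * of_real (S2 - S1) = c2 * of_real (- (g * (T2 * S2)))"
      using match unfolding that by (simp add: algebra_simps)
    also have "\<dots> \<longleftrightarrow> T1 * S1 = T2 * S2 \<and> S2 - S1 = - (g * (T2 * S2))"
      using c0 unfolding mult_cancel_left of_real_eq_iff by auto
    finally show ?thesis .
  qed
  have opposite: "delta_prime_matching lam \<gamma> \<omega> c1 y1 c2 y2 \<longleftrightarrow>
      T1 * S1 = - (T2 * S2) \<and> S2 + S1 = - (g * (T2 * S2))" if "c1 = - c2"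
  proof -
    have "delta_prime_matching lam \<gamma> \<omega> c1 y1 c2 y2 \<longleftrightarrow>
      c2 * of_real (T2 * S2) = c2 * of_real (- (T1 * S1)) \<and>
      c2 * of_real (S2 + S1) = c2 * of_real (- (g * (T2 * S2)))"
      using match unfolding that by (simp add: algebra_simps)
    also have "\<dots> \<longleftrightarrow> T1 * S1 = - (T2 * S2) \<and> S2 + S1 = - (g * (T2 * S2))"
      using c0 unfolding mult_cancel_left of_real_eq_iff by auto
    finally show ?thesis .
  qed
  have phases: "c1 = c2 \<or> c1 = - c2" if "delta_prime_matching lam \<gamma> \<omega> c1 y1 c2 y2"
  proof (cases "T1 = 0")
    case True
    then have "T2 = 0" using that c0 S by (auto simp: match)
    then have "S1 = S2" using S True by (metis power2_eq_iff_nonneg less_imp_le)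
    then show ?thesis using that True \<open>T2 = 0\<close> S by (auto simp: match)
  next
    case False
    define k where "k = T2 * S2 / (T1 * S1)"
    have "c1 = c2 * of_real k"
      using that False S by (auto simp: match k_def field_simps)
    then have "\<bar>k\<bar> = 1" using c by (simp add: norm_mult)
    then have "k = 1 \<or> k = - 1" by auto
    then show ?thesis using \<open>c1 = c2 * of_real k\<close> by auto
  qed
  have real_same: "(T1 * T2 > 0 \<and> T1^2 - T1^4 = T2^2 - T2^4 \<and> inverse T1 - inverse T2 = g) \<longleftrightarrow>
    (\<exists>t1 t2. same_sign_system \<gamma> \<omega> t1 t2 \<and>
      (y1 = shift \<omega> t1 \<and> y2 = shift \<omega> t2 \<or> y1 = - shift \<omega> t2 \<and> y2 = - shift \<omega> t1))"
    (is "?P \<longleftrightarrow> ?Q")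
  proof -
    have "?Q \<longleftrightarrow> (\<exists>t1 t2. same_sign_system \<gamma> \<omega> t1 t2 \<and>
      (T1 = t1 \<and> T2 = t2 \<or> T1 = - t2 \<and> T2 = - t1))"
    proof (intro ex_cong1 conj_cong refl)
      fix t1 t2 assume "same_sign_system \<gamma> \<omega> t1 t2"
      then have t: "\<bar>t1\<bar> < 1" "\<bar>t2\<bar> < 1"
        using system_bounds pos by (auto simp: same_sign_system_iff)
      show "(y1 = shift \<omega> t1 \<and> y2 = shift \<omega> t2 \<or> y1 = - shift \<omega> t2 \<and> y2 = - shift \<omega> t1) \<longleftrightarrow>
        (T1 = t1 \<and> T2 = t2 \<or> T1 = - t2 \<and> T2 = - t1)"
        unfolding eq_shift_iff[OF pos(3) t(1)] eq_shift_iff[OF pos(3) t(2)] T1_def T2_def by simp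
    qed
    also have "\<dots> \<longleftrightarrow> same_sign_system \<gamma> \<omega> T1 T2 \<or> same_sign_system \<gamma> \<omega> (- T2) (- T1)"
      by (metis minus_minus)
    also have "\<dots> \<longleftrightarrow> ?P"
      using T unfolding same_sign_system_def g_def[symmetric]
      by (auto simp: zero_less_mult_iff)
    finally show ?thesis by simp
  qed
  have real_opposite: "(T1 > 0 \<and> T2 < 0 \<and> T1^2 - T1^4 = T2^2 - T2^4 \<and> inverse T1 - inverse T2 = g) \<longleftrightarrow>
    \<omega> > 4 / \<gamma>^2 \<and> y1 = antisym_shift \<gamma> \<omega> \<and> y2 = - antisym_shift \<gamma> \<omega> \<or>
    \<omega> > 8 / \<gamma>^2 \<and> (\<exists>t1 t2. changing_sign_system \<gamma> \<omega> t1 t2 \<and>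
      (y1 = shift \<omega> t1 \<and> y2 = - shift \<omega> t2 \<or> y1 = shift \<omega> t2 \<and> y2 = - shift \<omega> t1))"
    (is "?P \<longleftrightarrow> ?A \<or> ?B")
  proof -
    have "?B \<longleftrightarrow> (\<exists>t1 t2. changing_sign_system \<gamma> \<omega> t1 t2 \<and>
      (y1 = shift \<omega> t1 \<and> y2 = - shift \<omega> t2 \<or> y1 = shift \<omega> t2 \<and> y2 = - shift \<omega> t1))"
      using changing_sign_system_threshold[OF pos(2,3)] by blast
    also have "\<dots> \<longleftrightarrow> (\<exists>t1 t2. changing_sign_system \<gamma> \<omega> t1 t2 \<and>
      (T1 = t1 \<and> T2 = - t2 \<or> T1 = t2 \<and> T2 = - t1))"
    proof (intro ex_cong1 conj_cong refl)
      fix t1 t2 assume "changing_sign_system \<gamma> \<omega> t1 t2"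
      then have t: "\<bar>t1\<bar> < 1" "\<bar>t2\<bar> < 1"
        using system_bounds[of t1 t2] pos by (auto simp: changing_sign_system_iff)
      show "(y1 = shift \<omega> t1 \<and> y2 = - shift \<omega> t2 \<or> y1 = shift \<omega> t2 \<and> y2 = - shift \<omega> t1) \<longleftrightarrow>
        (T1 = t1 \<and> T2 = - t2 \<or> T1 = t2 \<and> T2 = - t1)"
        unfolding eq_shift_iff[OF pos(3) t(1)] eq_shift_iff[OF pos(3) t(2)] T1_def T2_def by simp
    qed
    also have "\<dots> \<longleftrightarrow> changing_sign_system \<gamma> \<omega> T1 (- T2) \<or> changing_sign_system \<gamma> \<omega> (- T2) T1"
      by (metis minus_minus)
    finally have B: "?B \<longleftrightarrow> changing_sign_system \<gamma> \<omega> T1 (- T2) \<or> changing_sign_system \<gamma> \<omega> (- T2) T1" .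
    have A: "?A \<longleftrightarrow> T1 > 0 \<and> T2 = - T1 \<and> inverse T1 - inverse T2 = g"
    proof -
      have g2: "\<omega> > 4 / \<gamma>^2 \<longleftrightarrow> g > 2"
        unfolding threshold_iff[OF pos(2,3) zero_less_numeral] g_def[symmetric]
        using g power2_less_imp_less[of 2 g] power_strict_mono[of 2 g 2] by auto
      have "?A \<longleftrightarrow> g > 2 \<and> T1 = 2 / g \<and> T2 = - (2 / g)"
      proof (cases "g > 2")
        case True
        then have "\<bar>2 / g\<bar> < 1" by simp
        then show ?thesis
          using True unfolding g2 T1_def T2_def antisym_shift_eq_shift[OF True[unfolded g_def]]
          unfolding g_def[symmetric] by (simp only: eq_shift_iff[OF pos(3)])
      qed (simp add: g2)
      also have "\<dots> \<longleftrightarrow> T1 > 0 \<and> T2 = - T1 \<and> inverse T1 - inverse T2 = g"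
      proof
        assume "g > 2 \<and> T1 = 2 / g \<and> T2 = - (2 / g)"
        then show "T1 > 0 \<and> T2 = - T1 \<and> inverse T1 - inverse T2 = g" by simp
      next
        assume R: "T1 > 0 \<and> T2 = - T1 \<and> inverse T1 - inverse T2 = g"
        then have "g = 2 / T1" by (auto simp: divide_inverse)
        with R T show "g > 2 \<and> T1 = 2 / g \<and> T2 = - (2 / g)"
          by (simp add: pos_less_divide_eq)
      qed
      finally show ?thesis .
    qed
    show ?thesis
      unfolding A B using T unfolding changing_sign_system_def g_def[symmetric]
      by (auto simp: linorder_neq_iff)
  qed
  have "delta_prime_matching lam \<gamma> \<omega> c1 y1 c2 y2 \<longleftrightarrow>
    c1 = c2 \<and> delta_prime_matching lam \<gamma> \<omega> c1 y1 c2 y2 \<or>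
    c1 = - c2 \<and> delta_prime_matching lam \<gamma> \<omega> c1 y1 c2 y2"
    using phases by blast
  also have "\<dots> \<longleftrightarrow> c1 = c2 \<and> (T1 = 0 \<and> T2 = 0 \<or>
      T1 * T2 > 0 \<and> T1^2 - T1^4 = T2^2 - T2^4 \<and> inverse T1 - inverse T2 = g) \<or>
    c1 = - c2 \<and> (T1 > 0 \<and> T2 < 0 \<and> T1^2 - T1^4 = T2^2 - T2^4 \<and> inverse T1 - inverse T2 = g)"
    using same opposite matching_same_sign[OF S, of g] matching_changing_sign[OF S g] by blast
  finally show ?thesis
    unfolding real_same real_opposite y0 by blast
qed

section \<open>Stationary profiles as pairs of matched solitons\<close>

definition two_sided :: "real \<Rightarrow> real \<Rightarrow> complex \<Rightarrow> real \<Rightarrow> complex \<Rightarrow> real \<Rightarrow> real \<Rightarrow> complex" where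
  "two_sided lam \<omega> c1 y1 c2 y2 x =
     (if x < 0 then c1 * soliton lam \<omega> y1 x else c2 * soliton lam \<omega> y2 x)"

definition two_sided_deriv :: "real \<Rightarrow> real \<Rightarrow> complex \<Rightarrow> real \<Rightarrow> complex \<Rightarrow> real \<Rightarrow> real \<Rightarrow> complex" where
  "two_sided_deriv lam \<omega> c1 y1 c2 y2 x =
     (if x < 0 then c1 * soliton_deriv lam \<omega> y1 x else c2 * soliton_deriv lam \<omega> y2 x)"

lemma AE_lebesgue_neq: "AE x in lebesgue. x \<noteq> (a::real)"
  by (rule AE_completion[OF AE_lborel_singleton])

lemma AE_off_origin:
  assumes "AE x in lebesgue. x \<in> punctured_line \<longrightarrow> P x"
  shows "AE x in lebesgue. P (x::real)"
  using assms AE_lebesgue_neq[of 0] by eventually_elim auto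

lemma emeasure_half_line:
  "emeasure lebesgue {0::real<..} = \<infinity>" "emeasure lebesgue {..<0::real} = \<infinity>"
proof -
  have inf: "emeasure lebesgue I = \<infinity>"
    if sub: "\<And>r. r \<ge> 0 \<Longrightarrow> \<exists>a. {a<..<a + r + 1} \<subseteq> I" and I: "I \<in> sets borel" for I :: "real set"
  proof (cases "emeasure lebesgue I")
    case (real r)
    obtain a where a: "{a<..<a + r + 1} \<subseteq> I" using sub[OF real(1)] by blast
    have "ennreal (r + 1) = emeasure lebesgue {a<..<a + r + 1}"
      using real(1) by simp
    also have "\<dots> \<le> ennreal r"
      unfolding real(2)[symmetric] by (rule emeasure_mono[OF a]) (use I in simp)
    finally show ?thesis using real(1) by (simp add: ennreal_le_iff)
  qed simp
  show "emeasure lebesgue {0::real<..} = \<infinity>"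
    by (rule inf) (auto intro!: exI[of _ 0])
  have "\<exists>a. {a<..<a + r + 1} \<subseteq> {..<0}" for r :: real
    by (rule exI[of _ "- r - 1"]) auto
  then show "emeasure lebesgue {..<0::real} = \<infinity>"
    by (rule inf) simp
qed

text \<open>
  Otherwise a constant would be integrable over a set of infinite measure.
\<close>

lemma integrable_takes_small_values:
  fixes F :: "real \<Rightarrow> real"
  assumes I: "I \<in> sets lebesgue" "emeasure lebesgue I = \<infinity>"
    and F: "set_integrable lebesgue I F" and "\<epsilon> > 0"
  shows "\<exists>x\<in>I. F x < \<epsilon>"
proof (rule ccontr)
  assume "\<not> ?thesis"
  then have ge: "\<epsilon> \<le> F x" if "x \<in> I" for x using that by force
  have "integrable lebesgue (\<lambda>x. inverse \<epsilon> * (indicator I x *\<^sub>R F x))"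
    using F by (simp add: set_integrable_def)
  then have "integrable lebesgue (indicator I :: real \<Rightarrow> real)"
  proof (rule Bochner_Integration.integrable_bound)
    show "indicator I \<in> borel_measurable lebesgue"
      using I(1) by (rule borel_measurable_indicator)
    have "1 \<le> inverse \<epsilon> * \<bar>F x\<bar>" if "x \<in> I" for x
      using ge[OF that] \<open>\<epsilon> > 0\<close> by (simp add: field_simps)
    then show "AE x in lebesgue. norm (indicator I x :: real) \<le> norm (inverse \<epsilon> * (indicator I x *\<^sub>R F x))"
      using \<open>\<epsilon> > 0\<close> by (intro AE_I2) (auto simp: indicator_def abs_mult)
  qed
  then show False using I by (simp add: integrable_indicator_iff)
qed

lemma limit_of_extension:
  fixes g G :: "real \<Rightarrow> complex"
  assumes "(g \<longlongrightarrow> r) (at a within S)" "at a within S \<noteq> bot"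
    and "\<And>x. x \<in> S \<Longrightarrow> g x = G x" "isCont G a"
  shows "r = G a"
proof -
  have "(G \<longlongrightarrow> G a) (at a within S)"
    using assms(4) by (meson isCont_def tendsto_within_subset top_greatest)
  moreover have "(G \<longlongrightarrow> r) (at a within S)"
    using assms(1) by (rule Lim_transform_eventually)
      (use assms(3) in \<open>auto simp: eventually_at_filter\<close>)
  ultimately show ?thesis using assms(2) tendsto_unique by metis
qed

lemma soliton_continuous:
  assumes "lam > 0" "\<omega> > 0" "cmod c = 1"
  shows "isCont (\<lambda>x. c * soliton lam \<omega> y x) a" "isCont (\<lambda>x. c * soliton_deriv lam \<omega> y x) a"
  using nls_solution_soliton[OF assms, of UNIV y] unfolding nls_solution_def
  by (meson UNIV_I has_vector_derivative_continuous)+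

lemma nls_force_equation:
  "- W - of_real lam * of_real ((cmod z)\<^sup>2) * z + of_real \<omega> * z = 0 \<longleftrightarrow> W = nls_force lam \<omega> z"
  by (auto simp: nls_force_def scaleR_conv_of_real algebra_simps)

lemma continuous_on_nls_force:
  "continuous_on S g \<Longrightarrow> continuous_on S (\<lambda>x. nls_force lam \<omega> (g x))"
  unfolding nls_force_def by (intro continuous_intros)

lemma is_weak_deriv_weak_deriv:
  "is_weak_deriv \<Omega> u v \<Longrightarrow> is_weak_deriv \<Omega> u (weak_deriv \<Omega> u)"
  unfolding weak_deriv_def by (rule someI[of "is_weak_deriv \<Omega> u"])

text \<open>
  By uniqueness the chosen weak derivative \<open>V\<close> agrees with one that is square integrable and again
  weakly differentiable, so the choice \<open>W\<close> is a weak derivative of \<open>V\<close>. The equation shows that \<open>W\<close> has a continuous representative, so the regularity lemma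
  applies to both \<open>g\<close> and \<open>h\<close>.
\<close>

lemma stationary_profile_regular:
  assumes stat: "stationary_profile lam \<gamma> \<omega> \<phi>"
  obtains g h l r d where "AE x in lebesgue. \<phi> x = g x"
    "nls_solution lam \<omega> punctured_line g h"
    "set_integrable lebesgue punctured_line (\<lambda>x. (cmod (g x))\<^sup>2 + (cmod (h x))\<^sup>2)"
    "(g \<longlongrightarrow> l) (at_left 0)" "(g \<longlongrightarrow> r) (at_right 0)"
    "(h \<longlongrightarrow> d) (at_left 0)" "(h \<longlongrightarrow> d) (at_right 0)"
    "r - l = - of_real \<gamma> * d"
proof -
  let ?\<Omega> = "punctured_line"
  have "open ?\<Omega>" by (simp add: open_Compl)
  define V where "V = weak_deriv ?\<Omega> \<phi>"
  define W where "W = weak_deriv ?\<Omega> V"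
  from stat have dom: "dom_delta_prime \<gamma> \<phi>"
    and eqn: "AE x in lebesgue. W x = nls_force lam \<omega> (\<phi> x)"
    unfolding stationary_profile_def delta_prime_op_def nls_force_equation V_def W_def by blast+
  obtain g h l r d where g: "continuous_rep ?\<Omega> \<phi> g" and h: "continuous_rep ?\<Omega> V h"
    and lims: "(g \<longlongrightarrow> l) (at_left 0)" "(g \<longlongrightarrow> r) (at_right 0)"
      "(h \<longlongrightarrow> d) (at_left 0)" "(h \<longlongrightarrow> d) (at_right 0)" "r - l = - of_real \<gamma> * d"
    using dom unfolding dom_delta_prime_def V_def by blast
  obtain v w where \<phi>2: "in_L2 ?\<Omega> \<phi>" and v: "is_weak_deriv ?\<Omega> \<phi> v" "in_L2 ?\<Omega> v"
    and w: "is_weak_deriv ?\<Omega> v w"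
    using dom unfolding dom_delta_prime_def in_H2_def by blast
  have V: "is_weak_deriv ?\<Omega> \<phi> V"
    unfolding V_def by (rule is_weak_deriv_weak_deriv[OF v(1)])
  have vV: "AE x in lebesgue. x \<in> ?\<Omega> \<longrightarrow> v x = V x"
    by (rule weak_deriv_unique[OF \<open>open ?\<Omega>\<close> v(1) V])
  have "is_weak_deriv ?\<Omega> V w"
    using w vV by (rule is_weak_deriv_cong_AE) simp
  then have W: "is_weak_deriv ?\<Omega> V W"
    unfolding W_def by (rule is_weak_deriv_weak_deriv)
  from g h have gh_cont: "continuous_on ?\<Omega> g" "continuous_on ?\<Omega> h"
    and gh: "AE x in lebesgue. x \<in> ?\<Omega> \<longrightarrow> \<phi> x = g x" "AE x in lebesgue. x \<in> ?\<Omega> \<longrightarrow> V x = h x"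
    by (auto simp: continuous_rep_def)
  have \<phi>g: "AE x in lebesgue. \<phi> x = g x" by (rule AE_off_origin[OF gh(1)])
  have "AE x in lebesgue. x \<in> ?\<Omega> \<longrightarrow> W x = nls_force lam \<omega> (g x)"
    using eqn \<phi>g by eventually_elim simp
  with W gh(2) have h': "is_weak_deriv ?\<Omega> h (\<lambda>x. nls_force lam \<omega> (g x))"
    by (rule is_weak_deriv_cong_AE)
  have g': "is_weak_deriv ?\<Omega> g h"
    using V gh by (rule is_weak_deriv_cong_AE)
  have sol: "nls_solution lam \<omega> ?\<Omega> g h"
    unfolding nls_solution_def
    using weak_deriv_imp_derivative[OF \<open>open ?\<Omega>\<close> g' gh_cont]
      weak_deriv_imp_derivative[OF \<open>open ?\<Omega>\<close> h' gh_cont(2) continuous_on_nls_force[OF gh_cont(1)]]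
    by blast
  have "in_L2 ?\<Omega> g" using \<phi>2 gh(1) by (rule in_L2_cong_AE)
  moreover have "in_L2 ?\<Omega> h"
    using in_L2_cong_AE[OF in_L2_cong_AE[OF v(2) vV] gh(2)] .
  ultimately have "set_integrable lebesgue ?\<Omega> (\<lambda>x. (cmod (g x))\<^sup>2 + (cmod (h x))\<^sup>2)"
    by (auto simp: in_L2_def)
  with that[OF \<phi>g sol _ lims] show thesis by blast
qed

text \<open>
  If one half vanishes, then the boundary conditions give \<open>d = 0\<close> and \<open>l = r = 0\<close>, whereas a soliton is
  nonzero at the origin; so a nonzero profile is a soliton on both sides.
\<close>

lemma stationary_profile_two_sided:
  assumes pos: "lam > 0" "\<omega> > 0" and stat: "stationary_profile lam \<gamma> \<omega> \<phi>"
  obtains c1 y1 c2 y2 where "cmod c1 = 1" "cmod c2 = 1"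
    "delta_prime_matching lam \<gamma> \<omega> c1 y1 c2 y2"
    "AE x in lebesgue. \<phi> x = two_sided lam \<omega> c1 y1 c2 y2 x"
proof -
  obtain g h l r d where \<phi>g: "AE x in lebesgue. \<phi> x = g x"
    and sol: "nls_solution lam \<omega> punctured_line g h"
    and int: "set_integrable lebesgue punctured_line (\<lambda>x. (cmod (g x))\<^sup>2 + (cmod (h x))\<^sup>2)"
    and lims: "(g \<longlongrightarrow> l) (at_left 0)" "(g \<longlongrightarrow> r) (at_right 0)"
      "(h \<longlongrightarrow> d) (at_left 0)" "(h \<longlongrightarrow> d) (at_right 0)"
    and jump: "r - l = - of_real \<gamma> * d"
    using stationary_profile_regular[OF stat] by blast
  let ?zero = "\<lambda>I. \<forall>x\<in>I. g x = 0 \<and> h x = 0"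
  let ?soliton = "\<lambda>I c y. cmod c = 1 \<and>
    (\<forall>x\<in>I. g x = c * soliton lam \<omega> y x \<and> h x = c * soliton_deriv lam \<omega> y x)"
  have classify: "?zero I \<or> (\<exists>c y. ?soliton I c y)"
    if I: "I = {..<0} \<or> I = {0<..}" for I :: "real set"
  proof (rule nls_solution_classification[OF pos])
    have sub: "I \<subseteq> punctured_line" using I by auto
    show "is_interval I" using I by auto
    show "I \<noteq> {}" using I by (metis greaterThan_non_empty lessThan_non_empty)
    show "nls_solution lam \<omega> I g h" using sol sub by (auto simp: nls_solution_def)
    show "\<exists>x\<in>I. (cmod (g x))\<^sup>2 + (cmod (h x))\<^sup>2 < \<epsilon>" if "\<epsilon> > 0" for \<epsilon>
    proof (rule integrable_takes_small_values[OF _ _ _ that])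
      show "I \<in> sets lebesgue" using I by auto
      then show "set_integrable lebesgue I (\<lambda>x. (cmod (g x))\<^sup>2 + (cmod (h x))\<^sup>2)"
        by (rule set_integrable_subset[OF int _ sub])
      show "emeasure lebesgue I = \<infinity>" using I emeasure_half_line by auto
    qed
  qed
  have bot: "at_left (0::real) \<noteq> bot" "at_right (0::real) \<noteq> bot" by auto
  have zero_left: "l = 0 \<and> d = 0" if "?zero {..<0}"
    using limit_of_extension[OF lims(1) bot(1), of "\<lambda>_. 0"] limit_of_extension[OF lims(3) bot(1), of "\<lambda>_. 0"] that
    by auto
  have zero_right: "r = 0 \<and> d = 0" if "?zero {0<..}"
    using limit_of_extension[OF lims(2) bot(2), of "\<lambda>_. 0"] limit_of_extension[OF lims(4) bot(2), of "\<lambda>_. 0"] that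
    by auto
  have sol_left: "l = c * soliton lam \<omega> y 0 \<and> d = c * soliton_deriv lam \<omega> y 0" if "?soliton {..<0} c y" for c y
  proof
    show "l = c * soliton lam \<omega> y 0"
      by (rule limit_of_extension[where G = "\<lambda>x. c * soliton lam \<omega> y x", OF lims(1) bot(1)])
        (use that soliton_continuous[OF pos] in auto)
    show "d = c * soliton_deriv lam \<omega> y 0"
      by (rule limit_of_extension[where G = "\<lambda>x. c * soliton_deriv lam \<omega> y x", OF lims(3) bot(1)])
        (use that soliton_continuous[OF pos] in auto)
  qed
  have sol_right: "r = c * soliton lam \<omega> y 0 \<and> d = c * soliton_deriv lam \<omega> y 0" if "?soliton {0<..} c y" for c y
  proof
    show "r = c * soliton lam \<omega> y 0"
      by (rule limit_of_extension[where G = "\<lambda>x. c * soliton lam \<omega> y x", OF lims(2) bot(2)])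
        (use that soliton_continuous[OF pos] in auto)
    show "d = c * soliton_deriv lam \<omega> y 0"
      by (rule limit_of_extension[where G = "\<lambda>x. c * soliton_deriv lam \<omega> y x", OF lims(4) bot(2)])
        (use that soliton_continuous[OF pos] in auto)
  qed
  have nonzero: "c * soliton lam \<omega> y 0 \<noteq> 0" if "cmod c = 1" for c y
    using that soliton_ne_0[OF pos] by auto
  have not_both: "\<not> (?zero {..<0} \<and> ?zero {0<..})"
  proof
    assume "?zero {..<0} \<and> ?zero {0<..}"
    then have z: "g x = 0" if "x \<noteq> 0" for x using that by (cases "x < 0") auto
    have "AE x in lebesgue. \<phi> x = 0"
      using \<phi>g AE_lebesgue_neq[of 0] by eventually_elim (simp add: z)
    then show False using stat by (simp add: stationary_profile_def)
  qed
  have "\<not> ?zero {..<0}"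
  proof
    assume z: "?zero {..<0}"
    then obtain c y where s: "?soliton {0<..} c y" using classify[of "{0<..}"] not_both by blast
    from zero_left[OF z] jump have "r = 0" by simp
    then show False using sol_right[OF s] nonzero s by metis
  qed
  then obtain c1 y1 where s1: "?soliton {..<0} c1 y1" using classify[of "{..<0}"] by blast
  have "\<not> ?zero {0<..}"
  proof
    assume z: "?zero {0<..}"
    from zero_right[OF z] jump have "l = 0" by simp
    then show False using sol_left[OF s1] nonzero s1 by metis
  qed
  then obtain c2 y2 where s2: "?soliton {0<..} c2 y2" using classify[of "{0<..}"] by blast
  have "delta_prime_matching lam \<gamma> \<omega> c1 y1 c2 y2"
    using sol_left[OF s1] sol_right[OF s2] jump unfolding delta_prime_matching_def by metis
  moreover have "AE x in lebesgue. \<phi> x = two_sided lam \<omega> c1 y1 c2 y2 x"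
    using \<phi>g AE_lebesgue_neq[of 0]
    by eventually_elim (use s1 s2 in \<open>auto simp: two_sided_def\<close>)
  ultimately show thesis using that s1 s2 by blast
qed

text \<open>
  The antiderivative \<open>tanh\<close> has finite limits at both ends.
\<close>

lemma sech_square_integrable:
  assumes "\<omega> > 0"
  shows "integrable lebesgue (\<lambda>x. (sech (sqrt \<omega> * (x - y)))\<^sup>2)"
proof -
  define s where "s = sqrt \<omega>"
  have s: "s > 0" using assms by (simp add: s_def)
  define F where "F = (\<lambda>x. tanh (s * (x - y)) / s)"
  have F: "(F has_real_derivative (sech (s * (x - y)))\<^sup>2) (at x)" for x
    unfolding F_def sech_square using s
    by (auto intro!: derivative_eq_intros simp: cosh_real_pos less_imp_neq[symmetric])
  have cont: "isCont (\<lambda>x. (sech (s * (x - y)))\<^sup>2) x" for x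
    unfolding sech_def by (intro continuous_intros) (simp add: cosh_real_pos less_imp_neq[symmetric])
  have lim: "((\<lambda>x. tanh (s * (x - z)) / s) \<longlongrightarrow> 1 / s) at_top" for z
  proof -
    have "filterlim (\<lambda>x. - (s * z) + s * x) at_top at_top"
      by (intro filterlim_tendsto_add_at_top[OF tendsto_const]
          filterlim_tendsto_pos_mult_at_top[OF tendsto_const s filterlim_ident])
    then have "filterlim (\<lambda>x. s * (x - z)) at_top at_top"
      by (simp add: algebra_simps)
    from filterlim_compose[OF tanh_real_at_top this] show ?thesis
      by (intro tendsto_divide tendsto_const) (use s in auto)
  qed
  have top: "(F \<longlongrightarrow> 1 / s) at_top"
    unfolding F_def by (rule lim)
  have "F (- x) = - (tanh (s * (x - (- y))) / s)" for x
  proof -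
    have "s * (- x - y) = - (s * (x - (- y)))" by (simp add: algebra_simps)
    then show ?thesis by (simp only: F_def tanh_minus minus_divide_left)
  qed
  then have bot: "(F \<longlongrightarrow> - (1 / s)) at_bot"
    unfolding filterlim_at_bot_mirror by (simp only: tendsto_minus[OF lim])
  have "set_integrable lborel (einterval (-\<infinity>) \<infinity>) (\<lambda>x. (sech (s * (x - y)))\<^sup>2)"
    by (rule interval_integral_FTC_nonneg[of _ _ F _ "- (1 / s)" "1 / s"])
      (use F cont top bot in \<open>auto simp: ereal_tendsto_simps\<close>)
  then have "integrable lborel (\<lambda>x. (sech (s * (x - y)))\<^sup>2)"
    by (simp add: set_integrable_def)
  then show ?thesis
    by (simp add: integrable_completion borel_measurable_integrable s_def)
qed

text \<open>
  Profile, derivative and second derivative are all dominated by a multiple of the profile.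
\<close>

lemma in_L2_two_sided_bound:
  fixes u :: "real \<Rightarrow> complex"
  assumes pos: "lam > 0" "\<omega> > 0" and c: "cmod c1 = 1" "cmod c2 = 1"
    and cont: "continuous_on punctured_line u"
    and bound: "\<And>x. cmod (u x) \<le> K * cmod (two_sided lam \<omega> c1 y1 c2 y2 x)"
  shows "in_L2 punctured_line u"
proof -
  have meas: "set_borel_measurable lebesgue punctured_line f"
    if "continuous_on punctured_line f" for f :: "real \<Rightarrow> 'a::{banach, second_countable_topology}"
    unfolding set_borel_measurable_def
    using that by (intro measurable_completion) (simp add: borel_measurable_continuous_on_indicator)
  let ?S = "\<lambda>x. K\<^sup>2 * (2 * \<omega> / lam) * ((sech (sqrt \<omega> * (x - y1)))\<^sup>2 + (sech (sqrt \<omega> * (x - y2)))\<^sup>2)"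
  have "integrable lebesgue ?S"
    using sech_square_integrable[OF pos(2)] by (intro integrable_mult_right integrable_add) auto
  then have "set_integrable lebesgue punctured_line (\<lambda>x. (cmod (u x))\<^sup>2)"
    unfolding set_integrable_def
  proof (rule Bochner_Integration.integrable_bound)
    show "(\<lambda>x. indicat_real punctured_line x *\<^sub>R (cmod (u x))\<^sup>2) \<in> borel_measurable lebesgue"
      using meas[of "\<lambda>x. (cmod (u x))\<^sup>2"] cont unfolding set_borel_measurable_def
      by (simp add: continuous_intros)
    have le: "(cmod (u x))\<^sup>2 \<le> ?S x" for x
    proof -
      have "(cmod (u x))\<^sup>2 \<le> (K * cmod (two_sided lam \<omega> c1 y1 c2 y2 x))\<^sup>2"
        using bound by (intro power_mono) auto
      also have "\<dots> = K\<^sup>2 * (2 * \<omega> / lam) * (if x < 0 then (sech (sqrt \<omega> * (x - y1)))\<^sup>2 else (sech (sqrt \<omega> * (x - y2)))\<^sup>2)"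
        using pos c by (simp add: two_sided_def norm_mult cmod_soliton[OF pos] power_mult_distrib del: real_sqrt_divide)
      also have "\<dots> \<le> ?S x"
        using pos by (intro mult_left_mono) auto
      finally show ?thesis .
    qed
    have "norm (indicat_real punctured_line x *\<^sub>R (cmod (u x))\<^sup>2) \<le> (cmod (u x))\<^sup>2" for x
      by (simp add: indicator_def)
    also note le
    also have "?S x \<le> norm (?S x)" for x
      unfolding real_norm_def by (rule abs_ge_self)
    finally show "AE x in lebesgue. norm (indicat_real punctured_line x *\<^sub>R (cmod (u x))\<^sup>2) \<le> norm (?S x)"
      by (rule AE_I2)
  qed
  then show ?thesis using meas[OF cont] by (simp add: in_L2_def)
qed

lemma two_sided_solution:
  assumes pos: "lam > 0" "\<omega> > 0" and c: "cmod c1 = 1" "cmod c2 = 1"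
  shows "nls_solution lam \<omega> punctured_line (two_sided lam \<omega> c1 y1 c2 y2) (two_sided_deriv lam \<omega> c1 y1 c2 y2)"
  unfolding nls_solution_def
proof (intro ballI)
  fix x :: real assume "x \<in> punctured_line"
  let ?P = "two_sided lam \<omega> c1 y1 c2 y2" and ?P' = "two_sided_deriv lam \<omega> c1 y1 c2 y2"
  have *: "(?P has_vector_derivative ?P' x) (at x) \<and> (?P' has_vector_derivative nls_force lam \<omega> (?P x)) (at x)"
    if I: "open I" "x \<in> I" "cmod c = 1"
      and eq: "\<And>z. z \<in> I \<Longrightarrow> ?P z = c * soliton lam \<omega> y z \<and> ?P' z = c * soliton_deriv lam \<omega> y z" for I c y
  proof -
    have sol: "((\<lambda>x. c * soliton lam \<omega> y x) has_vector_derivative c * soliton_deriv lam \<omega> y x) (at x)"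
      "((\<lambda>x. c * soliton_deriv lam \<omega> y x) has_vector_derivative nls_force lam \<omega> (c * soliton lam \<omega> y x)) (at x)"
      using nls_solution_soliton[OF pos I(3), of I y] I(2) unfolding nls_solution_def by auto
    have eq': "c * soliton lam \<omega> y z = ?P z" "c * soliton_deriv lam \<omega> y z = ?P' z" if "z \<in> I" for z
      using eq[OF that] by auto
    show ?thesis
      using has_vector_derivative_transform_within_open[OF sol(1) I(1,2) eq'(1)]
        has_vector_derivative_transform_within_open[OF sol(2) I(1,2) eq'(2)]
      unfolding eq'[OF I(2)] by blast
  qed
  show "(?P has_vector_derivative ?P' x) (at x) \<and> (?P' has_vector_derivative nls_force lam \<omega> (?P x)) (at x)"
  proof (cases "x < 0")
    case True
    then show ?thesis
      by (intro *[of "{..<0}" c1 y1]) (auto simp: two_sided_def two_sided_deriv_def c)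
  next
    case False
    then show ?thesis using \<open>x \<in> punctured_line\<close>
      by (intro *[of "{0<..}" c2 y2]) (auto simp: two_sided_def two_sided_deriv_def c)
  qed
qed

lemma two_sided_stationary:
  assumes pos: "lam > 0" "\<omega> > 0" and c: "cmod c1 = 1" "cmod c2 = 1"
    and match: "delta_prime_matching lam \<gamma> \<omega> c1 y1 c2 y2"
    and \<phi>: "AE x in lebesgue. \<phi> x = two_sided lam \<omega> c1 y1 c2 y2 x"
  shows "stationary_profile lam \<gamma> \<omega> \<phi>"
proof -
  let ?\<Omega> = "punctured_line"
  define P P' P'' where "P = two_sided lam \<omega> c1 y1 c2 y2" and "P' = two_sided_deriv lam \<omega> c1 y1 c2 y2"
    and "P'' = (\<lambda>x. nls_force lam \<omega> (P x))"
  have "open ?\<Omega>" by (simp add: open_Compl)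
  have P: "(P has_vector_derivative P' x) (at x)" and P': "(P' has_vector_derivative P'' x) (at x)"
    if "x \<in> ?\<Omega>" for x
    using two_sided_solution[OF pos c, of y1 y2] that by (auto simp: nls_solution_def P_def P'_def P''_def)
  have cont: "continuous_on ?\<Omega> P" "continuous_on ?\<Omega> P'"
    using P P' by (meson continuous_at_imp_continuous_on has_vector_derivative_continuous)+
  have cont'': "continuous_on ?\<Omega> P''"
    unfolding P''_def by (rule continuous_on_nls_force[OF cont(1)])
  have amp: "(cmod (P x))\<^sup>2 \<le> 2 * \<omega> / lam" for x
  proof -
    have "(cmod (P x))\<^sup>2 = (2 * \<omega> / lam) * (sech (sqrt \<omega> * (x - (if x < 0 then y1 else y2))))\<^sup>2"
      using pos c by (simp add: P_def two_sided_def norm_mult cmod_soliton[OF pos] power_mult_distrib del: real_sqrt_divide)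
    also have "\<dots> \<le> 2 * \<omega> / lam * 1"
      using pos by (intro mult_left_mono) (auto simp: sech_square)
    finally show ?thesis by simp
  qed
  have L2: "in_L2 ?\<Omega> P" "in_L2 ?\<Omega> P'" "in_L2 ?\<Omega> P''"
  proof -
    show "in_L2 ?\<Omega> P"
      by (rule in_L2_two_sided_bound[OF pos c cont(1), of 1 y1 y2]) (simp add: P_def)
    show "in_L2 ?\<Omega> P'"
    proof (rule in_L2_two_sided_bound[OF pos c cont(2), of "sqrt \<omega>"])
      have "\<bar>tanh u\<bar> \<le> 1" for u :: real
        using tanh_real_bounds[of u] by auto
      then have "cmod (soliton_deriv lam \<omega> y x) \<le> sqrt \<omega> * cmod (soliton lam \<omega> y x)" for y x
        using pos by (simp add: soliton_deriv_def norm_mult abs_mult mult_right_mono mult_left_le)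
      then show "cmod (P' x) \<le> sqrt \<omega> * cmod (two_sided lam \<omega> c1 y1 c2 y2 x)" for x
        by (simp add: P'_def two_sided_deriv_def two_sided_def norm_mult c)
    qed
    show "in_L2 ?\<Omega> P''"
    proof (rule in_L2_two_sided_bound[OF pos c cont'', of "3 * \<omega>"])
      fix x
      have "lam * (cmod (P x))\<^sup>2 \<le> 2 * \<omega>"
        using amp[of x] pos by (simp add: field_simps)
      moreover have "lam * (cmod (P x))\<^sup>2 \<ge> 0" using pos by simp
      ultimately have "\<bar>\<omega> - lam * (cmod (P x))\<^sup>2\<bar> \<le> 3 * \<omega>" using pos by linarith
      then show "cmod (P'' x) \<le> 3 * \<omega> * cmod (two_sided lam \<omega> c1 y1 c2 y2 x)"
        unfolding P''_def nls_force_def P_def[symmetric] norm_scaleR by (rule mult_right_mono) simp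
    qed
  qed
  have \<phi>P: "AE x in lebesgue. x \<in> ?\<Omega> \<longrightarrow> P x = \<phi> x"
    using \<phi> by eventually_elim (simp add: P_def)
  have wP: "is_weak_deriv ?\<Omega> P P'" and wP': "is_weak_deriv ?\<Omega> P' P''"
    using is_weak_deriv_of_derivative P P' cont(2) cont'' by blast+
  have w\<phi>: "is_weak_deriv ?\<Omega> \<phi> P'"
    using wP \<phi>P by (rule is_weak_deriv_cong_AE) simp
  have H2: "in_H2 ?\<Omega> \<phi>"
    unfolding in_H2_def using w\<phi> wP' L2 in_L2_cong_AE[OF L2(1) \<phi>P] by blast
  define V W where "V = weak_deriv ?\<Omega> \<phi>" and "W = weak_deriv ?\<Omega> V"
  have "is_weak_deriv ?\<Omega> \<phi> V"
    unfolding V_def by (rule is_weak_deriv_weak_deriv[OF w\<phi>])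
  from weak_deriv_unique[OF \<open>open ?\<Omega>\<close> w\<phi> this]
  have P'V: "AE x in lebesgue. x \<in> ?\<Omega> \<longrightarrow> P' x = V x" .
  have wV: "is_weak_deriv ?\<Omega> V P''"
    using wP' P'V by (rule is_weak_deriv_cong_AE) simp
  then have "is_weak_deriv ?\<Omega> V W"
    unfolding W_def by (rule is_weak_deriv_weak_deriv)
  from weak_deriv_unique[OF \<open>open ?\<Omega>\<close> wV this]
  have P''W: "AE x in lebesgue. x \<in> ?\<Omega> \<longrightarrow> P'' x = W x" .
  have lims: "(P \<longlongrightarrow> c1 * soliton lam \<omega> y1 0) (at_left 0)" "(P \<longlongrightarrow> c2 * soliton lam \<omega> y2 0) (at_right 0)"
    "(P' \<longlongrightarrow> c1 * soliton_deriv lam \<omega> y1 0) (at_left 0)" "(P' \<longlongrightarrow> c2 * soliton_deriv lam \<omega> y2 0) (at_right 0)"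
  proof -
    have *: "(f \<longlongrightarrow> G 0) (at 0 within S)" if "isCont G 0" "\<And>x. x \<in> S \<Longrightarrow> G x = f x"
      for f G :: "real \<Rightarrow> complex" and S
    proof -
      have "(G \<longlongrightarrow> G 0) (at 0 within S)"
        using that(1) by (meson isCont_def tendsto_within_subset top_greatest)
      then show ?thesis
        by (rule Lim_transform_eventually) (use that(2) in \<open>auto simp: eventually_at_filter\<close>)
    qed
    show "(P \<longlongrightarrow> c1 * soliton lam \<omega> y1 0) (at_left 0)"
      by (rule *[OF soliton_continuous(1)[OF pos c(1)]]) (simp add: P_def two_sided_def)
    show "(P \<longlongrightarrow> c2 * soliton lam \<omega> y2 0) (at_right 0)"
      by (rule *[OF soliton_continuous(1)[OF pos c(2)]]) (simp add: P_def two_sided_def)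
    show "(P' \<longlongrightarrow> c1 * soliton_deriv lam \<omega> y1 0) (at_left 0)"
      by (rule *[OF soliton_continuous(2)[OF pos c(1)]]) (simp add: P'_def two_sided_deriv_def)
    show "(P' \<longlongrightarrow> c2 * soliton_deriv lam \<omega> y2 0) (at_right 0)"
      by (rule *[OF soliton_continuous(2)[OF pos c(2)]]) (simp add: P'_def two_sided_deriv_def)
  qed
  have reps: "continuous_rep ?\<Omega> \<phi> P" "continuous_rep ?\<Omega> V P'"
    unfolding continuous_rep_def using cont \<phi>P P'V by (auto elim: eventually_mono)
  have "dom_delta_prime \<gamma> \<phi>"
    unfolding dom_delta_prime_def V_def[symmetric]
    using H2 reps lims match[unfolded delta_prime_matching_def] by blast
  moreover have "\<not> (AE x in lebesgue. \<phi> x = 0)"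
  proof
    assume "AE x in lebesgue. \<phi> x = 0"
    with \<phi> have "AE x::real in lebesgue. False"
      by eventually_elim
        (use soliton_ne_0[OF pos] c in \<open>auto simp: two_sided_def split: if_splits\<close>)
    then have "{..<0::real} \<in> null_sets lebesgue"
      by (subst AE_iff_null_sets) (auto elim: eventually_mono)
    then show False using emeasure_half_line(2) by (simp add: null_sets_def)
  qed
  moreover have "AE x in lebesgue. delta_prime_op \<phi> x - of_real lam * of_real ((cmod (\<phi> x))\<^sup>2) * \<phi> x
      + of_real \<omega> * \<phi> x = 0"
    unfolding delta_prime_op_def V_def[symmetric] W_def[symmetric] nls_force_equation
    using \<phi> AE_off_origin[OF P''W] by eventually_elim (simp add: P''_def P_def)
  ultimately show ?thesis unfolding stationary_profile_def by blast
qed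

lemma stationary_profile_iff:
  assumes "lam > 0" "\<omega> > 0"
  shows "stationary_profile lam \<gamma> \<omega> \<phi> \<longleftrightarrow>
    (\<exists>c1 y1 c2 y2. cmod c1 = 1 \<and> cmod c2 = 1 \<and> delta_prime_matching lam \<gamma> \<omega> c1 y1 c2 y2 \<and>
      (AE x in lebesgue. \<phi> x = two_sided lam \<omega> c1 y1 c2 y2 x))"
proof
  assume "stationary_profile lam \<gamma> \<omega> \<phi>"
  from stationary_profile_two_sided[OF assms this]
  show "\<exists>c1 y1 c2 y2. cmod c1 = 1 \<and> cmod c2 = 1 \<and> delta_prime_matching lam \<gamma> \<omega> c1 y1 c2 y2 \<and>
      (AE x in lebesgue. \<phi> x = two_sided lam \<omega> c1 y1 c2 y2 x)"
    by metis
next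
  show "stationary_profile lam \<gamma> \<omega> \<phi>"
    if "\<exists>c1 y1 c2 y2. cmod c1 = 1 \<and> cmod c2 = 1 \<and> delta_prime_matching lam \<gamma> \<omega> c1 y1 c2 y2 \<and>
      (AE x in lebesgue. \<phi> x = two_sided lam \<omega> c1 y1 c2 y2 x)"
    using that by (elim exE conjE) (rule two_sided_stationary[OF assms])
qed

lemma equal_up_to_phase_iff:
  "equal_up_to_phase \<phi> \<psi> \<longleftrightarrow> (\<exists>c. cmod c = 1 \<and> (AE x in lebesgue. \<phi> x = c * \<psi> x))"
proof -
  have "\<exists>\<theta>. c = cis \<theta>" if "cmod c = 1" for c
    using that rcis_cmod_Arg[of c] by (metis cis_rcis_eq)
  then show ?thesis
    unfolding equal_up_to_phase_def by (metis norm_cis)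
qed

lemma equal_up_to_phase_two_sided:
  "equal_up_to_phase \<phi> (soliton lam \<omega> 0) \<longleftrightarrow>
    (\<exists>c. cmod c = 1 \<and> (AE x in lebesgue. \<phi> x = two_sided lam \<omega> c 0 c 0 x))"
  "equal_up_to_phase \<phi> (same_sign_profile lam \<omega> y1 y2) \<longleftrightarrow>
    (\<exists>c. cmod c = 1 \<and> (AE x in lebesgue. \<phi> x = two_sided lam \<omega> c y1 c y2 x))"
  "equal_up_to_phase \<phi> (minus_plus_profile lam \<omega> y1 y2) \<longleftrightarrow>
    (\<exists>c. cmod c = 1 \<and> (AE x in lebesgue. \<phi> x = two_sided lam \<omega> (- c) y1 c y2 x))"
  "equal_up_to_phase \<phi> (plus_minus_profile lam \<omega> y1 y2) \<longleftrightarrow>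
    (\<exists>c. cmod c = 1 \<and> (AE x in lebesgue. \<phi> x = two_sided lam \<omega> (- c) y1 c y2 x))"
proof -
  have 1: "c * soliton lam \<omega> 0 x = two_sided lam \<omega> c 0 c 0 x" for c x
    by (simp add: two_sided_def)
  have 2: "c * same_sign_profile lam \<omega> y1 y2 x = two_sided lam \<omega> c y1 c y2 x" for c x
    by (simp add: two_sided_def same_sign_profile_def)
  have 3: "c * minus_plus_profile lam \<omega> y1 y2 x = two_sided lam \<omega> (- c) y1 c y2 x" for c x
    by (simp add: two_sided_def minus_plus_profile_def)
  have 4: "c * plus_minus_profile lam \<omega> y1 y2 x = two_sided lam \<omega> (- (- c)) y1 (- c) y2 x" for c x
    by (simp add: two_sided_def plus_minus_profile_def)
  show "equal_up_to_phase \<phi> (soliton lam \<omega> 0) \<longleftrightarrow>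
    (\<exists>c. cmod c = 1 \<and> (AE x in lebesgue. \<phi> x = two_sided lam \<omega> c 0 c 0 x))"
    "equal_up_to_phase \<phi> (same_sign_profile lam \<omega> y1 y2) \<longleftrightarrow>
    (\<exists>c. cmod c = 1 \<and> (AE x in lebesgue. \<phi> x = two_sided lam \<omega> c y1 c y2 x))"
    "equal_up_to_phase \<phi> (minus_plus_profile lam \<omega> y1 y2) \<longleftrightarrow>
    (\<exists>c. cmod c = 1 \<and> (AE x in lebesgue. \<phi> x = two_sided lam \<omega> (- c) y1 c y2 x))"
    unfolding equal_up_to_phase_iff 1 2 3 by (rule refl)+
  have "(\<exists>c. cmod c = 1 \<and> Q (- c)) \<longleftrightarrow> (\<exists>c. cmod c = 1 \<and> Q c)" for Q
    by (metis minus_minus norm_minus_cancel)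
  from this[of "\<lambda>c. AE x in lebesgue. \<phi> x = two_sided lam \<omega> (- c) y1 c y2 x"]
  show "equal_up_to_phase \<phi> (plus_minus_profile lam \<omega> y1 y2) \<longleftrightarrow>
    (\<exists>c. cmod c = 1 \<and> (AE x in lebesgue. \<phi> x = two_sided lam \<omega> (- c) y1 c y2 x))"
    unfolding equal_up_to_phase_iff 4 .
qed

text \<open>
  The moduli of two solitons with different centres agree at the midpoint of the centres only.
\<close>

lemma not_equal_up_to_phase:
  assumes pos: "lam > 0" "\<omega> > 0" and "y \<noteq> y'"
    and \<phi>: "\<And>x. x < 0 \<Longrightarrow> cmod (\<phi> x) = cmod (soliton lam \<omega> y x)"
    and \<psi>: "\<And>x. x < 0 \<Longrightarrow> cmod (\<psi> x) = cmod (soliton lam \<omega> y' x)"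
  shows "\<not> equal_up_to_phase \<phi> \<psi>"
proof
  assume "equal_up_to_phase \<phi> \<psi>"
  then obtain c where c: "cmod c = 1" and eq: "AE x in lebesgue. \<phi> x = c * \<psi> x"
    by (auto simp: equal_up_to_phase_iff)
  have midpoint: "x = (y + y') / 2" if x: "x < 0" "\<phi> x = c * \<psi> x" for x
  proof -
    have "cmod (soliton lam \<omega> y x) = cmod (soliton lam \<omega> y' x)"
      using x c \<phi> \<psi> by (metis mult_1 norm_mult)
    then have "cosh \<bar>sqrt \<omega> * (x - y)\<bar> = cosh \<bar>sqrt \<omega> * (x - y')\<bar>"
      using pos by (simp add: cmod_soliton sech_def)
    then have "\<bar>sqrt \<omega> * (x - y)\<bar> = \<bar>sqrt \<omega> * (x - y')\<bar>"
      by (metis abs_ge_zero arcosh_cosh_real)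
    then have "\<bar>x - y\<bar> = \<bar>x - y'\<bar>" using pos by (simp add: abs_mult)
    then show ?thesis using \<open>y \<noteq> y'\<close> by (auto simp: abs_if split: if_splits)
  qed
  have "AE x in lebesgue. x \<notin> {..<0::real}"
    using eq AE_lebesgue_neq[of "(y + y') / 2"] by eventually_elim (use midpoint in auto)
  then have "{..<0::real} \<in> null_sets lebesgue"
    by (subst AE_iff_null_sets) auto
  then show False using emeasure_half_line(2) by (simp add: null_sets_def)
qed

lemma shift_pos: "\<omega> > 0 \<Longrightarrow> 0 < t \<Longrightarrow> t < 1 \<Longrightarrow> shift \<omega> t > 0"
  by (simp add: shift_def)

theorem theorem3p3:
  fixes lam \<gamma> \<omega> :: real
  assumes "lam > 0" and "\<gamma> > 0" and "\<omega> > 0"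
  shows
    "(\<exists>!(t1, t2). same_sign_system \<gamma> \<omega> t1 t2) \<and>
     (\<omega> > 8 / \<gamma>^2 \<longrightarrow> (\<exists>!(t1, t2). changing_sign_system \<gamma> \<omega> t1 t2)) \<and>
     (\<forall>t1 t2. same_sign_system \<gamma> \<omega> t1 t2 \<longrightarrow>
        \<not> equal_up_to_phase
            (same_sign_profile lam \<omega> (shift \<omega> t1) (shift \<omega> t2))
            (same_sign_profile lam \<omega> (- shift \<omega> t2) (- shift \<omega> t1))) \<and>
     (\<forall>t1 t2. \<omega> > 8 / \<gamma>^2 \<and> changing_sign_system \<gamma> \<omega> t1 t2 \<longrightarrow>
        \<not> equal_up_to_phase
            (plus_minus_profile lam \<omega> (shift \<omega> t1) (- shift \<omega> t2))
            (plus_minus_profile lam \<omega> (shift \<omega> t2) (- shift \<omega> t1))) \<and>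
     (\<forall>\<phi>. stationary_profile lam \<gamma> \<omega> \<phi> \<longleftrightarrow>
        equal_up_to_phase \<phi> (soliton lam \<omega> 0) \<or>
        (\<exists>t1 t2. same_sign_system \<gamma> \<omega> t1 t2 \<and>
           (equal_up_to_phase \<phi> (same_sign_profile lam \<omega> (shift \<omega> t1) (shift \<omega> t2)) \<or>
            equal_up_to_phase \<phi> (same_sign_profile lam \<omega> (- shift \<omega> t2) (- shift \<omega> t1)))) \<or>
        (\<omega> > 4 / \<gamma>^2 \<and>
           equal_up_to_phase \<phi>
             (minus_plus_profile lam \<omega> (antisym_shift \<gamma> \<omega>) (- antisym_shift \<gamma> \<omega>))) \<or>
        (\<omega> > 8 / \<gamma>^2 \<and>
           (\<exists>t1 t2. changing_sign_system \<gamma> \<omega> t1 t2 \<and>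
              (equal_up_to_phase \<phi> (plus_minus_profile lam \<omega> (shift \<omega> t1) (- shift \<omega> t2)) \<or>
               equal_up_to_phase \<phi> (plus_minus_profile lam \<omega> (shift \<omega> t2) (- shift \<omega> t1))))))"
proof (intro conjI allI impI)
  note pos = assms
  show "\<exists>!(t1, t2). same_sign_system \<gamma> \<omega> t1 t2"
    by (rule ex1_same_sign_system[OF pos(2,3)])
  show "\<exists>!(t1, t2). changing_sign_system \<gamma> \<omega> t1 t2" if "\<omega> > 8 / \<gamma>^2"
    by (rule ex1_changing_sign_system[OF pos(2,3) that])
next
  fix t1 t2
  assume "same_sign_system \<gamma> \<omega> t1 t2"
  then have t: "0 < t1" "0 < t2" "t1\<^sup>2 + t2\<^sup>2 = 1"
    by (simp_all add: same_sign_system_iff[OF assms(2,3)])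
  then have "shift \<omega> t1 > 0" "shift \<omega> t2 > 0"
    using system_bounds[OF t(3,1,2)] assms by (simp_all add: shift_pos)
  then show "\<not> equal_up_to_phase
            (same_sign_profile lam \<omega> (shift \<omega> t1) (shift \<omega> t2))
            (same_sign_profile lam \<omega> (- shift \<omega> t2) (- shift \<omega> t1))"
    by (intro not_equal_up_to_phase[OF assms(1,3), of "shift \<omega> t1" "- shift \<omega> t2"])
      (auto simp: same_sign_profile_def)
next
  fix t1 t2
  assume "\<omega> > 8 / \<gamma>^2 \<and> changing_sign_system \<gamma> \<omega> t1 t2"
  then have t: "0 < t2" "t2 < t1" "t1\<^sup>2 + t2\<^sup>2 = 1"
    by (simp_all add: changing_sign_system_iff[OF assms(2,3)])
  then have "\<bar>t1\<bar> < 1" "\<bar>t2\<bar> < 1" using system_bounds[of t1 t2] by auto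
  then have "shift \<omega> t1 \<noteq> shift \<omega> t2"
    using tanh_shift[OF assms(3)] t(2) by (metis less_irrefl)
  then show "\<not> equal_up_to_phase
            (plus_minus_profile lam \<omega> (shift \<omega> t1) (- shift \<omega> t2))
            (plus_minus_profile lam \<omega> (shift \<omega> t2) (- shift \<omega> t1))"
    by (intro not_equal_up_to_phase[OF assms(1,3), of "shift \<omega> t1" "shift \<omega> t2"])
      (auto simp: plus_minus_profile_def)
next
  fix \<phi> :: "real \<Rightarrow> complex"
  let ?eq = "\<lambda>c1 y1 c2 y2. AE x in lebesgue. \<phi> x = two_sided lam \<omega> c1 y1 c2 y2 x"
  have "stationary_profile lam \<gamma> \<omega> \<phi> \<longleftrightarrow>
      (\<exists>c1 y1 c2 y2. cmod c1 = 1 \<and> cmod c2 = 1 \<and>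
        (c1 = c2 \<and> y1 = 0 \<and> y2 = 0 \<or>
        c1 = c2 \<and> (\<exists>t1 t2. same_sign_system \<gamma> \<omega> t1 t2 \<and>
          (y1 = shift \<omega> t1 \<and> y2 = shift \<omega> t2 \<or> y1 = - shift \<omega> t2 \<and> y2 = - shift \<omega> t1)) \<or>
        c1 = - c2 \<and> \<omega> > 4 / \<gamma>^2 \<and> y1 = antisym_shift \<gamma> \<omega> \<and> y2 = - antisym_shift \<gamma> \<omega> \<or>
        c1 = - c2 \<and> \<omega> > 8 / \<gamma>^2 \<and> (\<exists>t1 t2. changing_sign_system \<gamma> \<omega> t1 t2 \<and>
          (y1 = shift \<omega> t1 \<and> y2 = - shift \<omega> t2 \<or> y1 = shift \<omega> t2 \<and> y2 = - shift \<omega> t1))) \<and>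
        ?eq c1 y1 c2 y2)"
    unfolding stationary_profile_iff[OF assms(1,3)]
    using delta_prime_matching_iff[OF assms] by (intro ex_cong1 conj_cong refl) auto
  also have "\<dots> \<longleftrightarrow>
      (\<exists>c. cmod c = 1 \<and> ?eq c 0 c 0) \<or>
      (\<exists>t1 t2. same_sign_system \<gamma> \<omega> t1 t2 \<and>
        ((\<exists>c. cmod c = 1 \<and> ?eq c (shift \<omega> t1) c (shift \<omega> t2)) \<or>
         (\<exists>c. cmod c = 1 \<and> ?eq c (- shift \<omega> t2) c (- shift \<omega> t1)))) \<or>
      (\<omega> > 4 / \<gamma>^2 \<and> (\<exists>c. cmod c = 1 \<and> ?eq (- c) (antisym_shift \<gamma> \<omega>) c (- antisym_shift \<gamma> \<omega>))) \<or>
      (\<omega> > 8 / \<gamma>^2 \<and> (\<exists>t1 t2. changing_sign_system \<gamma> \<omega> t1 t2 \<and>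
        ((\<exists>c. cmod c = 1 \<and> ?eq (- c) (shift \<omega> t1) c (- shift \<omega> t2)) \<or>
         (\<exists>c. cmod c = 1 \<and> ?eq (- c) (shift \<omega> t2) c (- shift \<omega> t1)))))"
    (is "?L \<longleftrightarrow> ?R")
  proof
    assume ?L
    then show ?R by (elim exE conjE disjE) blast+
  next
    have "cmod (- c) = 1" if "cmod c = 1" for c using that by simp
    moreover assume ?R
    ultimately show ?L by (elim exE conjE disjE) blast+
  qed
  finally show "stationary_profile lam \<gamma> \<omega> \<phi> \<longleftrightarrow>
        equal_up_to_phase \<phi> (soliton lam \<omega> 0) \<or>
        (\<exists>t1 t2. same_sign_system \<gamma> \<omega> t1 t2 \<and>
           (equal_up_to_phase \<phi> (same_sign_profile lam \<omega> (shift \<omega> t1) (shift \<omega> t2)) \<or>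
            equal_up_to_phase \<phi> (same_sign_profile lam \<omega> (- shift \<omega> t2) (- shift \<omega> t1)))) \<or>
        (\<omega> > 4 / \<gamma>^2 \<and>
           equal_up_to_phase \<phi>
             (minus_plus_profile lam \<omega> (antisym_shift \<gamma> \<omega>) (- antisym_shift \<gamma> \<omega>))) \<or>
        (\<omega> > 8 / \<gamma>^2 \<and>
           (\<exists>t1 t2. changing_sign_system \<gamma> \<omega> t1 t2 \<and>
              (equal_up_to_phase \<phi> (plus_minus_profile lam \<omega> (shift \<omega> t1) (- shift \<omega> t2)) \<or>
               equal_up_to_phase \<phi> (plus_minus_profile lam \<omega> (shift \<omega> t2) (- shift \<omega> t1)))))"
    unfolding equal_up_to_phase_two_sided .
qed

end
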